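(* For every $\varepsilon > 0$, there exist algorithms for SMKS that achieve approximation ratio $[(1 + O(\varepsilon))(p + 1 + \tfrac{7}{4}d)]^{-1}$ in $\tilde{O}(nd + n/\varepsilon)$ time, and approximation ratio $(p + 1.5556 + \tfrac{13}{9}d + \varepsilon)^{-1}$ in $\tilde{O}(n^2 + nd)$ time, respectively, where $\tilde{O}$ suppresses factors that are poly-logarithmic in $n$, $d$ and $\varepsilon^{-1}$.
   Context: A set system $(\mathcal{N}, \mathcal{I})$ has a finite ground set $\mathcal{N}$ ($|\mathcal{N}| = n$) and a non-empty family $\mathcal{I} \subseteq 2^{\mathcal{N}}$ of independent sets closed under subsets. A base of $S \subseteq \mathcal{N}$ is an inclusion-maximal independent subset of $S$. The system is a $p$-set system (integer $p \geq 1$) if for every $S \subseteq \mathcal{N}$ the ratio between the sizes of the largest and the smallest base of $S$ is at most $p$. SMKS: given a non-negative monotone submodular $f\colon 2^{\mathcal{N}} \to \mathbb{R}_{\geq 0}$ (value oracle), a $p$-set system $(\mathcal{N}, \mathcal{I})$ (independence oracle), $d \geq 1$ non-negative cost functions $c_i\colon \mathcal{N} \to \mathbb{R}_{\geq 0}$ and positive budgets $B_1, \dots, B_d$, find a set $S \in \mathcal{I}$ with $\sum_{u \in S} c_i(u) \leq B_i$ for all $1 \leq i \leq d$ maximizing $f(S)$. An approximation ratio $\gamma$ means the output is feasible and has value at least $\gamma \cdot f(OPT)$ for an optimal $OPT$. Running time counts oracle queries as unit-cost operations. *)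

theory Defs
  imports Complex_Main
begin

section \<open>Set systems and set functions\<close>

definition set_system :: "'a set \<Rightarrow> 'a set set \<Rightarrow> bool" where
  "set_system N \<I> \<longleftrightarrow> finite N \<and> \<I> \<subseteq> Pow N \<and> \<I> \<noteq> {} \<and> (\<forall>A\<in>\<I>. \<forall>B\<subseteq>A. B \<in> \<I>)"

definition is_base :: "'a set set \<Rightarrow> 'a set \<Rightarrow> 'a set \<Rightarrow> bool" where
  "is_base \<I> S B \<longleftrightarrow> B \<in> \<I> \<and> B \<subseteq> S \<and> (\<forall>A\<in>\<I>. B \<subseteq> A \<and> A \<subseteq> S \<longrightarrow> A = B)"

text \<open>
  The bound on the ratio is multiplied out. If the smallest base of \<open>S\<close> is empty then it is the
  only base, so the ratio 0/0 is harmless.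
\<close>

definition p_set_system :: "nat \<Rightarrow> 'a set \<Rightarrow> 'a set set \<Rightarrow> bool" where
  "p_set_system p N \<I> \<longleftrightarrow> set_system N \<I> \<and>
     (\<forall>S\<subseteq>N. Max (card ` {B. is_base \<I> S B}) \<le> p * Min (card ` {B. is_base \<I> S B}))"

definition monotone_set_fun :: "'a set \<Rightarrow> ('a set \<Rightarrow> real) \<Rightarrow> bool" where
  "monotone_set_fun N f \<longleftrightarrow> (\<forall>A B. A \<subseteq> B \<and> B \<subseteq> N \<longrightarrow> f A \<le> f B)"

definition submodular :: "'a set \<Rightarrow> ('a set \<Rightarrow> real) \<Rightarrow> bool" where
  "submodular N f \<longleftrightarrow>
     (\<forall>A B. A \<subseteq> N \<and> B \<subseteq> N \<longrightarrow> f (A \<union> B) + f (A \<inter> B) \<le> f A + f B)"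


section \<open>The problem SMKS\<close>

text \<open>
  As is usual for inputs of algorithms, the elements are numbered: the ground set is
  \<open>{..<n}\<close>. The knapsacks are numbered from 0 to \<open>d - 1\<close>, and \<open>cost x i u\<close> is the cost of element
  \<open>u\<close> in knapsack \<open>i\<close>.
\<close>

record smks =
  gsize :: nat
  objective :: "nat set \<Rightarrow> real"
  indep :: "nat set set"
  pparam :: nat
  knapsacks :: nat
  cost :: "nat \<Rightarrow> nat \<Rightarrow> real"
  budget :: "nat \<Rightarrow> real"

definition ground :: "smks \<Rightarrow> nat set" where
  "ground x = {..<gsize x}"

definition smks_instance :: "smks \<Rightarrow> bool" where
  "smks_instance x \<longleftrightarrow>
     (\<forall>S\<subseteq>ground x. 0 \<le> objective x S) \<and>
     monotone_set_fun (ground x) (objective x) \<and>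
     submodular (ground x) (objective x) \<and>
     1 \<le> pparam x \<and> p_set_system (pparam x) (ground x) (indep x) \<and>
     1 \<le> knapsacks x \<and>
     (\<forall>i<knapsacks x. \<forall>u\<in>ground x. 0 \<le> cost x i u) \<and>
     (\<forall>i<knapsacks x. 0 < budget x i)"

definition feasible :: "smks \<Rightarrow> nat set \<Rightarrow> bool" where
  "feasible x S \<longleftrightarrow> S \<in> indep x \<and> (\<forall>i<knapsacks x. (\<Sum>u\<in>S. cost x i u) \<le> budget x i)"

definition optimal :: "smks \<Rightarrow> nat set \<Rightarrow> bool" where
  "optimal x S \<longleftrightarrow> feasible x S \<and> (\<forall>T. feasible x T \<longrightarrow> objective x T \<le> objective x S)"

definition approximates :: "real \<Rightarrow> smks \<Rightarrow> nat set \<Rightarrow> bool" where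
  "approximates \<gamma> x S \<longleftrightarrow>
     feasible x S \<and> (\<exists>OPT. optimal x OPT \<and> \<gamma> * objective x OPT \<le> objective x S)"


section \<open>Algorithms: a real RAM with oracles\<close>

text \<open>
  A program is a finite list of instructions working on a memory of natural numbers (used also for
  addresses) and a memory of real numbers. Every instruction takes one unit of time. The natural
  number arithmetic is limited to addition and truncated subtraction, and there is no conversion
  from reals to natural numbers, so that unit-cost arithmetic cannot be abused. Both oracles take
  the argument set as an indicator vector of length \<open>n\<close> stored in the memory of natural numbers;
  the query itself costs one unit, but the vector must have been written by the program. The output
  set is given in the same way.

  In the following, \<open>M\<close> and \<open>R\<close> stand for the two memories.
\<close>

datatype instr =
    NConst nat nat              \<comment> \<open>\<open>M a := k\<close>\<close>
  | NAdd nat nat nat            \<comment> \<open>\<open>M a := M b + M c\<close>\<close>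
  | NSub nat nat nat            \<comment> \<open>\<open>M a := M b - M c\<close>\<close>
  | NLoad nat nat               \<comment> \<open>\<open>M a := M (M b)\<close>\<close>
  | NStore nat nat              \<comment> \<open>\<open>M (M a) := M b\<close>\<close>
  | RConst nat nat              \<comment> \<open>\<open>R a := k\<close>\<close>
  | RAdd nat nat nat            \<comment> \<open>\<open>R a := R b + R c\<close>, similarly for the next three\<close>
  | RSub nat nat nat
  | RMul nat nat nat
  | RDiv nat nat nat
  | RLoad nat nat               \<comment> \<open>\<open>R a := R (M b)\<close>\<close>
  | RStore nat nat              \<comment> \<open>\<open>R (M a) := R b\<close>\<close>
  | ReadCost nat nat nat        \<comment> \<open>\<open>R a :=\<close> cost of element \<open>M u\<close> in knapsack \<open>M i\<close>\<close>
  | ReadBudget nat nat          \<comment> \<open>\<open>R a :=\<close> budget of knapsack \<open>M i\<close>\<close>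
  | QueryValue nat nat          \<comment> \<open>\<open>R a := f S\<close>, where \<open>S\<close> is stored at address \<open>M b\<close>\<close>
  | QueryIndep nat nat          \<comment> \<open>\<open>M a := 1\<close> if the set stored at \<open>M b\<close> is independent, else \<open>0\<close>\<close>
  | NJumpLess nat nat nat       \<comment> \<open>go to instruction \<open>l\<close> if \<open>M a < M b\<close>\<close>
  | RJumpLess nat nat nat       \<comment> \<open>go to instruction \<open>l\<close> if \<open>R a < R b\<close>\<close>
  | Halt nat                    \<comment> \<open>stop and output the set stored at address \<open>M b\<close>\<close>

type_synonym program = "instr list"

record config =
  pc :: nat
  nmem :: "nat \<Rightarrow> nat"
  rmem :: "nat \<Rightarrow> real"

definition stored_set :: "nat \<Rightarrow> (nat \<Rightarrow> nat) \<Rightarrow> nat \<Rightarrow> nat set" where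
  "stored_set n M b = {u. u < n \<and> M (b + u) \<noteq> 0}"

definition nset :: "nat \<Rightarrow> nat \<Rightarrow> config \<Rightarrow> config" where
  "nset a v s = s\<lparr>pc := Suc (pc s), nmem := (nmem s)(a := v)\<rparr>"

definition rset :: "nat \<Rightarrow> real \<Rightarrow> config \<Rightarrow> config" where
  "rset a v s = s\<lparr>pc := Suc (pc s), rmem := (rmem s)(a := v)\<rparr>"

definition jump_if :: "bool \<Rightarrow> nat \<Rightarrow> config \<Rightarrow> config" where
  "jump_if b l s = s\<lparr>pc := (if b then l else Suc (pc s))\<rparr>"

fun exec_instr :: "smks \<Rightarrow> instr \<Rightarrow> config \<Rightarrow> config" where
  "exec_instr x (NConst a k) s = nset a k s"
| "exec_instr x (NAdd a b c) s = nset a (nmem s b + nmem s c) s"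
| "exec_instr x (NSub a b c) s = nset a (nmem s b - nmem s c) s"
| "exec_instr x (NLoad a b) s = nset a (nmem s (nmem s b)) s"
| "exec_instr x (NStore a b) s = nset (nmem s a) (nmem s b) s"
| "exec_instr x (RConst a k) s = rset a (real k) s"
| "exec_instr x (RAdd a b c) s = rset a (rmem s b + rmem s c) s"
| "exec_instr x (RSub a b c) s = rset a (rmem s b - rmem s c) s"
| "exec_instr x (RMul a b c) s = rset a (rmem s b * rmem s c) s"
| "exec_instr x (RDiv a b c) s = rset a (rmem s b / rmem s c) s"
| "exec_instr x (RLoad a b) s = rset a (rmem s (nmem s b)) s"
| "exec_instr x (RStore a b) s = rset (nmem s a) (rmem s b) s"
| "exec_instr x (ReadCost a i u) s = rset a (cost x (nmem s i) (nmem s u)) s"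
| "exec_instr x (ReadBudget a i) s = rset a (budget x (nmem s i)) s"
| "exec_instr x (QueryValue a b) s =
     rset a (objective x (stored_set (gsize x) (nmem s) (nmem s b))) s"
| "exec_instr x (QueryIndep a b) s =
     nset a (if stored_set (gsize x) (nmem s) (nmem s b) \<in> indep x then 1 else 0) s"
| "exec_instr x (NJumpLess a b l) s = jump_if (nmem s a < nmem s b) l s"
| "exec_instr x (RJumpLess a b l) s = jump_if (rmem s a < rmem s b) l s"
| "exec_instr x (Halt b) s = s"

text \<open>Leaving the program without reaching a \<open>Halt\<close> counts as not producing any output.\<close>

definition step :: "program \<Rightarrow> smks \<Rightarrow> config \<Rightarrow> config" where
  "step P x s = (if pc s < length P then exec_instr x (P ! pc s) s else s)"

text \<open>Initially, \<open>M\<close> contains \<open>n\<close>, \<open>d\<close>, \<open>p\<close> and then zeros, and \<open>R\<close> contains \<open>\<epsilon>\<close> and then zeros.\<close>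

definition init_config :: "real \<Rightarrow> smks \<Rightarrow> config" where
  "init_config \<epsilon> x =
     \<lparr>pc = 0,
      nmem = (\<lambda>_. 0)(0 := gsize x, 1 := knapsacks x, 2 := pparam x),
      rmem = (\<lambda>_. 0)(0 := \<epsilon>)\<rparr>"

definition outputs_within :: "program \<Rightarrow> real \<Rightarrow> smks \<Rightarrow> real \<Rightarrow> nat set \<Rightarrow> bool" where
  "outputs_within P \<epsilon> x t S \<longleftrightarrow>
     (\<exists>k b. let s = (step P x ^^ k) (init_config \<epsilon> x) in
        real (Suc k) \<le> t \<and> pc s < length P \<and> P ! pc s = Halt b \<and>
        S = stored_set (gsize x) (nmem s) (nmem s b))"


section \<open>Running time bounds\<close>

text \<open>
  \<open>soft_O g\<close> consists of the bounds \<open>T \<epsilon> n d\<close> that are at most \<open>g \<epsilon> n d\<close> up to a constant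
  and factors poly-logarithmic in \<open>n\<close>, \<open>d\<close> and \<open>1/\<epsilon>\<close>; the constants are uniform in \<open>\<epsilon>\<close>, \<open>n\<close> and
  \<open>d\<close>. Adding 2 inside the logarithms makes them at least 1. Empty ground sets are left out since the
  bounds of interest vanish for \<open>n = 0\<close>.
\<close>

definition soft_O :: "(real \<Rightarrow> nat \<Rightarrow> nat \<Rightarrow> real) \<Rightarrow> (real \<Rightarrow> nat \<Rightarrow> nat \<Rightarrow> real) set" where
  "soft_O g = {T. \<exists>C k. \<forall>\<epsilon>>0. \<forall>n\<ge>1. \<forall>d\<ge>1.
     T \<epsilon> n d \<le> C * g \<epsilon> n d *
       (log 2 (real n + 2) * log 2 (real d + 2) * log 2 (1 / \<epsilon> + 2)) ^ k}"

text \<open>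
  The program \<open>P\<close>, run with parameter \<open>\<epsilon>\<close>, is an algorithm for SMKS with approximation ratio
  \<open>\<gamma> p d\<close> and running time \<open>T n d\<close>.
\<close>

definition smks_algorithm ::
    "program \<Rightarrow> real \<Rightarrow> (nat \<Rightarrow> nat \<Rightarrow> real) \<Rightarrow> (nat \<Rightarrow> nat \<Rightarrow> real) \<Rightarrow> bool" where
  "smks_algorithm P \<epsilon> \<gamma> T \<longleftrightarrow>
     (\<forall>x. smks_instance x \<longrightarrow>
        (\<exists>S. outputs_within P \<epsilon> x (T (gsize x) (knapsacks x)) S \<and>
             approximates (\<gamma> (pparam x) (knapsacks x)) x S))"

end

theory Submission
  imports Defs
begin

text \<open>
  Scale the budgets to 1 and let the density of an element be its marginal value divided by its total
  cost over all knapsacks. Call an element small if it costs at most \<open>1/q\<close> in every knapsack. For a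
  density \<open>\<rho>\<close>, run the decreasing-threshold greedy algorithm on the small elements of density at
  least \<open>\<rho>\<close>. If a knapsack overflows, then every minimal infeasible subset of the chosen set has
  value at least \<open>\<rho>\<close> and more than \<open>q\<close> elements, so that dropping its least useful element leaves
  a feasible set of value at least \<open>\<rho> q/(q+1)\<close>. Otherwise the value \<open>V\<close> of the chosen set
  satisfies \<open>f(O) \<le> (p+1) V + \<rho> c(O)\<close>, up to the error of the thresholds, for all independent sets \<open>O\<close>
  of small elements. Bisection finds a \<open>\<rho>\<close> at which the two cases meet, that is, \<open>\<rho> \<approx> V (q+1)/q\<close>.

  For \<open>q = 2\<close>, the optimum contains at most \<open>d\<close> elements that are not small. Each of them is worth at
  most \<open>V\<close>, the value of the best singleton being a lower bound for \<open>V\<close>, and it leaves \<open>1/2\<close> less cost for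
  the small ones. This gives \<open>p + 1 + 3d/2 + d/4\<close>. For \<open>q = 3\<close>, a non-small element of total cost at least
  \<open>3/4\<close> pays for itself. There are at most \<open>2d\<close> others, and they are bounded in pairs by the best
  feasible pair, which gives \<open>p + 3/2 + 4d/3 + d/9\<close>. Two elements of total cost at most \<open>3/4\<close> can only
  overflow the most loaded knapsack of one of them, so all these pairs are tested in constant time each.
  In the second algorithm the thresholds decrease by a factor \<open>1 + O(1/n)\<close>, since the error is
  multiplied by \<open>p\<close>, which may be assumed to be at most \<open>n\<close>.
\<close>

section \<open>Structured programs\<close>

text \<open>The choice of \<open>q\<close> is a trade-off. A unit of cost is priced at
  \<open>(q + 1) / q\<close> times \<open>V\<close>, which favours a large \<open>q\<close>, but a
  feasible set may then contain up to \<open>d * (q - 1)\<close> elements that are not small. At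
  \<open>q = 3\<close> a price of \<open>V\<close> for each of these would be too high; pairs halve
  it, and 3/4 is the inverse of the price 4/3. The balancing density depends on the unknown value
  \<open>V\<close> itself. Bisection gets by with two one-sided facts, a value bound at the lower
  end and a certificate at the upper end, and both survive when a better set is found. It starts at
  \<open>n\<close> times the first threshold \<open>m\<close>, where no run of positive density can
  overflow, and stops at width \<open>m / (d * N)\<close>, because feasible sets have total cost at
  most \<open>d\<close>. Of the final error \<open>3 / N\<close>, one part comes from this width and
  two from the last threshold. For the running time, \<open>d\<close> must not be multiplied by the
  number of thresholds. Hence the knapsacks are touched only on insertion: \<open>d\<close> meets at
  most \<open>n\<close> insertions per run, and the thresholds meet only constant-time
  scans.\<close>

text \<open>
  Only conditionals without an else branch and do-while loops are provided: these compile to a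
  single conditional jump, and the machine has no unconditional one.
\<close>

datatype com =
    Atom instr
  | Seq com com (infixr ";;" 60)
  | UnlessN nat nat com
  | UnlessR nat nat com
  | DoN com nat nat
  | DoR com nat nat

fun com_size :: "com \<Rightarrow> nat" where
  "com_size (Atom i) = 1"
| "com_size (c1 ;; c2) = com_size c1 + com_size c2"
| "com_size (UnlessN a b c) = Suc (com_size c)"
| "com_size (UnlessR a b c) = Suc (com_size c)"
| "com_size (DoN c a b) = Suc (com_size c)"
| "com_size (DoR c a b) = Suc (com_size c)"

fun compile :: "nat \<Rightarrow> com \<Rightarrow> program" where
  "compile l (Atom i) = [i]"
| "compile l (c1 ;; c2) = compile l c1 @ compile (l + com_size c1) c2"
| "compile l (UnlessN a b c) = NJumpLess a b (Suc (l + com_size c)) # compile (Suc l) c"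
| "compile l (UnlessR a b c) = RJumpLess a b (Suc (l + com_size c)) # compile (Suc l) c"
| "compile l (DoN c a b) = compile l c @ [NJumpLess a b l]"
| "compile l (DoR c a b) = compile l c @ [RJumpLess a b l]"

lemma length_compile [simp]: "length (compile l c) = com_size c"
  by (induction c arbitrary: l) auto

section \<open>Execution of compiled code and proof rules with a clock\<close>

definition code_at :: "program \<Rightarrow> nat \<Rightarrow> program \<Rightarrow> bool" where
  "code_at P l code \<longleftrightarrow> (\<exists>p1 p2. P = p1 @ code @ p2 \<and> length p1 = l)"

lemma code_at_append:
  "code_at P l (xs @ ys) \<longleftrightarrow> code_at P l xs \<and> code_at P (l + length xs) ys"
proof
  assume "code_at P l (xs @ ys)"
  then obtain p1 p2 where "P = p1 @ (xs @ ys) @ p2" "length p1 = l"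
    by (auto simp: code_at_def)
  then have "P = p1 @ xs @ (ys @ p2)" "P = (p1 @ xs) @ ys @ p2" "length (p1 @ xs) = l + length xs"
    by auto
  then show "code_at P l xs \<and> code_at P (l + length xs) ys"
    using \<open>length p1 = l\<close> unfolding code_at_def by metis
next
  assume "code_at P l xs \<and> code_at P (l + length xs) ys"
  then obtain p1 p2 p3 p4 where *: "P = p1 @ xs @ p2" "length p1 = l"
    "P = p3 @ ys @ p4" "length p3 = l + length xs"
    unfolding code_at_def by blast
  then have "p3 = p1 @ xs"
    by (metis append.assoc append_eq_append_conv length_append)
  then show "code_at P l (xs @ ys)"
    using * by (auto simp: code_at_def)
qed

lemma code_at_Cons:
  "code_at P l (i # xs) \<longleftrightarrow> code_at P l [i] \<and> code_at P (Suc l) xs"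
  using code_at_append[of P l "[i]" xs] by simp

lemma code_at_single: "code_at P l [i] \<Longrightarrow> l < length P \<and> P ! l = i"
  by (auto simp: code_at_def)

text \<open>Quantifying over all programs that contain the code, at whatever address, makes runs of
  parts composable. \<open>k\<close> is the exact number of steps.\<close>

definition runs :: "smks \<Rightarrow> com \<Rightarrow> (nat \<Rightarrow> nat) \<Rightarrow> (nat \<Rightarrow> real) \<Rightarrow> nat
    \<Rightarrow> (nat \<Rightarrow> nat) \<Rightarrow> (nat \<Rightarrow> real) \<Rightarrow> bool" where
  "runs x c M R k M' R' \<longleftrightarrow> (\<forall>P l. code_at P l (compile l c) \<longrightarrow>
     (step P x ^^ k) \<lparr>pc = l, nmem = M, rmem = R\<rparr> = \<lparr>pc = l + com_size c, nmem = M', rmem = R'\<rparr>)"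

text \<open>The last argument is the clock at the start; the postcondition sees the clock at the end.\<close>

definition wp :: "smks \<Rightarrow> com \<Rightarrow> ((nat \<Rightarrow> nat) \<Rightarrow> (nat \<Rightarrow> real) \<Rightarrow> nat \<Rightarrow> bool)
    \<Rightarrow> (nat \<Rightarrow> nat) \<Rightarrow> (nat \<Rightarrow> real) \<Rightarrow> nat \<Rightarrow> bool" where
  "wp x c Q M R t \<longleftrightarrow> (\<exists>k M' R'. runs x c M R k M' R' \<and> Q M' R' (t + k))"

lemma wp_mono:
  assumes "wp x c Q M R t" and "\<And>M' R' t'. Q M' R' t' \<Longrightarrow> Q' M' R' t'"
  shows "wp x c Q' M R t"
  using assms unfolding wp_def by blast

lemma step_code_at:
  assumes "code_at P l [i]"
  shows "step P x \<lparr>pc = l, nmem = M, rmem = R\<rparr> = exec_instr x i \<lparr>pc = l, nmem = M, rmem = R\<rparr>"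
  using code_at_single[OF assms] by (simp add: step_def)

lemma wp_atomI:
  assumes "\<And>l. exec_instr x i \<lparr>pc = l, nmem = M, rmem = R\<rparr> = \<lparr>pc = Suc l, nmem = M', rmem = R'\<rparr>"
    and "Q M' R' (Suc t)"
  shows "wp x (Atom i) Q M R t"
proof -
  have "runs x (Atom i) M R 1 M' R'"
    using assms(1) by (simp add: runs_def step_code_at)
  then show ?thesis
    using assms(2) unfolding wp_def by fastforce
qed

lemma wp_atoms:
  "Q (M(a := k)) R (Suc t) \<Longrightarrow> wp x (Atom (NConst a k)) Q M R t"
  "Q (M(a := M b + M c)) R (Suc t) \<Longrightarrow> wp x (Atom (NAdd a b c)) Q M R t"
  "Q (M(a := M (M b))) R (Suc t) \<Longrightarrow> wp x (Atom (NLoad a b)) Q M R t"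
  "Q (M(M a := M b)) R (Suc t) \<Longrightarrow> wp x (Atom (NStore a b)) Q M R t"
  "Q M (R(a := real k)) (Suc t) \<Longrightarrow> wp x (Atom (RConst a k)) Q M R t"
  "Q M (R(a := R b + R c)) (Suc t) \<Longrightarrow> wp x (Atom (RAdd a b c)) Q M R t"
  "Q M (R(a := R b - R c)) (Suc t) \<Longrightarrow> wp x (Atom (RSub a b c)) Q M R t"
  "Q M (R(a := R b * R c)) (Suc t) \<Longrightarrow> wp x (Atom (RMul a b c)) Q M R t"
  "Q M (R(a := R b / R c)) (Suc t) \<Longrightarrow> wp x (Atom (RDiv a b c)) Q M R t"
  "Q M (R(a := R (M b))) (Suc t) \<Longrightarrow> wp x (Atom (RLoad a b)) Q M R t"
  "Q M (R(M a := R b)) (Suc t) \<Longrightarrow> wp x (Atom (RStore a b)) Q M R t"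
  "Q M (R(a := cost x (M i) (M u))) (Suc t) \<Longrightarrow> wp x (Atom (ReadCost a i u)) Q M R t"
  "Q M (R(a := budget x (M i))) (Suc t) \<Longrightarrow> wp x (Atom (ReadBudget a i)) Q M R t"
  "Q M (R(a := objective x (stored_set (gsize x) M (M b)))) (Suc t) \<Longrightarrow>
     wp x (Atom (QueryValue a b)) Q M R t"
  "Q (M(a := (if stored_set (gsize x) M (M b) \<in> indep x then 1 else 0))) R (Suc t) \<Longrightarrow>
     wp x (Atom (QueryIndep a b)) Q M R t"
  by (rule wp_atomI; force simp: nset_def rset_def)+

lemma wp_Seq:
  assumes "wp x c1 (wp x c2 Q) M R t"
  shows "wp x (c1 ;; c2) Q M R t"
proof -
  obtain k1 M1 R1 k2 M2 R2 where 1: "runs x c1 M R k1 M1 R1" and 2: "runs x c2 M1 R1 k2 M2 R2"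
    and Q: "Q M2 R2 (t + k1 + k2)"
    using assms unfolding wp_def by blast
  have "runs x (c1 ;; c2) M R (k2 + k1) M2 R2"
    using 1 2 by (simp add: runs_def code_at_append funpow_add add.assoc)
  then show ?thesis
    using Q unfolding wp_def by (metis add.assoc add.commute)
qed

text \<open>The conditional jump \<open>i\<close> and its test \<open>b'\<close> are parameters so
  that tests on natural numbers and on reals share one proof.\<close>

lemma wp_Unless:
  assumes skip: "b \<Longrightarrow> Q M R (Suc t)"
    and exec: "\<not> b \<Longrightarrow> wp x c Q M R (Suc t)"
    and jump: "\<And>l s. exec_instr x (i l) s = jump_if (b' s) l s"
    and b: "\<And>l. b' \<lparr>pc = l, nmem = M, rmem = R\<rparr> = b"
    and comp: "\<And>l. compile l c' = i (Suc (l + com_size c)) # compile (Suc l) c"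
  shows "wp x c' Q M R t"
proof (cases b)
  case True
  have size: "com_size c' = Suc (com_size c)"
    using arg_cong[OF comp[of 0], of length] by simp
  have "runs x c' M R 1 M R"
    using True by (auto simp: runs_def comp code_at_Cons[of _ _ _ "compile _ c"] step_code_at jump b
        jump_if_def size)
  then show ?thesis
    using skip[OF True] unfolding wp_def by fastforce
next
  case False
  have size: "com_size c' = Suc (com_size c)"
    using arg_cong[OF comp[of 0], of length] by simp
  obtain k M1 R1 where 1: "runs x c M R k M1 R1" and Q: "Q M1 R1 (Suc t + k)"
    using exec[OF False] unfolding wp_def by blast
  have "runs x c' M R (Suc k) M1 R1"
    unfolding runs_def
  proof (intro allI impI)
    fix P l
    assume "code_at P l (compile l c')"
    then have *: "code_at P l [i (Suc (l + com_size c))]" "code_at P (Suc l) (compile (Suc l) c)"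
      by (auto simp: comp code_at_Cons[of _ _ _ "compile _ c"])
    have "(step P x ^^ Suc k) \<lparr>pc = l, nmem = M, rmem = R\<rparr>
        = (step P x ^^ k) \<lparr>pc = Suc l, nmem = M, rmem = R\<rparr>"
      using False by (simp add: funpow_Suc_right step_code_at[OF *(1)] jump b jump_if_def del: funpow.simps)
    then show "(step P x ^^ Suc k) \<lparr>pc = l, nmem = M, rmem = R\<rparr>
        = \<lparr>pc = l + com_size c', nmem = M1, rmem = R1\<rparr>"
      using 1 *(2) by (simp add: runs_def size)
  qed
  then show ?thesis
    using Q unfolding wp_def by (metis add_Suc_shift)
qed

lemma wp_UnlessN:
  assumes "\<not> M a < M b \<Longrightarrow> wp x c Q M R (Suc t)" and "M a < M b \<Longrightarrow> Q M R (Suc t)"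
  shows "wp x (UnlessN a b c) Q M R t"
  by (rule wp_Unless[where b = "M a < M b" and i = "NJumpLess a b"
        and b' = "\<lambda>s. nmem s a < nmem s b" and c = c]) (use assms in auto)

lemma wp_UnlessR:
  assumes "\<not> R a < R b \<Longrightarrow> wp x c Q M R (Suc t)" and "R a < R b \<Longrightarrow> Q M R (Suc t)"
  shows "wp x (UnlessR a b c) Q M R t"
  by (rule wp_Unless[where b = "R a < R b" and i = "RJumpLess a b"
        and b' = "\<lambda>s. rmem s a < rmem s b" and c = c]) (use assms in auto)

text \<open>\<open>j\<close> counts the completed rounds. The invariant itself has to exclude
  \<open>j > K\<close>, so \<open>K - j\<close> decreases with every jump back and the loop ends.
  The extra \<open>Suc\<close> on the clock is the closing jump.\<close>

lemma wp_Do: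
  assumes init: "I (0::nat) M R t"
    and bound: "\<And>j M R t. I j M R t \<Longrightarrow> j \<le> K"
    and body: "\<And>j M R t. I j M R t \<Longrightarrow> wp x c (\<lambda>M R t. if b M R then I (Suc j) M R (Suc t) else Q M R (Suc t)) M R t"
    and jump: "\<And>l s. exec_instr x (i l) s = jump_if (b (nmem s) (rmem s)) l s"
    and comp: "\<And>l. compile l c' = compile l c @ [i l]"
  shows "wp x c' Q M R t"
proof -
  have size: "com_size c' = Suc (com_size c)"
    using arg_cong[OF comp[of 0], of length] by simp
  have "wp x c' Q M R t" if "I j M R t" for j M R t
    using that
  proof (induction "K - j" arbitrary: j M R t rule: less_induct)
    case less
    obtain k M1 R1 where 1: "runs x c M R k M1 R1"
      and b: "if b M1 R1 then I (Suc j) M1 R1 (Suc (t + k)) else Q M1 R1 (Suc (t + k))"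
      using body[OF less.prems] unfolding wp_def by blast
    have first: "(step P x ^^ Suc k) \<lparr>pc = l, nmem = M, rmem = R\<rparr>
        = \<lparr>pc = (if b M1 R1 then l else l + com_size c'), nmem = M1, rmem = R1\<rparr>"
      if "code_at P l (compile l c')" for P l
    proof -
      have *: "code_at P l (compile l c)" "code_at P (l + com_size c) [i l]"
        using that by (auto simp: comp code_at_append)
      have "(step P x ^^ k) \<lparr>pc = l, nmem = M, rmem = R\<rparr>
          = \<lparr>pc = l + com_size c, nmem = M1, rmem = R1\<rparr>"
        using 1 *(1) by (simp add: runs_def)
      then show ?thesis
        by (simp add: step_code_at[OF *(2)] jump jump_if_def size)
    qed
    show ?case
    proof (cases "b M1 R1")
      case True
      then have I: "I (Suc j) M1 R1 (Suc (t + k))"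
        using b by simp
      then have "K - Suc j < K - j"
        using bound[OF I] by simp
      from less.hyps[OF this I] obtain k2 M2 R2 where 2: "runs x c' M1 R1 k2 M2 R2"
        and Q: "Q M2 R2 (Suc (t + k) + k2)"
        unfolding wp_def by blast
      have "runs x c' M R (k2 + Suc k) M2 R2"
        unfolding runs_def
      proof (intro allI impI)
        fix P l assume c: "code_at P l (compile l c')"
        show "(step P x ^^ (k2 + Suc k)) \<lparr>pc = l, nmem = M, rmem = R\<rparr>
            = \<lparr>pc = l + com_size c', nmem = M2, rmem = R2\<rparr>"
          using True 2 c unfolding funpow_add comp_apply first[OF c] by (simp add: runs_def)
      qed
      moreover have "Suc (t + k) + k2 = t + (k2 + Suc k)"
        by simp
      ultimately show ?thesis
        using Q unfolding wp_def by metis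
    next
      case False
      then have "runs x c' M R (Suc k) M1 R1"
        using first unfolding runs_def by simp
      then show ?thesis
        using b False unfolding wp_def by (metis add_Suc_right)
    qed
  qed
  then show ?thesis
    using init by blast
qed

lemma wp_DoR:
  assumes "I (0::nat) M R t"
    and "\<And>j M R t. I j M R t \<Longrightarrow> j \<le> K"
    and "\<And>j M R t. I j M R t \<Longrightarrow>
      wp x c (\<lambda>M R t. if R a < R b then I (Suc j) M R (Suc t) else Q M R (Suc t)) M R t"
  shows "wp x (DoR c a b) Q M R t"
  by (rule wp_Do[where I = I and b = "\<lambda>M R. R a < R b" and i = "RJumpLess a b"]) (use assms in auto)

lemma wp_DoN:
  assumes "I (0::nat) M R t"
    and "\<And>j M R t. I j M R t \<Longrightarrow> j \<le> K"
    and "\<And>j M R t. I j M R t \<Longrightarrow>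
      wp x c (\<lambda>M R t. if M a < M b then I (Suc j) M R (Suc t) else Q M R (Suc t)) M R t"
  shows "wp x (DoN c a b) Q M R t"
  by (rule wp_Do[where I = I and b = "\<lambda>M R. M a < M b" and i = "NJumpLess a b"]) (use assms in auto)

text \<open>Register 4 is supposed to hold the constant 1.\<close>

definition For :: "nat \<Rightarrow> nat \<Rightarrow> com \<Rightarrow> com" where
  "For u r c = Atom (NConst u 0) ;; DoN (c ;; Atom (NAdd u u 4)) u r"

text \<open>The body runs before the first test, hence \<open>0 < K\<close>. The body has to
  establish \<open>J\<close> for a counter already advanced and a clock two steps later, which
  accounts for the increment and the jump.\<close>

lemma wp_For:
  assumes init: "J 0 (M(u := 0)) R (Suc t)" and K: "0 < K"
    and body: "\<And>j M R t. \<lbrakk>j < K; M u = j; J j M R t\<rbrakk> \<Longrightarrow>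
      wp x c (\<lambda>M R t. M u = j \<and> M 4 = 1 \<and> M r = K \<and> J (Suc j) (M(u := Suc j)) R (t + 2)) M R t"
    and fin: "\<And>M R t. \<lbrakk>M u = K; J K M R t\<rbrakk> \<Longrightarrow> Q M R t"
    and r: "r \<noteq> u" 
  shows "wp x (For u r c) Q M R t"
  unfolding For_def
proof (intro wp_Seq wp_atoms wp_DoN[where I = "\<lambda>j M R t. j < K \<and> M u = j \<and> J j M R t" and K = K])
  fix j :: nat and M R t
  assume *: "j < K \<and> M u = j \<and> J j M R t"
  show "wp x c (wp x (Atom (NAdd u u 4))
      (\<lambda>M R t. if M u < M r then Suc j < K \<and> M u = Suc j \<and> J (Suc j) M R (Suc t) else Q M R (Suc t))) M R t"
  proof (rule wp_mono[OF body])
    fix M' R' t'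
    assume M': "M' u = j \<and> M' 4 = 1 \<and> M' r = K \<and> J (Suc j) (M'(u := Suc j)) R' (t' + 2)"
    have "Q (M'(u := Suc j)) R' (Suc (Suc t'))" if "\<not> Suc j < K"
      using fin[of "M'(u := Suc j)" R' "t' + 2"] M' * that by (metis Suc_lessI add_2_eq_Suc' fun_upd_same)
    then show "wp x (Atom (NAdd u u 4))
        (\<lambda>M R t. if M u < M r then Suc j < K \<and> M u = Suc j \<and> J (Suc j) M R (Suc t) else Q M R (Suc t)) M' R' t'"
      using M' r by (intro wp_atoms) auto
  qed (use * in auto)
qed (use init K in auto)

text \<open>The loops are do-while loops and presuppose a non-empty ground set. The two leading
  instructions ensure this: register 3 still holds 0, so the first one jumps to the code of
  \<open>c\<close> exactly if \<open>0 < n\<close>. The 2 added to the clock is that jump and the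
  \<open>Suc\<close> in \<open>outputs_within\<close>.\<close>

lemma outputs_withinI:
  assumes wp: "wp x c Q (nmem (init_config \<epsilon> x)) (rmem (init_config \<epsilon> x)) 0"
    and Q: "\<And>M R k. Q M R k \<Longrightarrow> real k + 2 \<le> t \<and> S_ok (stored_set (gsize x) M (M b))"
    and n: "0 < gsize x"
  shows "\<exists>S. outputs_within ([NJumpLess 3 0 2, Halt 3] @ compile 2 c @ [Halt b]) \<epsilon> x t S \<and> S_ok S"
proof -
  obtain k M R where k: "runs x c (nmem (init_config \<epsilon> x)) (rmem (init_config \<epsilon> x)) k M R" and "Q M R k"
    using wp unfolding wp_def by auto
  define P where "P = [NJumpLess 3 0 2, Halt 3] @ compile 2 c @ [Halt b]"
  have "code_at P 2 (compile 2 c)"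
    unfolding code_at_def P_def
    by (rule exI[of _ "[NJumpLess 3 0 2, Halt 3]"], rule exI[of _ "[Halt b]"]) auto
  moreover have "step P x (init_config \<epsilon> x) = \<lparr>pc = 2, nmem = nmem (init_config \<epsilon> x), rmem = rmem (init_config \<epsilon> x)\<rparr>"
    using n by (simp add: step_def P_def init_config_def jump_if_def)
  ultimately have "(step P x ^^ Suc k) (init_config \<epsilon> x) = \<lparr>pc = 2 + com_size c, nmem = M, rmem = R\<rparr>"
    using k by (simp add: funpow_Suc_right runs_def del: funpow.simps)
  moreover have "P ! (2 + com_size c) = Halt b" "2 + com_size c < length P"
    using nth_append_length[of "[NJumpLess 3 0 2, Halt 3] @ compile 2 c" "Halt b" "[]"]
    by (auto simp: P_def)
  ultimately have "outputs_within P \<epsilon> x t (stored_set (gsize x) M (M b))"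
    using Q[OF \<open>Q M R k\<close>] unfolding outputs_within_def Let_def
    by (intro exI[of _ "Suc k"] exI[of _ b]) auto
  then show ?thesis
    using Q[OF \<open>Q M R k\<close>] unfolding P_def by blast
qed

section \<open>The density greedy algorithm\<close>

locale smks_ctx =
  fixes x :: smks
  assumes inst: "smks_instance x"
begin

abbreviation "n \<equiv> gsize x"
abbreviation "d \<equiv> knapsacks x"
abbreviation "f \<equiv> objective x"
abbreviation "\<I> \<equiv> indep x"

definition p' :: nat where "p' = min (pparam x) n"

definition kcost :: "nat \<Rightarrow> real" where
  "kcost u = (\<Sum>i<d. cost x i u / budget x i)"

definition kfeas :: "nat set \<Rightarrow> bool" where
  "kfeas S \<longleftrightarrow> (\<forall>i<d. (\<Sum>u\<in>S. cost x i u) \<le> budget x i)"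

definition small :: "nat \<Rightarrow> nat \<Rightarrow> bool" where
  "small q u \<longleftrightarrow> u < n \<and> (\<forall>i<d. real q * cost x i u \<le> budget x i)"

definition marg :: "nat set \<Rightarrow> nat \<Rightarrow> real" where
  "marg S u = f (insert u S) - f S"

lemma feasible_iff: "feasible x S \<longleftrightarrow> S \<in> \<I> \<and> kfeas S"
  by (simp add: feasible_def kfeas_def)

lemma d_pos: "1 \<le> d"
  using inst by (simp add: smks_instance_def)

lemma cost_nonneg: "i < d \<Longrightarrow> u < n \<Longrightarrow> 0 \<le> cost x i u"
  using inst by (simp add: smks_instance_def ground_def)

lemma budget_pos: "i < d \<Longrightarrow> 0 < budget x i"
  using inst by (simp add: smks_instance_def)

lemma f_nonneg: "S \<subseteq> {..<n} \<Longrightarrow> 0 \<le> f S"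
  using inst by (simp add: smks_instance_def ground_def)

lemma f_mono: "A \<subseteq> B \<Longrightarrow> B \<subseteq> {..<n} \<Longrightarrow> f A \<le> f B"
  using inst by (auto simp: smks_instance_def ground_def monotone_set_fun_def)

lemma f_submod: "A \<subseteq> {..<n} \<Longrightarrow> B \<subseteq> {..<n} \<Longrightarrow> f (A \<union> B) + f (A \<inter> B) \<le> f A + f B"
  using inst by (auto simp: smks_instance_def ground_def submodular_def)

lemma set_system: "set_system {..<n} \<I>"
  using inst by (simp add: smks_instance_def ground_def p_set_system_def)

lemma indep_ground: "S \<in> \<I> \<Longrightarrow> S \<subseteq> {..<n}"
  using set_system by (auto simp: set_system_def)

lemma indep_finite: "S \<in> \<I> \<Longrightarrow> finite S"
  using indep_ground finite_subset by blast

lemma indep_subset: "S \<in> \<I> \<Longrightarrow> T \<subseteq> S \<Longrightarrow> T \<in> \<I>"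
  using set_system by (auto simp: set_system_def)

lemma indep_empty: "{} \<in> \<I>"
  using set_system by (auto simp: set_system_def)

lemma kcost_nonneg: "u < n \<Longrightarrow> 0 \<le> kcost u"
  unfolding kcost_def by (intro sum_nonneg divide_nonneg_pos) (auto simp: cost_nonneg budget_pos)

lemma cost_le_kcost: "u < n \<Longrightarrow> i < d \<Longrightarrow> cost x i u / budget x i \<le> kcost u"
  unfolding kcost_def
  by (rule member_le_sum) (auto intro!: divide_nonneg_pos simp: cost_nonneg budget_pos)

lemma kfeas_subset:
  assumes "kfeas S" "T \<subseteq> S" "S \<subseteq> {..<n}"
  shows "kfeas T"
  unfolding kfeas_def
proof (intro allI impI)
  fix i assume i: "i < d"
  have "(\<Sum>u\<in>T. cost x i u) \<le> (\<Sum>u\<in>S. cost x i u)"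
    using assms i finite_subset[OF assms(3)] by (intro sum_mono2) (auto intro: cost_nonneg)
  then show "(\<Sum>u\<in>T. cost x i u) \<le> budget x i"
    using assms(1) i by (force simp: kfeas_def)
qed

lemma feasible_subset: "feasible x S \<Longrightarrow> T \<subseteq> S \<Longrightarrow> feasible x T"
  using indep_subset kfeas_subset indep_ground by (auto simp: feasible_iff)

lemma feasible_empty: "feasible x {}"
  using indep_empty by (auto simp: feasible_def intro: less_imp_le budget_pos)

lemma sum_kcost: "(\<Sum>u\<in>S. kcost u) = (\<Sum>i<d. (\<Sum>u\<in>S. cost x i u) / budget x i)"
  unfolding kcost_def by (subst sum.swap) (simp add: sum_divide_distrib)

lemma kcost_feasible:
  assumes "kfeas S"
  shows "(\<Sum>u\<in>S. kcost u) \<le> real d"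
proof -
  have "(\<Sum>u\<in>S. kcost u) \<le> (\<Sum>i<d. 1)"
    unfolding sum_kcost using assms budget_pos by (intro sum_mono) (auto simp: kfeas_def)
  then show ?thesis by simp
qed

lemma kcost_infeasible:
  assumes "\<not> kfeas S" "S \<subseteq> {..<n}"
  shows "1 < (\<Sum>u\<in>S. kcost u)"
proof -
  obtain i where i: "i < d" "budget x i < (\<Sum>u\<in>S. cost x i u)"
    using assms(1) by (auto simp: kfeas_def not_le)
  then have "1 < (\<Sum>u\<in>S. cost x i u) / budget x i"
    using budget_pos by simp
  also have "\<dots> \<le> (\<Sum>i<d. (\<Sum>u\<in>S. cost x i u) / budget x i)"
    using i(1) assms(2) budget_pos cost_nonneg
    by (intro member_le_sum[where f = "\<lambda>i. (\<Sum>u\<in>S. cost x i u) / budget x i"])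
      (auto intro!: divide_nonneg_pos sum_nonneg)
  finally show ?thesis
    by (simp add: sum_kcost)
qed

lemma marg_antimono:
  assumes "A \<subseteq> B" "B \<subseteq> {..<n}" "u < n"
  shows "marg B u \<le> marg A u"
proof (cases "u \<in> B")
  case True
  then show ?thesis
    using f_mono[of A "insert u A"] assms by (auto simp: marg_def insert_absorb)
next
  case False
  then have "insert u A \<union> B = insert u B" "insert u A \<inter> B = A"
    using assms by auto
  moreover have "insert u A \<subseteq> {..<n}"
    using assms by auto
  ultimately show ?thesis
    using f_submod[of "insert u A" B] assms by (simp add: marg_def)
qed

lemma marg_le_singleton:
  assumes "S \<subseteq> {..<n}" "u < n"
  shows "marg S u \<le> f {u}"
  using marg_antimono[of "{}" S u] f_nonneg[of "{}"] assms by (auto simp: marg_def)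

lemma f_union_le:
  assumes "S \<subseteq> {..<n}" "Y \<subseteq> {..<n}"
  shows "f (S \<union> Y) \<le> f S + (\<Sum>u\<in>Y. marg S u)"
proof -
  have "finite Y"
    using assms finite_subset by auto
  then show ?thesis
    using assms(2)
  proof (induction Y rule: finite_induct)
    case (insert u Y)
    have "marg (S \<union> Y) u \<le> marg S u"
      using insert assms by (intro marg_antimono) auto
    then show ?case
      using insert by (auto simp: marg_def)
  qed simp
qed

lemma f_subadd:
  assumes "S \<subseteq> {..<n}" "T \<subseteq> {..<n}"
  shows "f (S \<union> T) \<le> f S + f T"
  using f_submod[OF assms] f_nonneg[of "S \<inter> T"] assms by (simp add: le_infI1)

text \<open>\<open>S\<close> is a base of \<open>S \<union> A\<close> because all of
  \<open>A\<close> is blocked, while \<open>A\<close> extends to some base, so the ratio of base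
  sizes applies. Truncating the parameter at \<open>n\<close> is sound:
  \<open>card A \<le> n\<close>, and an empty \<open>S\<close> forces an empty
  \<open>A\<close>.\<close>

lemma card_le_p':
  assumes S: "S \<in> \<I>" and A: "A \<in> \<I>" and blocked: "\<And>u. u \<in> A \<Longrightarrow> insert u S \<notin> \<I>"
  shows "card A \<le> p' * card S"
proof -
  let ?G = "S \<union> A" and ?bases = "{B. is_base \<I> (S \<union> A) B}"
  have sub: "?G \<subseteq> {..<n}"
    using S A indep_ground by auto
  then have fin: "finite ?G"
    using finite_subset by blast
  have fb: "finite ?bases"
    by (rule finite_subset[of _ "Pow ?G"]) (use fin in \<open>auto simp: is_base_def\<close>)
  have bS: "is_base \<I> ?G S"
    unfolding is_base_def
  proof (intro conjI ballI impI)
    fix B assume B: "B \<in> \<I>" "S \<subseteq> B \<and> B \<subseteq> ?G"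
    show "B = S"
    proof (rule ccontr)
      assume "B \<noteq> S"
      then obtain u where u: "u \<in> B" "u \<notin> S" "u \<in> A"
        using B by auto
      then have "insert u S \<in> \<I>"
        using B indep_subset[of B "insert u S"] by auto
      then show False
        using blocked u by auto
    qed
  qed (use S in auto)
  obtain B where B: "is_base \<I> ?G B" "A \<subseteq> B"
  proof -
    let ?F = "{B \<in> \<I>. A \<subseteq> B \<and> B \<subseteq> ?G}"
    have F: "finite ?F"
      by (rule finite_subset[of _ "Pow ?G"]) (use fin in auto)
    have "A \<in> ?F"
      using A by auto
    from finite_has_maximal2[OF F this] obtain B where "B \<in> ?F" "A \<subseteq> B" "\<forall>C\<in>?F. B \<subseteq> C \<longrightarrow> B = C"
      by (elim bexE conjE)
    moreover have "C = B" if "C \<in> \<I>" "B \<subseteq> C \<and> C \<subseteq> ?G" for C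
      using calculation that by blast
    ultimately show thesis
      by (intro that[of B]) (auto simp: is_base_def)
  qed
  have "card A \<le> card B"
    using B fin by (intro card_mono) (auto simp: is_base_def intro: finite_subset)
  also have "\<dots> \<le> Max (card ` ?bases)"
    using B fb by (intro Max_ge) auto
  also have "\<dots> \<le> pparam x * Min (card ` ?bases)"
    using inst sub by (auto simp: smks_instance_def ground_def p_set_system_def)
  also have "\<dots> \<le> pparam x * card S"
    using bS fb by (intro mult_left_mono Min_le) auto
  finally have 1: "card A \<le> pparam x * card S" .
  have "card A \<le> n"
    using card_mono[OF _ indep_ground[OF A]] by simp
  moreover have "card A = 0" if "card S = 0"
    using 1 that by simp
  ultimately have "card A \<le> n * card S"
    by (cases "card S") auto
  then show ?thesis
    using 1 by (auto simp: p'_def min_def)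
qed

text \<open>The part of a blocked element's value that chosen elements must pay. It is 0 once the
  density has fallen below \<open>\<rho>\<close>, because the element is then paid for by its own
  cost.\<close>

definition hval :: "real \<Rightarrow> nat set \<Rightarrow> nat \<Rightarrow> real" where
  "hval \<rho> S u = (if \<rho> * kcost u \<le> marg S u then marg S u else 0)"

definition blocked :: "nat set \<Rightarrow> nat set \<Rightarrow> nat set" where
  "blocked Y S = {u \<in> Y. insert u S \<notin> \<I>}"

text \<open>
  The last conjunct is the usual charging of blocked elements to chosen ones: each chosen element
  pays for \<open>p\<close> blocked ones, and those not yet blocked can be paid later at the current threshold
  \<open>\<tau>\<close>, which never increases.
\<close>

definition greedy_inv :: "nat \<Rightarrow> real \<Rightarrow> real \<Rightarrow> real \<Rightarrow> nat set \<Rightarrow> bool" where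
  "greedy_inv q \<rho> \<eta> \<tau> S \<longleftrightarrow> S \<in> \<I> \<and> (\<forall>u\<in>S. small q u) \<and>
     (\<forall>T\<subseteq>S. \<rho> * (\<Sum>u\<in>T. kcost u) \<le> f T - f {}) \<and>
     (\<forall>Y\<in>\<I>. (\<forall>u\<in>Y. small q u) \<longrightarrow>
        (real (p' * card S) - real (card (blocked Y S))) * \<tau> + (\<Sum>u\<in>blocked Y S. hval \<rho> S u) / \<eta>
          \<le> real p' * (f S - f {}))"

definition scanned :: "nat \<Rightarrow> real \<Rightarrow> real \<Rightarrow> nat set \<Rightarrow> nat \<Rightarrow> bool" where
  "scanned q \<rho> b S u \<longleftrightarrow>
     (small q u \<and> u \<notin> S \<and> insert u S \<in> \<I> \<and> \<rho> * kcost u \<le> marg S u \<longrightarrow> marg S u \<le> b)"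

text \<open>The premises inside \<open>scanned\<close> pass from a set to its subsets and marginal
  values only shrink, so an element once below a threshold stays below it however the set
  grows.\<close>

lemma scanned_mono:
  assumes "scanned q \<rho> b S u" "S \<subseteq> S'" "S' \<subseteq> {..<n}" "b \<le> b'"
  shows "scanned q \<rho> b' S' u"
  using assms marg_antimono[of S S' u] indep_subset[of "insert u S'" "insert u S"]
  unfolding scanned_def small_def by force

section \<open>Preservation of the charging invariant and the resulting certificate\<close>

lemma card_blocked: "Y \<in> \<I> \<Longrightarrow> S \<in> \<I> \<Longrightarrow> card (blocked Y S) \<le> p' * card S"
  by (rule card_le_p') (auto simp: blocked_def intro: indep_subset)

lemma greedy_inv_empty: "greedy_inv q \<rho> \<eta> \<tau> {}"
proof -
  have "blocked Y {} = {}" if "Y \<in> \<I>" for Y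
    using that indep_subset[of Y] by (auto simp: blocked_def)
  then show ?thesis
    by (auto simp: greedy_inv_def indep_empty)
qed

text \<open>The factor of the threshold is non-negative, since an independent set has at most
  \<open>p' * card S\<close> blocked elements. Lowering the threshold therefore only weakens the
  invariant.\<close>

lemma greedy_inv_level:
  assumes inv: "greedy_inv q \<rho> \<eta> \<tau> S" and \<tau>: "\<tau>' \<le> \<tau>"
  shows "greedy_inv q \<rho> \<eta> \<tau>' S"
proof -
  have "(real (p' * card S) - real (card (blocked Y S))) * \<tau>'
      \<le> (real (p' * card S) - real (card (blocked Y S))) * \<tau>" if "Y \<in> \<I>" for Y
    using card_blocked[OF that, of S] inv \<tau> 
    by (intro mult_left_mono) (auto simp: greedy_inv_def simp flip: of_nat_mult)
  then show ?thesis
    using inv unfolding greedy_inv_def by (meson add_right_mono order_trans)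
qed

text \<open>An element that becomes blocked now could still be added before, so the scan at the
  previous threshold \<open>\<eta> * \<tau>\<close> bounds its value; after division by
  \<open>\<eta>\<close> it uses up at most one unit \<open>\<tau>\<close> of the credit. The
  inserted element is worth at least \<open>\<tau>\<close> and supplies \<open>p'\<close> new
  units.\<close>

lemma greedy_inv_insert:
  assumes inv: "greedy_inv q \<rho> \<eta> \<tau> S" and scan: "\<And>z. scanned q \<rho> (\<eta> * \<tau>) S z"
    and u: "u \<notin> S" "small q u" "insert u S \<in> \<I>" "\<tau> \<le> marg S u" "\<rho> * kcost u \<le> marg S u"
    and \<eta>: "1 \<le> \<eta>" and \<tau>: "0 \<le> \<tau>" and \<rho>: "0 \<le> \<rho>"
  shows "greedy_inv q \<rho> \<eta> \<tau> (insert u S)"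
proof -
  let ?S = "insert u S"
  have S: "S \<in> \<I>" "\<forall>u\<in>S. small q u"
    using inv by (auto simp: greedy_inv_def)
  have fin: "finite S" and gr: "S \<subseteq> {..<n}" "?S \<subseteq> {..<n}"
    using indep_finite S(1) indep_ground u(3) by auto
  have dens: "\<rho> * (\<Sum>v\<in>T. kcost v) \<le> f T - f {}" if T: "T \<subseteq> ?S" for T
  proof (cases "u \<in> T")
    case True
    have "finite T"
      using T fin finite_subset by blast
    have "T - {u} \<subseteq> S"
      using T by auto
    then have 1: "\<rho> * (\<Sum>v\<in>T - {u}. kcost v) \<le> f (T - {u}) - f {}"
      using inv by (auto simp: greedy_inv_def)
    have "marg S u \<le> marg (T - {u}) u"
      using T gr by (intro marg_antimono) auto
    also have "\<dots> = f T - f (T - {u})"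
      using True by (simp add: marg_def insert_absorb)
    finally have "\<rho> * kcost u \<le> f T - f (T - {u})"
      using u by linarith
    then show ?thesis
      using 1 by (simp add: sum.remove[OF \<open>finite T\<close> True] algebra_simps)
  next
    case False
    then have "T \<subseteq> S" using T by auto
    then show ?thesis
      using inv by (auto simp: greedy_inv_def)
  qed
  have "(real (p' * card ?S) - real (card (blocked Y ?S))) * \<tau> + (\<Sum>v\<in>blocked Y ?S. hval \<rho> ?S v) / \<eta>
      \<le> real p' * (f ?S - f {})" if Y: "Y \<in> \<I>" "\<forall>u\<in>Y. small q u" for Y
  proof -
    let ?B = "blocked Y S" and ?B' = "blocked Y ?S"
    have finB: "finite ?B'" "finite ?B"
      using Y(1) indep_finite finite_subset[of _ Y] by (auto simp: blocked_def)
    have sub: "?B \<subseteq> ?B'"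
    proof
      fix z assume "z \<in> ?B"
      then have "z \<in> Y" "insert z S \<notin> \<I>" by (auto simp: blocked_def)
      moreover have "insert z S \<subseteq> insert z ?S" by auto
      ultimately show "z \<in> ?B'"
        using indep_subset unfolding blocked_def by blast
    qed
    have old: "hval \<rho> ?S z \<le> hval \<rho> S z" if "z \<in> ?B" for z
    proof -
      have "z < n" using that Y by (auto simp: small_def blocked_def)
      then have "marg ?S z \<le> marg S z" "0 \<le> marg S z"
        using gr f_mono[of S "insert z S"] marg_antimono[of S ?S z] by (auto simp: marg_def)
      then show ?thesis
        by (auto simp: hval_def)
    qed
    have new: "hval \<rho> ?S z \<le> \<eta> * \<tau>" if "z \<in> ?B' - ?B" for z
    proof (cases "\<rho> * kcost z \<le> marg ?S z")
      case True
      have z: "z < n" "z \<in> Y" "insert z S \<in> \<I>" "insert z ?S \<notin> \<I>"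
        using that Y by (auto simp: small_def blocked_def)
      then have "marg ?S z \<le> marg S z"
        using gr by (intro marg_antimono) auto
      moreover have "z \<notin> S"
        using z u(3) by (auto simp: insert_absorb)
      ultimately have "marg S z \<le> \<eta> * \<tau>"
        using scan[of z] True z Y by (auto simp: scanned_def)
      then show ?thesis
        using \<open>marg ?S z \<le> marg S z\<close> True by (auto simp: hval_def)
    next
      case False
      then show ?thesis
        using \<eta> \<tau> by (simp add: hval_def)
    qed
    have "(\<Sum>v\<in>?B'. hval \<rho> ?S v) = (\<Sum>v\<in>?B' - ?B. hval \<rho> ?S v) + (\<Sum>v\<in>?B. hval \<rho> ?S v)"
      by (rule sum.subset_diff[OF sub finB(1)])
    also have "\<dots> \<le> real (card (?B' - ?B)) * (\<eta> * \<tau>) + (\<Sum>v\<in>?B. hval \<rho> S v)"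
      using old new by (intro add_mono sum_mono sum_bounded_above)
    also have "card (?B' - ?B) = card ?B' - card ?B"
      using sub finB by (intro card_Diff_subset)
    finally have "(\<Sum>v\<in>?B'. hval \<rho> ?S v) / \<eta>
        \<le> (real (card ?B') - real (card ?B)) * \<tau> + (\<Sum>v\<in>?B. hval \<rho> S v) / \<eta>"
      using card_mono[OF finB(1) sub] \<eta> by (simp add: of_nat_diff field_simps)
    moreover have "(real (p' * card S) - real (card ?B)) * \<tau> + (\<Sum>u\<in>?B. hval \<rho> S u) / \<eta>
        \<le> real p' * (f S - f {})"
      using inv Y by (auto simp: greedy_inv_def)
    moreover have "real p' * \<tau> \<le> real p' * marg S u"
      using u by (intro mult_left_mono) auto
    ultimately show ?thesis
      using fin u(1) by (simp add: marg_def algebra_simps)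
  qed
  then show ?thesis
    using dens S u by (auto simp: greedy_inv_def)
qed

text \<open>\<open>V\<close> is separate from the value of the run that yields the certificate: the
  bisection keeps an old certificate while the best value increases.\<close>

definition cert :: "nat \<Rightarrow> real \<Rightarrow> real \<Rightarrow> real \<Rightarrow> real \<Rightarrow> bool" where
  "cert q \<eta> e \<rho> V \<longleftrightarrow> (\<forall>Y\<in>\<I>. (\<forall>u\<in>Y. small q u) \<longrightarrow>
     f Y \<le> (\<eta> * real p' + 1) * V + \<rho> * (\<Sum>u\<in>Y. kcost u) + e)"

lemma cert_mono:
  assumes "cert q \<eta> e \<rho> V" "V \<le> V'" "0 \<le> \<eta>"
  shows "cert q \<eta> e \<rho> V'"
proof -
  have "(\<eta> * real p' + 1) * V \<le> (\<eta> * real p' + 1) * V'"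
    using assms by (intro mult_left_mono) auto
  then show ?thesis
    using assms(1) unfolding cert_def by force
qed

text \<open>An element of \<open>Y\<close> is either too expensive for its marginal value and paid
  for by \<open>\<rho>\<close> times its cost, or blocked and charged through the invariant, or
  still addable and then worth at most the last scanned threshold \<open>\<tau>\<close>. The third
  kind accounts for \<open>e\<close>. The threshold \<open>\<tau>'\<close> of the invariant may
  differ from \<open>\<tau>\<close>.\<close>

lemma greedy_cert:
  assumes inv: "greedy_inv q \<rho> \<eta> \<tau>' S" and \<tau>': "0 \<le> \<tau>'" and \<tau>: "0 \<le> \<tau>"
    and scan: "\<And>u. scanned q \<rho> \<tau> S u"
    and \<eta>: "1 \<le> \<eta>" and \<rho>: "0 \<le> \<rho>" and e: "real n * \<tau> \<le> e"
  shows "cert q \<eta> e \<rho> (f S)"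
  unfolding cert_def
proof (intro ballI impI)
  fix Y assume Y: "Y \<in> \<I>" "\<forall>u\<in>Y. small q u"
  have S: "S \<in> \<I>" using inv by (auto simp: greedy_inv_def)
  have gr: "S \<subseteq> {..<n}" "Y \<subseteq> {..<n}" using S Y indep_ground by auto
  have finO: "finite Y" using Y indep_finite by auto
  let ?B = "blocked Y S"
  have finB: "finite ?B" using finO by (auto simp: blocked_def)
  have "(\<Sum>u\<in>?B. hval \<rho> S u) / \<eta> \<le> real p' * (f S - f {})"
  proof -
    have "0 \<le> (real (p' * card S) - real (card ?B)) * \<tau>'"
      using card_blocked[OF Y(1) S] \<tau>' by (simp flip: of_nat_mult)
    moreover have "(real (p' * card S) - real (card ?B)) * \<tau>' + (\<Sum>u\<in>?B. hval \<rho> S u) / \<eta>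
        \<le> real p' * (f S - f {})"
      using inv Y by (auto simp: greedy_inv_def)
    ultimately show ?thesis
      by linarith
  qed
  also have "\<dots> \<le> real p' * f S"
    using f_nonneg[of "{}"] by (intro mult_left_mono) auto
  finally have B: "(\<Sum>u\<in>?B. hval \<rho> S u) \<le> \<eta> * real p' * f S"
    using \<eta> by (simp add: field_simps)
  have each: "marg S u \<le> (if u \<in> ?B then hval \<rho> S u else 0) + \<rho> * kcost u + \<tau>" if "u \<in> Y" for u
  proof -
    have u: "small q u" "u < n" using Y that by (auto simp: small_def)
    have c: "0 \<le> \<rho> * kcost u" using \<rho> kcost_nonneg u by simp
    show ?thesis
    proof (cases "\<rho> * kcost u \<le> marg S u \<and> u \<notin> S")
      case True
      then show ?thesis
        using scan[of u] u c \<tau> that by (auto simp: scanned_def blocked_def hval_def)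
    next
      case False
      then have "marg S u \<le> \<rho> * kcost u"
        using c by (auto simp: marg_def insert_absorb)
      moreover have "0 \<le> (if u \<in> ?B then hval \<rho> S u else 0)"
        using c by (auto simp: hval_def)
      ultimately show ?thesis
        using \<tau> by linarith
    qed
  qed
  have "f Y \<le> f (S \<union> Y)"
    using gr by (intro f_mono) auto
  also have "\<dots> \<le> f S + (\<Sum>u\<in>Y. marg S u)"
    by (rule f_union_le[OF gr])
  also have "(\<Sum>u\<in>Y. marg S u) \<le> (\<Sum>u\<in>Y. (if u \<in> ?B then hval \<rho> S u else 0) + \<rho> * kcost u + \<tau>)"
    by (intro sum_mono each)
  also have "\<dots> = (\<Sum>u\<in>?B. hval \<rho> S u) + \<rho> * (\<Sum>u\<in>Y. kcost u) + real (card Y) * \<tau>"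
  proof -
    have "(\<Sum>u\<in>Y. if u \<in> ?B then hval \<rho> S u else 0) = (\<Sum>u\<in>?B. hval \<rho> S u)"
      using finO by (intro sum.mono_neutral_cong_right) (auto simp: blocked_def)
    then show ?thesis
      by (simp add: sum.distrib sum_distrib_left)
  qed
  also have "real (card Y) * \<tau> \<le> e"
    using card_mono[OF _ gr(2)] \<tau> e order_trans[OF mult_right_mono[of "real (card Y)" "real n" \<tau>]]
    by simp
  finally show "f Y \<le> (\<eta> * real p' + 1) * f S + \<rho> * (\<Sum>u\<in>Y. kcost u) + e"
    using B by (simp add: algebra_simps)
qed

section \<open>Runs that overflow a knapsack\<close>

lemma card_infeasible:
  assumes "\<not> kfeas W" "\<forall>u\<in>W. small q u" "finite W"
  shows "q < card W"
proof (rule ccontr)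
  assume "\<not> q < card W"
  have "(\<Sum>u\<in>W. cost x i u) \<le> budget x i" if "i < d" for i
  proof (cases "q = 0")
    case True
    then show ?thesis
      using \<open>\<not> q < card W\<close> assms(3) budget_pos[OF that] by simp
  next
    case False
    have "(\<Sum>u\<in>W. cost x i u) \<le> real (card W) * (budget x i / real q)"
      using assms(2) that False by (intro sum_bounded_above) (auto simp: small_def field_simps)
    also have "\<dots> \<le> real q * (budget x i / real q)"
      using \<open>\<not> q < card W\<close> budget_pos[OF that] by (intro mult_right_mono) auto
    finally show ?thesis
      using False by simp
  qed
  then show False
    using assms(1) by (auto simp: kfeas_def)
qed

text \<open>Averaging over the elements that may be dropped.\<close>

lemma greedy_drop:
  assumes inv: "greedy_inv q \<rho> \<eta> \<tau> S" and W: "W \<subseteq> S" "\<not> kfeas W" and \<rho>: "0 \<le> \<rho>"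
  shows "\<exists>w\<in>W. \<rho> * (real q / (real q + 1)) \<le> f (W - {w})"
proof (rule ccontr)
  assume "\<not> ?thesis"
  then have less: "f (W - {w}) < \<rho> * (real q / (real q + 1))" if "w \<in> W" for w
    using that by force
  have S: "S \<in> \<I>" "\<forall>u\<in>S. small q u"
    using inv by (auto simp: greedy_inv_def)
  have fin: "finite W" and gr: "W \<subseteq> {..<n}"
    using indep_finite[OF S(1)] indep_ground[OF S(1)] W finite_subset by auto
  have card: "q < card W"
    using card_infeasible[OF W(2) _ fin] S W by auto
  then have "W \<noteq> {}" by auto
  let ?k = "\<Sum>u\<in>W. kcost u"
  \<comment> \<open>The sets \<open>W - {w}\<close> contain each element \<open>card W - 1\<close>
    times in total, and an infeasible set costs more than 1, so their values add up to at least
    \<open>\<rho> * (card W - 1)\<close>. Since \<open>card W\<close> is at least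
    \<open>q + 1\<close>, their mean is at least \<open>\<rho> * q / (q + 1)\<close>.\<close>
  have "real (card W - 1) * \<rho> * 1 \<le> real (card W - 1) * \<rho> * ?k"
    using kcost_infeasible[OF W(2) gr] \<rho> by (intro mult_left_mono) auto
  also have "\<dots> = (\<Sum>w\<in>W. \<rho> * (\<Sum>u\<in>W - {w}. kcost u))"
  proof -
    have "(\<Sum>w\<in>W. (\<Sum>u\<in>W - {w}. kcost u)) = (\<Sum>w\<in>W. ?k - kcost w)"
      using fin by (intro sum.cong) (auto simp: sum_diff1)
    also have "\<dots> = real (card W - 1) * ?k"
      using card by (simp add: sum_subtractf of_nat_diff algebra_simps)
    finally show ?thesis
      by (simp flip: sum_distrib_left)
  qed
  also have "\<dots> \<le> (\<Sum>w\<in>W. f (W - {w}))"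
  proof (rule sum_mono)
    fix w
    have "W - {w} \<subseteq> S" using W by auto
    then have "\<rho> * (\<Sum>u\<in>W - {w}. kcost u) \<le> f (W - {w}) - f {}"
      using inv unfolding greedy_inv_def by blast
    then show "\<rho> * (\<Sum>u\<in>W - {w}. kcost u) \<le> f (W - {w})"
      using f_nonneg[of "{}"] by simp
  qed
  also have "\<dots> < (\<Sum>w\<in>W. \<rho> * (real q / (real q + 1)))"
    using fin \<open>W \<noteq> {}\<close> less by (intro sum_strict_mono) auto
  also have "\<dots> = real (card W) * real q / (real q + 1) * \<rho>"
    by simp
  finally have "real (card W - 1) * \<rho> < real (card W) * real q / (real q + 1) * \<rho>"
    by simp
  then have "real (card W - 1) < real (card W) * real q / (real q + 1)"
    using \<rho> by (rule mult_right_less_imp_less)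
  then have "real (card W - 1) * (real q + 1) < real (card W) * real q"
    by (simp add: field_simps)
  moreover have "real (card W - 1) = real (card W) - 1"
    using card by (simp add: of_nat_diff)
  ultimately show False
    using card by (simp add: algebra_simps)
qed

text \<open>An infeasible set costs more than 1, so for positive \<open>\<rho>\<close> it gains more
  than \<open>\<rho>\<close> over \<open>f {}\<close>, but \<open>n\<close> elements gain at most
  \<open>n * m\<close>. A run at density \<open>n * m\<close> thus cannot overflow, which gives the
  bisection its first upper end.\<close>

lemma greedy_infeasible_bound:
  assumes inv: "greedy_inv q \<rho> \<eta> \<tau> S" and vio: "\<not> kfeas S"
    and m: "\<And>u. u \<in> S \<Longrightarrow> f {u} \<le> m" and "0 < m"
  shows "\<rho> < real n * m"
proof -
  have S: "S \<in> \<I>"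
    using inv by (auto simp: greedy_inv_def)
  have gr: "S \<subseteq> {..<n}"
    using indep_ground[OF S] by simp
  have fS: "f S - f {} \<le> real n * m"
  proof -
    have "f S - f {} \<le> (\<Sum>u\<in>S. marg {} u)"
      using f_union_le[of "{}" S] gr by simp
    also have "\<dots> \<le> real (card S) * m"
      using gr m marg_le_singleton[of "{}"] by (intro sum_bounded_above) force
    also have "\<dots> \<le> real n * m"
      using card_mono[OF _ gr] \<open>0 < m\<close> by (intro mult_right_mono) auto
    finally show ?thesis .
  qed
  have k: "1 < (\<Sum>u\<in>S. kcost u)"
    by (rule kcost_infeasible[OF vio gr])
  show ?thesis
  proof (cases "\<rho> > 0")
    case True
    then have "\<rho> < \<rho> * (\<Sum>u\<in>S. kcost u)"
      using k by simp
    also have "\<dots> \<le> f S - f {}"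
      using inv by (auto simp: greedy_inv_def)
    finally show ?thesis using fS by simp
  next
    case False
    have "S \<noteq> {}" using k by auto
    then have "0 < n" using gr by auto
    then have "0 < real n * m" using \<open>0 < m\<close> by simp
    then show ?thesis using False by linarith
  qed
qed

section \<open>Approximation guarantees\<close>

lemma f_union_singletons:
  assumes "finite K" "K \<subseteq> {..<n}" "S \<subseteq> {..<n}" "\<And>u. u \<in> K \<Longrightarrow> f {u} \<le> V"
  shows "f (S \<union> K) \<le> f S + real (card K) * V"
proof -
  have "(\<Sum>u\<in>K. marg S u) \<le> real (card K) * V"
    using assms marg_le_singleton[of S] by (intro sum_bounded_above) force
  then show ?thesis
    using f_union_le[of S K] assms by simp
qed

text \<open>Elements are split off two at a time; a last single one counts as the pair
  \<open>{u, u}\<close>. Rounding up the number of pairs costs the extra 1/2 that turns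
  \<open>p + 1\<close> into \<open>p + 3/2\<close>.\<close>

lemma f_union_pairs:
  assumes "finite K" "K \<subseteq> {..<n}" "S \<subseteq> {..<n}" "\<And>u v. u \<in> K \<Longrightarrow> v \<in> K \<Longrightarrow> f {u, v} \<le> V" "0 \<le> V"
  shows "f (S \<union> K) \<le> f S + (real (card K) + 1) / 2 * V"
  using assms(1,2,4)
proof (induction "card K" arbitrary: K rule: less_induct)
  case less
  show ?case
  proof (cases "card K \<le> 1")
    case True
    then have "card K = 0 \<or> card K = 1" by auto
    then consider "K = {}" | u where "K = {u}"
      using less.prems(1) by (metis card_0_eq card_1_singletonE)
    then show ?thesis
    proof cases
      case 1
      then show ?thesis using \<open>0 \<le> V\<close> by simp
    next
      case 2
      then show ?thesis
        using f_subadd[of S "{u}"] less.prems(2) less.prems(3)[of u u] assms(3) by simp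
    qed
  next
    case False
    then obtain u where u: "u \<in> K"
      using less.prems(1) by fastforce
    have "K - {u} \<noteq> {}"
    proof
      assume "K - {u} = {}"
      then have "K = {u}" using u by auto
      then show False using False by simp
    qed
    then obtain v where v: "v \<in> K" "v \<noteq> u"
      by auto
    let ?K = "K - {u, v}"
    have card: "card K = card ?K + 2"
    proof -
      have "card ?K = card K - card {u, v}"
        using u v less.prems(1) by (intro card_Diff_subset) auto
      then show ?thesis
        using v False by simp
    qed
    have "S \<union> K = (S \<union> ?K) \<union> {u, v}"
      using u v by auto
    then have "f (S \<union> K) \<le> f (S \<union> ?K) + f {u, v}"
      using f_subadd[of "S \<union> ?K" "{u, v}"] u v less.prems(2) assms(3) by auto
    also have "f (S \<union> ?K) \<le> f S + (real (card ?K) + 1) / 2 * V"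
      using less.prems card by (intro less.hyps) auto
    also have "f {u, v} \<le> V"
      using less.prems u v by auto
    finally show ?thesis
      by (simp add: card field_simps)
  qed
qed

text \<open>Each element of \<open>K\<close> takes more than a share \<open>1/q\<close> of some
  knapsack, and each knapsack has room for at most \<open>q - 1\<close> such elements.\<close>

lemma card_big:
  assumes feas: "kfeas Y" and K: "K \<subseteq> Y" "Y \<subseteq> {..<n}" "\<And>u. u \<in> K \<Longrightarrow> \<not> small q u" and q: "1 \<le> q"
  shows "card K \<le> d * (q - 1)"
proof -
  let ?A = "\<lambda>i. {u \<in> K. budget x i < real q * cost x i u}"
  have fin: "finite Y" "finite K" using K finite_subset[of _ "{..<n}"] by blast+
  have "card (?A i) \<le> q - 1" if i: "i < d" for i
  proof (rule ccontr)
    assume "\<not> card (?A i) \<le> q - 1"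
    then have c: "q \<le> card (?A i)" by simp
    then have ne: "?A i \<noteq> {}" using q by force
    have finA: "finite (?A i)" using fin by simp
    have "budget x i = real q * (budget x i / real q)"
      using q by simp
    also have "\<dots> \<le> real (card (?A i)) * (budget x i / real q)"
      using c budget_pos[OF i] by (intro mult_right_mono) auto
    also have "\<dots> = (\<Sum>u\<in>?A i. budget x i / real q)"
      by simp
    also have "\<dots> < (\<Sum>u\<in>?A i. cost x i u)"
      using finA ne q by (intro sum_strict_mono) (auto simp: field_simps)
    also have "\<dots> \<le> (\<Sum>u\<in>Y. cost x i u)"
      using K fin cost_nonneg[OF i] by (intro sum_mono2) auto
    also have "\<dots> \<le> budget x i"
      using feas i by (auto simp: kfeas_def)
    finally show False by simp
  qed
  moreover have "K \<subseteq> (\<Union>i<d. ?A i)"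
  proof
    fix u assume u: "u \<in> K"
    then have "\<not> small q u" "u < n"
      using K by auto
    then show "u \<in> (\<Union>i<d. ?A i)"
      using u by (force simp: small_def not_le)
  qed
  then have "card K \<le> card (\<Union>i<d. ?A i)"
    using fin by (intro card_mono) auto
  moreover have "card (\<Union>i<d. ?A i) \<le> (\<Sum>i<d. card (?A i))"
    by (intro card_UN_le) auto
  ultimately have "card K \<le> (\<Sum>i<d. q - 1)"
    by (meson order_trans sum_mono lessThan_iff)
  then show ?thesis by simp
qed

lemma kcost_big:
  assumes "u < n" "\<not> small q u" "1 \<le> q"
  shows "1 / real q \<le> kcost u"
proof -
  obtain i where i: "i < d" "budget x i < real q * cost x i u"
    using assms by (auto simp: small_def not_le)
  then have "1 / real q \<le> cost x i u / budget x i"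
    using budget_pos[OF i(1)] assms(3) by (simp add: field_simps)
  then show ?thesis
    using cost_le_kcost[OF assms(1) i(1)] by linarith
qed

text \<open>This is \<open>cert\<close> at the balanced density \<open>V * (q + 1) / q\<close>, with
  the error measured in units of \<open>V\<close>. Only feasible competitors are considered, because
  the inaccuracy of the density is multiplied by their total cost, which is then at most
  \<open>d\<close>.\<close>

definition search_result :: "nat \<Rightarrow> real \<Rightarrow> real \<Rightarrow> real \<Rightarrow> bool" where
  "search_result q \<eta> e V \<longleftrightarrow> (\<forall>Y\<in>\<I>. kfeas Y \<longrightarrow> (\<forall>u\<in>Y. small q u) \<longrightarrow>
     f Y \<le> (\<eta> * real p' + 1) * V + (real q + 1) / real q * V * (\<Sum>u\<in>Y. kcost u) + e * V)"

lemma feasible_split: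
  fixes q :: nat
  assumes "feasible x Y"
  defines "A \<equiv> {u \<in> Y. small q u}" and "B \<equiv> {u \<in> Y. \<not> small q u}"
  shows "A \<in> \<I>" "kfeas A" "Y = A \<union> B" "finite B" "A \<subseteq> {..<n}" "B \<subseteq> {..<n}"
    "(\<Sum>u\<in>A. kcost u) + (\<Sum>u\<in>B. kcost u) \<le> real d"
proof -
  have Y: "Y \<in> \<I>" "kfeas Y" using assms by (auto simp: feasible_iff)
  show "A \<in> \<I>" "kfeas A"
    using feasible_subset[OF assms(1), of A] by (auto simp: feasible_iff A_def)
  show *: "Y = A \<union> B" by (auto simp: A_def B_def)
  show "finite B" "A \<subseteq> {..<n}" "B \<subseteq> {..<n}"
    using indep_finite indep_ground Y * by blast+
  then have "(\<Sum>u\<in>A. kcost u) + (\<Sum>u\<in>B. kcost u) = (\<Sum>u\<in>Y. kcost u)"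
    unfolding * using finite_subset[of A] by (intro sum.union_disjoint[symmetric]) (auto simp: A_def B_def)
  then show "(\<Sum>u\<in>A. kcost u) + (\<Sum>u\<in>B. kcost u) \<le> real d"
    using kcost_feasible[OF Y(2)] by simp
qed

lemma ratio_singletons:
  assumes res: "search_result 2 \<eta> e V" and Y: "feasible x Y"
    and single: "\<And>u. feasible x {u} \<Longrightarrow> f {u} \<le> V" and V: "0 \<le> V"
  shows "f Y \<le> (\<eta> * real p' + 1 + 7 / 4 * real d + e) * V"
proof -
  define A where "A = {u \<in> Y. small 2 u}"
  define B where "B = {u \<in> Y. \<not> small 2 u}"
  note split = feasible_split[OF Y, of 2, folded A_def B_def]
  have "f Y \<le> f A + real (card B) * V"
    unfolding split(3) using split(4-6) single feasible_subset[OF Y]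
    by (intro f_union_singletons) (auto simp: B_def)
  moreover have "f A \<le> (\<eta> * real p' + 1) * V + 3 / 2 * V * (\<Sum>u\<in>A. kcost u) + e * V"
    using res split(1,2) by (auto simp: search_result_def A_def)
  moreover have "3 / 2 * V * (\<Sum>u\<in>A. kcost u) \<le> 3 / 2 * V * (real d - real (card B) / 2)"
  proof -
    have "real (card B) * (1 / 2) \<le> (\<Sum>u\<in>B. kcost u)"
      using split(4-6) kcost_big[of _ 2] by (intro sum_bounded_below) (auto simp: B_def)
    then show ?thesis
      using split(7) V by (intro mult_left_mono) auto
  qed
  moreover have "real (card B) * V \<le> real d * V"
  proof -
    have "card B \<le> d * (2 - 1)"
      using Y indep_ground by (intro card_big[of Y]) (auto simp: B_def feasible_iff)
    then show ?thesis
      using V by (intro mult_right_mono) auto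
  qed
  ultimately show ?thesis
    by (simp add: algebra_simps)
qed

lemma ratio_pairs:
  assumes res: "search_result 3 \<eta> e V" and Y: "feasible x Y"
    and single: "\<And>u. feasible x {u} \<Longrightarrow> f {u} \<le> V" and V: "0 \<le> V"
    and pair: "\<And>u v. feasible x {u, v} \<Longrightarrow> kcost u \<le> 3 / 4 \<Longrightarrow> kcost v \<le> 3 / 4 \<Longrightarrow> f {u, v} \<le> V"
  shows "f Y \<le> (\<eta> * real p' + 3 / 2 + 13 / 9 * real d + e) * V"
proof -
  define A where "A = {u \<in> Y. small 3 u}"
  define B where "B = {u \<in> Y. \<not> small 3 u}"
  note split = feasible_split[OF Y, of 3, folded A_def B_def]
  define C where "C = {u \<in> B. kcost u \<le> 3 / 4}"
  define E where "E = {u \<in> B. \<not> kcost u \<le> 3 / 4}"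
  have BCE: "B = C \<union> E" "C \<inter> E = {}" by (auto simp: C_def E_def)
  then have fin: "finite C" "finite E" and gr: "C \<subseteq> {..<n}" "E \<subseteq> {..<n}"
    using split by auto
  have "f Y = f ((A \<union> C) \<union> E)"
    using split(3) BCE by (simp add: Un_assoc)
  also have "\<dots> \<le> f (A \<union> C) + real (card E) * V"
    using fin gr split(5) single feasible_subset[OF Y]
    by (intro f_union_singletons) (auto simp: E_def B_def)
  also have "f (A \<union> C) \<le> f A + (real (card C) + 1) / 2 * V"
    using fin gr split(5) V feasible_subset[OF Y]
    by (intro f_union_pairs pair) (auto simp: C_def B_def)
  finally have "f Y \<le> f A + (real (card C) + 1) / 2 * V + real (card E) * V" by simp
  moreover have "f A \<le> (\<eta> * real p' + 1) * V + 4 / 3 * V * (\<Sum>u\<in>A. kcost u) + e * V"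
    using res split(1,2) by (auto simp: search_result_def A_def)
  moreover have "4 / 3 * V * (\<Sum>u\<in>A. kcost u) \<le> 4 / 3 * V * (real d - real (card C) / 3 - 3 / 4 * real (card E))"
  proof -
    have "real (card C) * (1 / 3) \<le> (\<Sum>u\<in>C. kcost u)"
      using gr kcost_big[of _ 3] by (intro sum_bounded_below) (auto simp: C_def B_def)
    moreover have "real (card E) * (3 / 4) \<le> (\<Sum>u\<in>E. kcost u)"
      by (intro sum_bounded_below) (auto simp: E_def)
    moreover have "(\<Sum>u\<in>B. kcost u) = (\<Sum>u\<in>C. kcost u) + (\<Sum>u\<in>E. kcost u)"
      unfolding BCE(1) using fin BCE(2) by (intro sum.union_disjoint)
    ultimately show ?thesis
      using split(7) V by (intro mult_left_mono) auto
  qed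
  moreover have "real (card C) * V \<le> real d * 2 * V"
  proof -
    have "card C \<le> d * (3 - 1)"
      using Y indep_ground by (intro card_big[of Y]) (auto simp: C_def B_def feasible_iff)
    then have "real (card C) \<le> real (d * 2)" by (simp del: of_nat_mult)
    then show ?thesis
      using V by (intro mult_right_mono) auto
  qed
  ultimately have *: "real (card C) * V \<le> 2 * (real d * V)" and **: "f Y \<le> (\<eta> * real p' + 1) * V
      + 4 / 3 * V * (real d - real (card C) / 3 - 3 / 4 * real (card E)) + e * V
      + (real (card C) + 1) / 2 * V + real (card E) * V"
    by auto
  note **
  \<comment> \<open>The coefficient of \<open>card C\<close> is 1/2 - 4/9 = 1/18, and that of
    \<open>card E\<close> vanishes as 4/3 * 3/4 = 1.\<close>
  also have "\<dots> = \<eta> * real p' * V + 3 / 2 * V + 4 / 3 * (real d * V) + e * V + 1 / 18 * (real (card C) * V)"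
    by (simp add: field_simps)
  also have "\<dots> \<le> \<eta> * real p' * V + 3 / 2 * V + 13 / 9 * (real d * V) + e * V"
    using * by linarith
  also have "\<dots> = (\<eta> * real p' + 3 / 2 + 13 / 9 * real d + e) * V"
    by (simp add: algebra_simps)
  finally show ?thesis .
qed

text \<open>A knapsack violated by two elements of total cost at most 3/4 each is the most loaded one of either.\<close>

lemma kfeas_pair:
  assumes uv: "u < n" "v < n" "kcost u \<le> 3 / 4" "kcost v \<le> 3 / 4" "kfeas {u}"
    and i: "i < d" "\<And>k. k < d \<Longrightarrow> cost x k u / budget x k \<le> cost x i u / budget x i"
    and j: "j < d" "\<And>k. k < d \<Longrightarrow> cost x k v / budget x k \<le> cost x j v / budget x j"
    and le: "cost x i u + cost x i v \<le> budget x i" "cost x j u + cost x j v \<le> budget x j"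
  shows "kfeas {u, v}"
proof (cases "u = v")
  case True
  then show ?thesis using uv by simp
next
  case False
  \<comment> \<open>A load \<open>k\<close> that is not above another load \<open>l\<close> of
    \<open>a\<close> is at most half of the total 3/4. The bound 1/2 is what two elements sharing
    knapsack \<open>k\<close> can afford.\<close>
  have key: "cost x k a / budget x k \<le> 1 / 2"
    if "a < n" "kcost a \<le> 3 / 4" "k < d" "l < d" "k \<noteq> l"
      "cost x k a / budget x k \<le> cost x l a / budget x l" for a k l
  proof -
    have "(\<Sum>i\<in>{k, l}. cost x i a / budget x i) \<le> kcost a"
      unfolding kcost_def using that budget_pos cost_nonneg
      by (intro sum_mono2) (auto intro!: divide_nonneg_pos)
    then show ?thesis using that by simp
  qed
  have "cost x k u + cost x k v \<le> budget x k" if k: "k < d" for k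
  proof (cases "k = i \<or> k = j")
    case True
    then show ?thesis using le by auto
  next
    case False
    then have "cost x k u / budget x k \<le> 1 / 2" "cost x k v / budget x k \<le> 1 / 2"
      using key[of u k i] key[of v k j] uv i j k by auto
    then show ?thesis
      using budget_pos[OF k] by (simp add: field_simps)
  qed
  then show ?thesis
    using False by (simp add: kfeas_def)
qed

end

section \<open>The program\<close>

lemma stored_set_subset: "stored_set n M b \<subseteq> {..<n}"
  by (auto simp: stored_set_def)

lemma stored_set_cong: "(\<And>u. u < n \<Longrightarrow> M' (b + u) = M (b + u)) \<Longrightarrow> stored_set n M' b = stored_set n M b"
  by (auto simp: stored_set_def)

lemma stored_set_upd_out:
  "a < b \<or> b + n \<le> a \<Longrightarrow> stored_set n (M(a := v)) b = stored_set n M b"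
  by (rule stored_set_cong) auto

lemma stored_set_insert:
  "u < n \<Longrightarrow> 0 < v \<Longrightarrow> stored_set n (M(b + u := v)) b = insert u (stored_set n M b)"
  by (auto simp: stored_set_def)

lemma stored_set_remove: "stored_set n (M(b + u := 0)) b = stored_set n M b - {u}"
  by (auto simp: stored_set_def)

lemmas stored_set_simps = stored_set_upd_out stored_set_insert stored_set_remove

text \<open>The machine branches only on strict inequalities, so "all knapsacks satisfy
  \<open>A\<close>" is tested by counting those that do and comparing the count with
  \<open>d\<close>.\<close>

definition count_below :: "(nat \<Rightarrow> bool) \<Rightarrow> nat \<Rightarrow> nat" where
  "count_below A j = card {i. i < j \<and> A i}"

lemma count_below_0 [simp]: "count_below A 0 = 0"
  by (simp add: count_below_def)

lemma count_below_Suc [simp]: "count_below A (Suc j) = count_below A j + (if A j then 1 else 0)"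
proof -
  have "{i. i < Suc j \<and> A i} = (if A j then insert j {i. i < j \<and> A i} else {i. i < j \<and> A i})"
    by (auto simp: less_Suc_eq)
  then show ?thesis
    by (auto simp: count_below_def)
qed

lemma count_below_less: "count_below A j < j \<longleftrightarrow> \<not> (\<forall>i<j. A i)"
proof (induction j)
  case (Suc j)
  have "count_below A j \<le> j"
    using card_mono[of "{..<j}" "{i. i < j \<and> A i}"] by (auto simp: count_below_def)
  then show ?case
    using Suc by (auto simp: less_Suc_eq)
qed simp

text \<open>
  Registers: \<open>M 3 = 0\<close>, \<open>M 4 = 1\<close>, \<open>M 5\<close> and \<open>M 6\<close> are the current element and knapsack, \<open>M 11\<close> tells
  whether a knapsack is violated; the current set, the best set and the small elements are stored at
  \<open>M 14 = 30\<close>, \<open>M 15 = 30 + n\<close> and \<open>M 16 = 30 + 2n\<close>. \<open>R 3\<close> is the density, \<open>R 4\<close> the threshold, \<open>R 5\<close> and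
  \<open>R 11\<close> are the values of the current and the best set, \<open>R 12\<close> and \<open>R 13\<close> enclose the density; the
  total cost of an element \<open>u\<close> is stored at \<open>R (30 + u)\<close>, the load of knapsack \<open>i\<close> at \<open>R (30 + n + i)\<close>.
\<close>

definition upd_loads :: com where
  "upd_loads = Atom (NConst 10 0) ;; For 6 1 (
     Atom (NAdd 8 15 6) ;; Atom (ReadCost 7 6 5) ;; Atom (RMul 7 7 9) ;; Atom (RLoad 8 8) ;;
     Atom (RAdd 7 8 7) ;; Atom (RStore 8 7) ;; Atom (ReadBudget 8 6) ;;
     UnlessR 8 7 (Atom (NAdd 10 10 4)))"

text \<open>The outermost test skips everything once a knapsack is violated, which freezes the set
  at the first overflow. The element is inserted for the two queries and removed again; only
  acceptance reaches \<open>upd_loads\<close>, so a rejection takes constant time.\<close>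

definition scan_element :: com where
  "scan_element = UnlessN 3 11 (Atom (NAdd 8 14 5) ;; Atom (NLoad 9 8) ;; UnlessN 3 9 (
     Atom (NAdd 12 16 5) ;; Atom (NLoad 9 12) ;; UnlessN 9 4 (
     Atom (NStore 8 4) ;; Atom (QueryIndep 9 14) ;; Atom (QueryValue 6 14) ;; Atom (NStore 8 3) ;;
     Atom (RSub 7 6 5) ;; UnlessR 7 4 (
     Atom (RLoad 8 8) ;; Atom (RMul 8 3 8) ;; UnlessR 7 8 (UnlessN 9 4 (
     Atom (NStore 8 4) ;; Atom (RAdd 5 6 1) ;; Atom (RConst 9 1) ;; upd_loads ;;
     Atom (NConst 11 1) ;; UnlessN 10 1 (Atom (NConst 11 0))))))))"

context smks_ctx
begin

definition loads :: "(nat \<Rightarrow> real) \<Rightarrow> (nat \<Rightarrow> real) \<Rightarrow> bool" where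
  "loads R L \<longleftrightarrow> (\<forall>i<d. R (30 + n + i) = L i)"

text \<open>Between two states related by \<open>frN\<close> and \<open>frR\<close>, only scratch registers, the current set and the loads change.\<close>

definition frN :: "(nat \<Rightarrow> nat) \<Rightarrow> (nat \<Rightarrow> nat) \<Rightarrow> bool" where
  "frN M M' \<longleftrightarrow> (\<forall>a. (a < 5 \<or> 13 < a) \<and> (a < 30 \<or> 30 + n \<le> a) \<longrightarrow> M' a = M a)"

definition frR :: "(nat \<Rightarrow> real) \<Rightarrow> (nat \<Rightarrow> real) \<Rightarrow> bool" where
  "frR R R' \<longleftrightarrow> (\<forall>a. (a < 4 \<or> 9 < a) \<and> a \<noteq> 18 \<and> a < 30 + n \<longrightarrow> R' a = R a)"

definition with_loads :: "(nat \<Rightarrow> real) \<Rightarrow> (nat \<Rightarrow> real) \<Rightarrow> nat \<Rightarrow> real" where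
  "with_loads L R a = (if a < 30 + n then R a else L (a - (30 + n)))"

lemma with_loads_less [simp]: "a < 30 + n \<Longrightarrow> with_loads L R a = R a"
  and loads_with_loads [simp]: "loads (with_loads L R) L' \<longleftrightarrow> (\<forall>i<d. L i = L' i)"
  by (auto simp: with_loads_def loads_def)

lemma loads_upd [simp]: "a < 30 + n \<Longrightarrow> loads (R(a := v)) L = loads R L"
  by (auto simp: loads_def)

text \<open>\<open>R 9\<close> is a sign: 1 if the element \<open>M 5\<close> enters the set, -1 if
  it leaves. The same pass decides feasibility through the counter \<open>M 10\<close>.\<close>

lemma wp_upd_loads:
  assumes M: "M 1 = d" "M 4 = 1" "M 15 = 30 + n" and L: "loads R L"
    and Q: "\<And>i a k b c L' t'. \<lbrakk>\<forall>i<d. L' i = L i + cost x i (M 5) * R 9;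
        k < d \<longleftrightarrow> \<not> (\<forall>i<d. L i + cost x i (M 5) * R 9 \<le> budget x i); t' \<le> t + 2 + 11 * d\<rbrakk> \<Longrightarrow>
        Q (M(6 := i, 8 := a, 10 := k)) (with_loads L' (R(7 := b, 8 := c))) t'"
  shows "wp x upd_loads Q M R t"
  unfolding upd_loads_def
proof (intro wp_Seq wp_atoms)
  let ?L = "\<lambda>i. L i + cost x i (M 5) * R 9"
  let ?J = "\<lambda>j M' R' t'. (\<forall>a. a \<noteq> 6 \<and> a \<noteq> 8 \<and> a \<noteq> 10 \<longrightarrow> M' a = M a) \<and>
     (\<forall>a. a \<noteq> 7 \<and> a \<noteq> 8 \<and> (a < 30 + n \<or> 30 + n + j \<le> a) \<longrightarrow> R' a = R a) \<and>
     (\<forall>i<j. R' (30 + n + i) = ?L i) \<and>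
     M' 10 = count_below (\<lambda>i. ?L i \<le> budget x i) j \<and> t' \<le> t + 2 + 11 * j"
  show "wp x (For 6 1 (Atom (NAdd 8 15 6) ;; Atom (ReadCost 7 6 5) ;; Atom (RMul 7 7 9) ;; Atom (RLoad 8 8) ;;
     Atom (RAdd 7 8 7) ;; Atom (RStore 8 7) ;; Atom (ReadBudget 8 6) ;;
     UnlessR 8 7 (Atom (NAdd 10 10 4)))) Q (M(10 := 0)) R (Suc t)"
  proof (rule wp_For[where J = ?J and K = d])
    fix j M' R' t'
    assume j: "j < d" and M'6: "M' 6 = j" and J: "?J j M' R' t'"
    have [simp]: "M' 15 = 30 + n" "M' 5 = M 5" "M' 4 = 1" "M' 1 = d" "R' 9 = R 9" "R' (30 + n + j) = L j"
      using J M L j by (auto simp: loads_def)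
    note [simp] = M'6
    show "wp x (Atom (NAdd 8 15 6) ;; Atom (ReadCost 7 6 5) ;; Atom (RMul 7 7 9) ;; Atom (RLoad 8 8) ;;
     Atom (RAdd 7 8 7) ;; Atom (RStore 8 7) ;; Atom (ReadBudget 8 6) ;;
     UnlessR 8 7 (Atom (NAdd 10 10 4))) (\<lambda>M R t. M 6 = j \<and> M 4 = 1 \<and> M 1 = d \<and> ?J (Suc j) (M(6 := Suc j)) R (t + 2)) M' R' t'"
      using J M by (intro wp_Seq wp_atoms wp_UnlessR) (auto simp: less_Suc_eq)
  next
    fix M' R' t'
    assume "?J d M' R' t'"
    moreover from this have "M' = M(6 := M' 6, 8 := M' 8, 10 := M' 10)"
      "R' = with_loads (\<lambda>i. R' (30 + n + i)) (R(7 := R' 7, 8 := R' 8))"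
      by (auto simp: with_loads_def)
    ultimately show "Q M' R' t'"
      using Q[of "\<lambda>i. R' (30 + n + i)" "M' 10" t' "M' 6" "M' 8" "R' 7" "R' 8"]
      by (simp add: count_below_less)
  qed (use d_pos in auto)
qed

end

section \<open>Scanning a single element\<close>

context smks_ctx
begin

definition best :: "real \<Rightarrow> (nat \<Rightarrow> nat) \<Rightarrow> (nat \<Rightarrow> real) \<Rightarrow> bool" where
  "best V M R \<longleftrightarrow> R 11 = V \<and> feasible x (stored_set n M (30 + n)) \<and> f (stored_set n M (30 + n)) = V"

text \<open>The memory that stays fixed during the search: \<open>m\<close> is the first threshold,
  \<open>\<eta>\<close> the ratio of consecutive thresholds, \<open>ta\<close> the level at which
  they stop, and \<open>dm\<close> the width at which the bisection stops.\<close>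

definition env :: "nat \<Rightarrow> real \<Rightarrow> real \<Rightarrow> real \<Rightarrow> real \<Rightarrow> (nat \<Rightarrow> nat) \<Rightarrow> (nat \<Rightarrow> real) \<Rightarrow> bool" where
  "env q \<eta> m ta dm M R \<longleftrightarrow> M 0 = n \<and> M 1 = d \<and> M 3 = 0 \<and> M 4 = 1 \<and> M 14 = 30 \<and> M 15 = 30 + n \<and>
     M 16 = 30 + 2 * n \<and> (\<forall>u<n. M (30 + 2 * n + u) = (if small q u then 1 else 0)) \<and>
     R 1 = 0 \<and> R 2 = 1 \<and> R 10 = m \<and> R 14 = \<eta> \<and> R 15 = ta \<and> R 16 = dm \<and> R 19 = 2 \<and>
     (\<forall>u<n. R (30 + u) = kcost u)"

lemma frN_refl [simp]: "frN M M" and frR_refl [simp]: "frR R R"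
  by (auto simp: frN_def frR_def)

lemma frN_trans: "frN M M' \<Longrightarrow> frN M' M'' \<Longrightarrow> frN M M''"
  and frR_trans: "frR R R' \<Longrightarrow> frR R' R'' \<Longrightarrow> frR R R''"
  by (auto simp: frN_def frR_def)

lemma env_fr: "env q \<eta> m ta dm M R \<Longrightarrow> frN M M' \<Longrightarrow> frR R R' \<Longrightarrow> env q \<eta> m ta dm M' R'"
  by (auto simp: env_def frN_def frR_def)

lemma best_fr: 
  assumes "best V M R" "frN M M'" "frR R R'" 
  shows "best V M' R'"
proof -
  have "stored_set n M' (30 + n) = stored_set n M (30 + n)"
    using assms by (intro stored_set_cong) (auto simp: frN_def)
  then show ?thesis
    using assms by (auto simp: best_def frR_def)
qed

definition run_state :: "nat \<Rightarrow> real \<Rightarrow> real \<Rightarrow> real \<Rightarrow> nat set \<Rightarrow> (nat \<Rightarrow> nat) \<Rightarrow> (nat \<Rightarrow> real) \<Rightarrow> bool" where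
  "run_state q \<rho> \<eta> \<tau> S M R \<longleftrightarrow> stored_set n M 30 = S \<and> R 3 = \<rho> \<and> R 4 = \<tau> \<and> R 5 = f S \<and>
     loads R (\<lambda>i. \<Sum>u\<in>S. cost x i u) \<and> M 11 = (if kfeas S then 0 else 1) \<and> greedy_inv q \<rho> \<eta> \<tau> S"

text \<open>The clock charges 18 for the scan and \<open>8 + 11 * d\<close> only for growth of the
  set. Over a run the second part telescopes to at most \<open>n\<close> insertions, so
  \<open>d\<close> is not multiplied by the number of thresholds.\<close>

lemma wp_scan_element:
  assumes env: "env q \<eta> m ta dm M R" and rs: "run_state q \<rho> \<eta> \<tau> S M R" and u: "M 5 = u" "u < n"
    and scan: "kfeas S \<Longrightarrow> \<forall>v. scanned q \<rho> (\<eta> * \<tau>) S v"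
    and par: "1 \<le> \<eta>" "0 \<le> \<tau>" "0 \<le> \<rho>"
    and Q: "\<And>S' M' R' t'. \<lbrakk>S \<subseteq> S'; frN M M'; frR R R'; M' 5 = u; run_state q \<rho> \<eta> \<tau> S' M' R';
        kfeas S' \<Longrightarrow> kfeas S \<and> scanned q \<rho> \<tau> S' u; t' \<le> t + 18 + (8 + 11 * d) * (card S' - card S)\<rbrakk> \<Longrightarrow> Q M' R' t'"
  shows "wp x scan_element Q M R t"
proof -
  have M [simp]: "M 3 = 0" "M 4 = 1" "M 14 = 30" "M 15 = 30 + n" "M 16 = 30 + 2 * n" "M 5 = u" "M (Suc 0) = d"
    "M (30 + 2 * n + u) = (if small q u then 1 else 0)"
    "R (Suc 0) = 0" "R (30 + u) = kcost u"
    using env u by (auto simp: env_def)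
  have S [simp]: "stored_set n M 30 = S" "R 3 = \<rho>" "R 4 = \<tau>" "R 5 = f S" 
    and S': "loads R (\<lambda>i. \<Sum>u\<in>S. cost x i u)" "M 11 = (if kfeas S then 0 else 1)" "greedy_inv q \<rho> \<eta> \<tau> S"
    using rs by (auto simp: run_state_def)
  have gr: "S \<subseteq> {..<n}" and fin: "finite S" and SI: "S \<in> \<I>"
    using S'(3) indep_ground indep_finite by (auto simp: greedy_inv_def)
  have uS: "u \<in> S \<longleftrightarrow> M (30 + u) \<noteq> 0"
    using u by (auto simp flip: S(1) simp: stored_set_def)
  have ins [simp]: "stored_set n (M'(30 + u := Suc 0)) 30 = insert u (stored_set n M' 30)" for M'
    using u by (simp add: stored_set_insert)
  have keep: "Q M' R' t'"
    if "frN M M'" "frR R R'" "M' 5 = u" "stored_set n M' 30 = S" "M' 11 = M 11"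
      "R' 5 = R 5" "R' 4 = R 4" "loads R' (\<lambda>i. \<Sum>u\<in>S. cost x i u)" "t' \<le> t + 18"
      "kfeas S \<Longrightarrow> scanned q \<rho> \<tau> S u" for M' R' t'
    using that rs by (intro Q[of S]) (auto simp: run_state_def frR_def)
  have accept: "Q M' R' t'"
    if "frN M M'" "frR R R'" "M' 5 = u" "stored_set n M' 30 = insert u S"
      "M' 11 = (if kfeas (insert u S) then 0 else 1)"
      "R' 5 = f (insert u S)" "R' 4 = R 4" "loads R' (\<lambda>i. (\<Sum>u\<in>S. cost x i u) + cost x i u)" "t' \<le> t + 26 + 11 * d"
      "small q u" "insert u S \<in> \<I>" "\<tau> \<le> marg S u" "\<rho> * kcost u \<le> marg S u" "kfeas S" "u \<notin> S" for M' R' t'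
  proof (rule Q[of "insert u S"])
    have "greedy_inv q \<rho> \<eta> \<tau> (insert u S)"
      using that scan S' par by (intro greedy_inv_insert) auto
    then show "run_state q \<rho> \<eta> \<tau> (insert u S) M' R'"
      using that fin by (auto simp: run_state_def frR_def add.commute)
    show "t' \<le> t + 18 + (8 + 11 * d) * (card (insert u S) - card S)"
      using that fin by simp
  qed (use that in \<open>auto simp: scanned_def\<close>)
  have kf: "kfeas (insert u S) \<longleftrightarrow> (\<forall>i<d. (\<Sum>u\<in>S. cost x i u) + cost x i u \<le> budget x i)" if "u \<notin> S"
    using that fin by (auto simp: kfeas_def add.commute)
  show ?thesis
    unfolding scan_element_def
    apply ((rule wp_Seq wp_UnlessN wp_UnlessR wp_atoms; (simp add: stored_set_simps split del: if_split)?)+)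
          apply (rule wp_upd_loads[where L = "\<lambda>i. \<Sum>u\<in>S. cost x i u"])
              apply (simp_all)[3]
           apply (use S'(1) in \<open>simp add: loads_def\<close>)
          apply ((rule wp_Seq wp_UnlessN wp_atoms; (simp split del: if_split)?)+)
    \<comment> \<open>The first two goals are acceptance without and with overflow; in all the
      others the set is unchanged.\<close>
    subgoal using uS S'(2) fin kf u(2) by (intro accept) (auto simp: frN_def frR_def stored_set_simps marg_def split: if_splits)
    subgoal using uS S'(2) fin kf u(2) by (intro accept) (auto simp: frN_def frR_def stored_set_simps marg_def split: if_splits)
    subgoal using uS S' fin by (intro keep) (auto simp: frN_def frR_def loads_def stored_set_simps scanned_def split: if_splits)
    subgoal using uS S' fin by (intro keep) (auto simp: frN_def frR_def loads_def stored_set_simps scanned_def marg_def)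
    subgoal using uS S' fin by (intro keep) (auto simp: frN_def frR_def loads_def stored_set_simps scanned_def marg_def)
    subgoal using uS S' fin by (intro keep) (auto simp: frN_def frR_def loads_def stored_set_simps scanned_def split: if_splits)
    subgoal using uS S' fin by (intro keep) (auto simp: frN_def frR_def loads_def stored_set_simps scanned_def)
    subgoal using uS S' fin by (intro keep) (auto simp: frN_def frR_def loads_def stored_set_simps scanned_def)
    done
qed

end

section \<open>The loop over the thresholds\<close>

definition run_greedy :: com where
  "run_greedy = For 5 0 (Atom (NAdd 8 14 5) ;; Atom (NStore 8 3)) ;;
     For 6 1 (Atom (NAdd 8 15 6) ;; Atom (RStore 8 1)) ;;
     Atom (NConst 11 0) ;; Atom (QueryValue 5 14) ;; Atom (RAdd 4 10 1) ;;
     DoR (For 5 0 scan_element ;; Atom (RDiv 4 4 14)) 15 4"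

context smks_ctx
begin

lemma run_state_upd5: "run_state q \<rho> \<eta> \<tau> S (M(5 := v)) R = run_state q \<rho> \<eta> \<tau> S M R"
  by (simp add: run_state_def stored_set_simps)

lemma frN_upd5: "frN M M' \<Longrightarrow> frN M (M'(5 := v))"
  by (simp add: frN_def)

lemma run_state_finite: "run_state q \<rho> \<eta> \<tau> S M R \<Longrightarrow> finite S \<and> S \<subseteq> {..<n}"
  using indep_finite indep_ground by (auto simp: run_state_def greedy_inv_def)

lemma wp_scan_all:
  assumes env: "env q \<eta> m ta dm M R" and rs: "run_state q \<rho> \<eta> \<tau> S M R" and n: "0 < n"
    and scan: "kfeas S \<Longrightarrow> \<forall>v. scanned q \<rho> (\<eta> * \<tau>) S v"
    and par: "1 \<le> \<eta>" "0 \<le> \<tau>" "0 \<le> \<rho>"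
    and Q: "\<And>S' M' R' t'. \<lbrakk>S \<subseteq> S'; frN M M'; frR R R'; run_state q \<rho> \<eta> \<tau> S' M' R';
        kfeas S' \<Longrightarrow> \<forall>v. scanned q \<rho> \<tau> S' v; t' \<le> t + 1 + 20 * n + (8 + 11 * d) * (card S' - card S)\<rbrakk> \<Longrightarrow> Q M' R' t'"
  shows "wp x (For 5 0 scan_element) Q M R t"
proof (rule wp_For[where K = n and J = "\<lambda>j M' R' t'. \<exists>S'. S \<subseteq> S' \<and> frN M M' \<and> frR R R' \<and> run_state q \<rho> \<eta> \<tau> S' M' R' \<and>
     (kfeas S' \<longrightarrow> kfeas S \<and> (\<forall>v<j. scanned q \<rho> \<tau> S' v)) \<and> t' \<le> t + 1 + 20 * j + (8 + 11 * d) * (card S' - card S)"])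
  fix j M' R' t'
  assume j: "j < n" "M' 5 = j" and "\<exists>S'. S \<subseteq> S' \<and> frN M M' \<and> frR R R' \<and> run_state q \<rho> \<eta> \<tau> S' M' R' \<and>
     (kfeas S' \<longrightarrow> kfeas S \<and> (\<forall>v<j. scanned q \<rho> \<tau> S' v)) \<and> t' \<le> t + 1 + 20 * j + (8 + 11 * d) * (card S' - card S)"
  then obtain S' where S': "S \<subseteq> S'" "frN M M'" "frR R R'" "run_state q \<rho> \<eta> \<tau> S' M' R'"
     "kfeas S' \<longrightarrow> kfeas S \<and> (\<forall>v<j. scanned q \<rho> \<tau> S' v)" "t' \<le> t + 1 + 20 * j + (8 + 11 * d) * (card S' - card S)"
    by blast
  show "wp x scan_element (\<lambda>M' R' t'. M' 5 = j \<and> M' 4 = 1 \<and> M' 0 = n \<and>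
     (\<exists>S'. S \<subseteq> S' \<and> frN M (M'(5 := Suc j)) \<and> frR R R' \<and> run_state q \<rho> \<eta> \<tau> S' (M'(5 := Suc j)) R' \<and>
       (kfeas S' \<longrightarrow> kfeas S \<and> (\<forall>v<Suc j. scanned q \<rho> \<tau> S' v)) \<and>
       t' + 2 \<le> t + 1 + 20 * Suc j + (8 + 11 * d) * (card S' - card S))) M' R' t'"
  proof (rule wp_scan_element[OF env_fr[OF env S'(2,3)] S'(4) j(2,1) _ par])
    show "\<forall>v. scanned q \<rho> (\<eta> * \<tau>) S' v" if "kfeas S'"
      using that S' scan run_state_finite[OF S'(4)] scanned_mono by blast
    fix S'' M'' R'' t''
    assume *: "S' \<subseteq> S''" "frN M' M''" "frR R' R''" "M'' 5 = j" "run_state q \<rho> \<eta> \<tau> S'' M'' R''"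
      "kfeas S'' \<Longrightarrow> kfeas S' \<and> scanned q \<rho> \<tau> S'' j" "t'' \<le> t' + 18 + (8 + 11 * d) * (card S'' - card S')"
    have fr: "frN M M''" "frR R R''"
      using S' * frN_trans frR_trans by blast+
    have "M'' 4 = 1" "M'' 0 = n"
      using env_fr[OF env fr] by (auto simp: env_def)
    moreover have "scanned q \<rho> \<tau> S'' v" if "kfeas S''" "v < Suc j" for v
      using that * S' run_state_finite[OF *(5)] by (auto simp: less_Suc_eq intro: scanned_mono)
    moreover have "t'' + 2 \<le> t + 1 + 20 * Suc j + (8 + 11 * d) * (card S'' - card S)"
    proof -
      have "card S \<le> card S'" "card S' \<le> card S''"
        using S' * run_state_finite[OF S'(4)] run_state_finite[OF *(5)] by (auto intro: card_mono)
      then have "card S'' - card S = (card S' - card S) + (card S'' - card S')"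
        by simp
      then have "(8 + 11 * d) * (card S'' - card S) = (8 + 11 * d) * (card S' - card S) + (8 + 11 * d) * (card S'' - card S')"
        by (simp only: distrib_left)
      then show ?thesis
        using * S' by simp
    qed
    ultimately show "M'' 5 = j \<and> M'' 4 = 1 \<and> M'' 0 = n \<and>
     (\<exists>S'. S \<subseteq> S' \<and> frN M (M''(5 := Suc j)) \<and> frR R R'' \<and> run_state q \<rho> \<eta> \<tau> S' (M''(5 := Suc j)) R'' \<and>
       (kfeas S' \<longrightarrow> kfeas S \<and> (\<forall>v<Suc j. scanned q \<rho> \<tau> S' v)) \<and>
       t'' + 2 \<le> t + 1 + 20 * Suc j + (8 + 11 * d) * (card S' - card S))"
      using * S' fr by (auto simp: run_state_upd5 frN_upd5 intro!: exI[of _ S''])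
  qed
next
  fix M' R' t'
  assume "\<exists>S'. S \<subseteq> S' \<and> frN M M' \<and> frR R R' \<and> run_state q \<rho> \<eta> \<tau> S' M' R' \<and>
     (kfeas S' \<longrightarrow> kfeas S \<and> (\<forall>v<n. scanned q \<rho> \<tau> S' v)) \<and> t' \<le> t + 1 + 20 * n + (8 + 11 * d) * (card S' - card S)"
  then show "Q M' R' t'"
    by (elim exE conjE, intro Q) (auto simp: scanned_def small_def)
qed (use n rs in \<open>auto simp: run_state_upd5 frN_upd5 intro!: exI[of _ S]\<close>)

lemma small_kfeas: "small q v \<Longrightarrow> 1 \<le> q \<Longrightarrow> kfeas {v}"
  unfolding kfeas_def
proof (intro allI impI)
  fix i assume "small q v" "1 \<le> q" "i < d"
  then have "1 * cost x i v \<le> real q * cost x i v" "real q * cost x i v \<le> budget x i"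
    using cost_nonneg by (auto simp: small_def simp del: mult_1 intro!: mult_right_mono)
  then show "(\<Sum>u\<in>{v}. cost x i u) \<le> budget x i"
    by simp
qed

definition run_done :: "nat \<Rightarrow> real \<Rightarrow> real \<Rightarrow> nat set \<Rightarrow> (nat \<Rightarrow> nat) \<Rightarrow> (nat \<Rightarrow> real) \<Rightarrow> bool" where
  "run_done q \<rho> \<eta> S M R \<longleftrightarrow> stored_set n M 30 = S \<and> R 3 = \<rho> \<and>
     loads R (\<lambda>i. \<Sum>u\<in>S. cost x i u) \<and> M 11 = (if kfeas S then 0 else 1) \<and> (\<exists>\<tau>. greedy_inv q \<rho> \<eta> \<tau> S)"

text \<open>By Bernoulli's inequality \<open>\<eta> ^ W\<close> is at least 2: every
  \<open>W\<close> levels at least halve the threshold, which bounds the number of levels.\<close>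

lemma eta_power_ge:
  assumes "1 \<le> W" "\<eta> = 1 + 1 / real W"
  shows "2 ^ k \<le> \<eta> ^ (W * k)"
proof -
  have "2 = 1 + real W * (1 / real W)"
    using assms by simp
  also have "\<dots> \<le> (1 + 1 / real W) ^ W"
    by (rule Bernoulli_inequality, rule order_trans[of _ 0]) auto
  finally have "2 ^ k \<le> (\<eta> ^ W) ^ k"
    using assms by (intro power_mono) auto
  then show ?thesis
    by (simp add: power_mult)
qed

text \<open>Clearing the set and the loads, then \<open>W * lg + 1\<close> passes over the elements,
  then at most \<open>n\<close> insertions.\<close>

definition run_time :: "nat \<Rightarrow> nat \<Rightarrow> nat" where
  "run_time W lg = 8 + 4 * n + 4 * d + (W * lg + 1) * (20 * n + 3) + (8 + 11 * d) * n"

lemma wp_run_greedy: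
  assumes env: "env q \<eta> m ta dm M R" and \<rho>: "R 3 = \<rho>" "0 \<le> \<rho>" and n: "0 < n" and q: "1 \<le> q"
    and W: "1 \<le> W" "\<eta> = 1 + 1 / real W" and N: "1 \<le> N" "ta = m / (real n * real N)" and lg: "real n * real N \<le> 2 ^ lg"
    and m: "0 \<le> m" "\<And>u. feasible x {u} \<Longrightarrow> f {u} \<le> m"
    and Q: "\<And>S' M' R' t'. \<lbrakk>frN M M'; frR R R'; run_done q \<rho> \<eta> S' M' R';
        kfeas S' \<Longrightarrow> cert q \<eta> (2 * m / real N) \<rho> (f S'); t' \<le> t + run_time W lg\<rbrakk> \<Longrightarrow> Q M' R' t'"
  shows "wp x run_greedy Q M R t"
proof -
  have \<eta>: "1 \<le> \<eta>" "\<eta> \<le> 2"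
    using W by auto
  have M [simp]: "M 0 = n" "M (Suc 0) = d" "M 4 = 1" "M 3 = 0" "M 14 = 30" "M 15 = 30 + n" "R (Suc 0) = 0"
    using env by (auto simp: env_def)
  define t2 where "t2 = t + 5 + 4 * n + 4 * d"
  \<comment> \<open>Before pass \<open>j\<close> the elements have been scanned at the preceding
    threshold, hence the factor \<open>\<eta>\<close>. For positive \<open>j\<close> the loop test
    has just succeeded; that conjunct is what bounds \<open>j\<close>.\<close>
  let ?lvl = "\<lambda>j M' R' t'. \<exists>S. frN M M' \<and> frR R R' \<and> run_state q \<rho> \<eta> (m / \<eta> ^ j) S M' R' \<and>
      (kfeas S \<longrightarrow> (\<forall>v. scanned q \<rho> (\<eta> * (m / \<eta> ^ j)) S v)) \<and> (0 < j \<longrightarrow> ta < m / \<eta> ^ j) \<and>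
      t' \<le> t2 + j * (20 * n + 3) + (8 + 11 * d) * card S"
  have lvl_bound: "j \<le> W * lg" if lvl: "?lvl j M' R' t'" for j M' R' t'
  proof (rule ccontr)
    assume j: "\<not> j \<le> W * lg"
    then have "m / (real n * real N) < m / \<eta> ^ j"
      using lvl N by auto
    moreover have "real n * real N \<le> \<eta> ^ j"
    proof -
      have "real n * real N \<le> \<eta> ^ (W * lg)"
        using lg eta_power_ge[OF W, of lg] by linarith
      also have "\<dots> \<le> \<eta> ^ j"
        using j \<eta> by (intro power_increasing) auto
      finally show ?thesis .
    qed
    then have "m / \<eta> ^ j \<le> m / (real n * real N)"
      using m n N by (intro divide_left_mono mult_pos_pos) (use \<eta> in auto)
    ultimately show False by simp
  qed
  have loop: "wp x (DoR (For 5 0 scan_element ;; Atom (RDiv 4 4 14)) 15 4) Q M' R' t'"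
    if init: "frN M M'" "frR R R'" "stored_set n M' 30 = {}" "R' 5 = f {}" "R' 4 = m" "loads R' (\<lambda>i. 0)" "M' 11 = 0"
      "t' \<le> t2" for M' R' t'
  proof (rule wp_DoR[where I = ?lvl and K = "W * lg"])
    have "kfeas {}" using feasible_empty by (simp add: feasible_iff)
    \<comment> \<open>No pass precedes the first one, but no feasible singleton is worth more than
      \<open>m\<close>, and small elements are feasible on their own if independent.\<close>
    moreover have "scanned q \<rho> (\<eta> * m) {} v" for v
    proof -
      have "marg {} v \<le> f {v}" if "v < n"
        using marg_le_singleton[of "{}" v] that by simp
      moreover have "m \<le> \<eta> * m"
        using \<eta> m mult_right_mono[of 1 \<eta> m] by simp
      moreover have "f {v} \<le> m" if "small q v" "{v} \<in> \<I>"
        using m(2) small_kfeas q that by (auto simp: feasible_iff)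
      ultimately show ?thesis
        by (force simp: scanned_def small_def)
    qed
    ultimately show "?lvl 0 M' R' t'"
      using init \<rho> by (intro exI[of _ "{}"]) (auto simp: run_state_def greedy_inv_empty frR_def)
  next
    show "\<And>j M' R' t'. ?lvl j M' R' t' \<Longrightarrow> j \<le> W * lg"
      by (rule lvl_bound)
  next
    fix j M' R' t'
    assume lvl: "?lvl j M' R' t'"
    note jK = lvl_bound[OF lvl]
    obtain S where S: "frN M M'" "frR R R'" "run_state q \<rho> \<eta> (m / \<eta> ^ j) S M' R'"
      "kfeas S \<Longrightarrow> \<forall>v. scanned q \<rho> (\<eta> * (m / \<eta> ^ j)) S v" 
      "t' \<le> t2 + j * (20 * n + 3) + (8 + 11 * d) * card S"
      using lvl by blast
    let ?\<tau> = "m / \<eta> ^ j"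
    have \<tau>0: "0 \<le> ?\<tau>" using m \<eta> by simp
    show "wp x (For 5 0 scan_element ;; Atom (RDiv 4 4 14))
        (\<lambda>M R t. if R 15 < R 4 then ?lvl (Suc j) M R (Suc t) else Q M R (Suc t)) M' R' t'"
    proof (rule wp_Seq, rule wp_scan_all[OF env_fr[OF env S(1,2)] S(3) n S(4) \<eta>(1) \<tau>0 \<rho>(2)], assumption, rule wp_atoms)
      fix S' M'' R'' t''
      assume *: "S \<subseteq> S'" "frN M' M''" "frR R' R''" "run_state q \<rho> \<eta> ?\<tau> S' M'' R''"
        "kfeas S' \<Longrightarrow> \<forall>v. scanned q \<rho> ?\<tau> S' v" "t'' \<le> t' + 1 + 20 * n + (8 + 11 * d) * (card S' - card S)"
      have fr: "frN M M''" "frR R R''"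
        using S * frN_trans frR_trans by blast+
      have R4: "R'' 4 = ?\<tau>" "R'' 14 = \<eta>" "R'' 15 = ta"
        using *(4) env_fr[OF env fr] by (auto simp: run_state_def env_def)
      let ?R = "R''(4 := R'' 4 / R'' 14)"
      have \<tau>': "?\<tau> / \<eta> = m / \<eta> ^ Suc j" by simp
      have fin: "finite S'" "S' \<subseteq> {..<n}"
        using run_state_finite[OF *(4)] by auto
      have rs: "run_state q \<rho> \<eta> (m / \<eta> ^ Suc j) S' M'' ?R"
      proof -
        have "m / \<eta> ^ Suc j \<le> ?\<tau>"
          using \<eta> m by (intro divide_left_mono) auto
        then show ?thesis
          using *(4) R4 \<tau>' greedy_inv_level by (auto simp: run_state_def loads_def)
      qed
      have fr': "frR R ?R"
        using fr by (simp add: frR_def)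
      have "card S \<le> card S'"
        using *(1) fin by (intro card_mono) auto
      then have "(8 + 11 * d) * card S' = (8 + 11 * d) * card S + (8 + 11 * d) * (card S' - card S)"
        by (simp flip: distrib_left)
      then have time: "Suc (Suc t'') \<le> t2 + Suc j * (20 * n + 3) + (8 + 11 * d) * card S'"
        using * S by simp
      show "if ?R 15 < ?R 4 then ?lvl (Suc j) M'' ?R (Suc (Suc t'')) else Q M'' ?R (Suc (Suc t''))"
      proof (cases "ta < ?\<tau> / \<eta>")
        case True
        have "?lvl (Suc j) M'' ?R (Suc (Suc t''))"
          using fr fr' rs *(5) time True[unfolded \<tau>'] \<eta> by (intro exI[of _ S']) auto
        then show ?thesis
          using True R4 by simp
      next
        case False
        have "Q M'' ?R (Suc (Suc t''))"
        proof (rule Q[OF fr(1) fr'])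
          show "run_done q \<rho> \<eta> S' M'' ?R"
            using rs by (auto simp: run_state_def run_done_def)
          show "cert q \<eta> (2 * m / real N) \<rho> (f S')" if "kfeas S'"
          proof (rule greedy_cert)
            show "greedy_inv q \<rho> \<eta> ?\<tau> S'"
              using *(4) by (simp add: run_state_def)
            \<comment> \<open>The loop ends because the next threshold is at most \<open>ta\<close>,
              so the one just scanned is at most \<open>\<eta> * ta\<close>. Bounding
              \<open>\<eta>\<close> by 2 gives the 2 in \<open>2 * m / real N\<close>.\<close>
            have "?\<tau> \<le> \<eta> * ta"
              using False \<eta> by (simp add: field_simps)
            also have "\<dots> \<le> 2 * ta"
              using \<eta> N m by (intro mult_right_mono) auto
            finally have "real n * ?\<tau> \<le> real n * (2 * ta)"
              by (intro mult_left_mono) auto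
            also have "\<dots> = 2 * m / real N"
              using N n by (simp add: field_simps)
            finally show "real n * ?\<tau> \<le> 2 * m / real N" .
          qed (use *(5) that \<eta> \<tau>0 \<rho> in auto)
          have "(8 + 11 * d) * card S' \<le> (8 + 11 * d) * n"
            using card_mono[OF _ fin(2)] by (intro mult_left_mono) auto
          moreover have "Suc j * (20 * n + 3) \<le> (W * lg + 1) * (20 * n + 3)"
            using jK by (intro mult_right_mono) auto
          ultimately show "Suc (Suc t'') \<le> t + run_time W lg"
            using time unfolding run_time_def t2_def by linarith
        qed
        then show ?thesis
          using False R4 by simp
      qed
    qed
  qed
  have clear_loads: "wp x (For 6 1 (Atom (NAdd 8 15 6) ;; Atom (RStore 8 1)))
      (wp x (Atom (NConst 11 0) ;; Atom (QueryValue 5 14) ;; Atom (RAdd 4 10 1) ;;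
        DoR (For 5 0 scan_element ;; Atom (RDiv 4 4 14)) 15 4) Q) M' R t'"
    if M': "frN M M'" "stored_set n M' 30 = {}" "t' \<le> t + 1 + 4 * n" for M' t'
  proof (rule wp_For[where K = d and J = "\<lambda>j M' R' t'. frN M M' \<and> stored_set n M' 30 = {} \<and> frR R R' \<and>
        (\<forall>i<j. R' (30 + n + i) = 0) \<and> t' \<le> t + 2 + 4 * n + 4 * j"])
    fix j M' R' t'
    assume *: "M' 6 = j" "j < d" "frN M M' \<and> stored_set n M' 30 = {} \<and> frR R R' \<and> (\<forall>i<j. R' (30 + n + i) = 0) \<and> t' \<le> t + 2 + 4 * n + 4 * j"
    have [simp]: "M' (Suc 0) = d" "M' 4 = 1" "M' 15 = 30 + n" "R' (Suc 0) = 0"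
      using * M unfolding frN_def frR_def by auto
    show "wp x (Atom (NAdd 8 15 6) ;; Atom (RStore 8 1)) (\<lambda>M' R' t'. M' 6 = j \<and> M' 4 = 1 \<and> M' 1 = d \<and>
        (frN M (M'(6 := Suc j)) \<and> stored_set n (M'(6 := Suc j)) 30 = {} \<and> frR R R' \<and> (\<forall>i<Suc j. R' (30 + n + i) = 0) \<and>
           t' + 2 \<le> t + 2 + 4 * n + 4 * Suc j)) M' R' t'"
      using * by (intro wp_Seq wp_atoms) (auto simp: stored_set_simps frN_def frR_def less_Suc_eq)
  next
    fix M' R' t'
    assume *: "frN M M' \<and> stored_set n M' 30 = {} \<and> frR R R' \<and> (\<forall>i<d. R' (30 + n + i) = 0) \<and> t' \<le> t + 2 + 4 * n + 4 * d"
    have [simp]: "M' 14 = 30" "R' (Suc 0) = 0" "R' 10 = m"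
      using * env unfolding frN_def frR_def env_def by auto
    show "wp x (Atom (NConst 11 0) ;; Atom (QueryValue 5 14) ;; Atom (RAdd 4 10 1) ;;
        DoR (For 5 0 scan_element ;; Atom (RDiv 4 4 14)) 15 4) Q M' R' t'"
      using * by (intro wp_Seq wp_atoms loop)
        (auto simp: stored_set_simps frN_def frR_def loads_def t2_def)
  qed (use M' d_pos in \<open>auto simp: frN_def stored_set_simps\<close>)
  show ?thesis
    unfolding run_greedy_def
  proof (rule wp_Seq, rule wp_For[where K = n and J = "\<lambda>j M' R' t'. frN M M' \<and> (\<forall>u<j. M' (30 + u) = 0) \<and> R' = R \<and> t' \<le> t + 1 + 4 * j"])
    fix j M' R' t'
    assume *: "M' 5 = j" "j < n" "frN M M' \<and> (\<forall>u<j. M' (30 + u) = 0) \<and> R' = R \<and> t' \<le> t + 1 + 4 * j"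
    have [simp]: "M' 3 = 0" "M' 4 = 1" "M' 14 = 30" "M' 0 = n"
      using * M unfolding frN_def by auto
    show "wp x (Atom (NAdd 8 14 5) ;; Atom (NStore 8 3)) (\<lambda>M' R' t'. M' 5 = j \<and> M' 4 = 1 \<and> M' 0 = n \<and>
        (frN M (M'(5 := Suc j)) \<and> (\<forall>u<Suc j. (M'(5 := Suc j)) (30 + u) = 0) \<and> R' = R \<and> t' + 2 \<le> t + 1 + 4 * Suc j)) M' R' t'"
      using * by (intro wp_Seq wp_atoms) (auto simp: frN_def less_Suc_eq)
  next
    fix M' R' t'
    assume *: "frN M M' \<and> (\<forall>u<n. M' (30 + u) = 0) \<and> R' = R \<and> t' \<le> t + 1 + 4 * n"
    then have R': "R' = R" by blast
    show "wp x (For 6 1 (Atom (NAdd 8 15 6) ;; Atom (RStore 8 1)) ;;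
        Atom (NConst 11 0) ;; Atom (QueryValue 5 14) ;; Atom (RAdd 4 10 1) ;;
        DoR (For 5 0 scan_element ;; Atom (RDiv 4 4 14)) 15 4) Q M' R' t'"
      unfolding R' by (rule wp_Seq, rule clear_loads) (use * in \<open>auto simp: stored_set_def\<close>)
  qed (use n in \<open>auto simp: frN_def\<close>)
qed

end

section \<open>Repairing an overflowing set and recording the best set\<close>

definition minimise :: com where
  "minimise = For 5 0 (Atom (NAdd 8 14 5) ;; Atom (NLoad 9 8) ;; UnlessN 9 4 (
     Atom (NStore 8 3) ;; Atom (RSub 9 1 2) ;; upd_loads ;; UnlessN 10 1 (
     Atom (NAdd 8 14 5) ;; Atom (NStore 8 4) ;; Atom (RConst 9 1) ;; upd_loads)))"

text \<open>\<open>R 18\<close> is the best remaining value so far and \<open>M 13\<close> the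
  element whose removal attains it. Starting \<open>R 18\<close> at 0 is safe: values are
  non-negative and ties overwrite, so the first member of the set always replaces the meaningless
  initial \<open>M 13\<close>.\<close>

definition drop_element :: com where
  "drop_element = Atom (RAdd 18 1 1) ;; Atom (NConst 13 0) ;; For 5 0 (
     Atom (NAdd 8 14 5) ;; Atom (NLoad 9 8) ;; UnlessN 9 4 (
     Atom (NStore 8 3) ;; Atom (QueryValue 6 14) ;; Atom (NStore 8 4) ;; UnlessR 6 18 (
     Atom (RAdd 18 6 1) ;; Atom (NAdd 13 5 3)))) ;;
     Atom (NAdd 8 14 13) ;; Atom (NStore 8 3)"

definition keep_best :: com where
  "keep_best = Atom (QueryValue 6 14) ;; UnlessR 6 11 (Atom (RAdd 11 6 1) ;; For 5 0 (
     Atom (NAdd 8 14 5) ;; Atom (NLoad 9 8) ;; Atom (NAdd 8 15 5) ;; Atom (NStore 8 9)))"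

context smks_ctx
begin

text \<open>One pass suffices, since a feasible \<open>W - {w}\<close> stays feasible when further
  elements leave: an element once put back never has to be tested again. Minimality makes every
  single removal feasible, so the element to drop can be chosen by value alone.\<close>

lemma wp_minimise:
  assumes env: "env q \<eta> m ta dm M R" and n: "0 < n"
    and S: "stored_set n M 30 = S" "loads R (\<lambda>i. \<Sum>u\<in>S. cost x i u)" "\<not> kfeas S"
    and Q: "\<And>W M' R' t'. \<lbrakk>frN M M'; frR R R'; M' 11 = M 11; stored_set n M' 30 = W; W \<subseteq> S; \<not> kfeas W;
        \<And>w. w \<in> W \<Longrightarrow> kfeas (W - {w}); t' \<le> t + 1 + n * (15 + 22 * d)\<rbrakk> \<Longrightarrow> Q M' R' t'"
  shows "wp x minimise Q M R t"
  unfolding minimise_def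
proof (rule wp_For[where K = n and J = "\<lambda>j M' R' t'. \<exists>W. W \<subseteq> S \<and> \<not> kfeas W \<and> (\<forall>w\<in>W. w < j \<longrightarrow> kfeas (W - {w})) \<and>
      frN M M' \<and> frR R R' \<and> M' 11 = M 11 \<and> stored_set n M' 30 = W \<and> loads R' (\<lambda>i. \<Sum>u\<in>W. cost x i u) \<and>
      t' \<le> t + 1 + j * (15 + 22 * d)"])
  fix j M' R' t'
  assume j: "j < n" "M' 5 = j" and "\<exists>W. W \<subseteq> S \<and> \<not> kfeas W \<and> (\<forall>w\<in>W. w < j \<longrightarrow> kfeas (W - {w})) \<and>
      frN M M' \<and> frR R R' \<and> M' 11 = M 11 \<and> stored_set n M' 30 = W \<and> loads R' (\<lambda>i. \<Sum>u\<in>W. cost x i u) \<and>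
      t' \<le> t + 1 + j * (15 + 22 * d)"
  then obtain W where W: "W \<subseteq> S" "\<not> kfeas W" "\<forall>w\<in>W. w < j \<longrightarrow> kfeas (W - {w})"
      "loads R' (\<lambda>i. \<Sum>u\<in>W. cost x i u)" "t' \<le> t + 1 + j * (15 + 22 * d)"
     and fr: "frN M M'" "frR R R'" "M' 11 = M 11"
     and [simp]: "stored_set n M' 30 = W"
    by blast
  have [simp]: "M' 0 = n" "M' (Suc 0) = d" "M' 3 = 0" "M' 4 = 1" "M' 14 = 30" "M' 15 = 30 + n" "R' (Suc 0) = 0" "R' 2 = 1"
    "M' 5 = j"
    using env_fr[OF env fr(1,2)] j by (auto simp: env_def)
  have gr: "W \<subseteq> {..<n}" "finite W"
    using stored_set_subset[of n M' 30] finite_subset[of W "{..<n}"] by auto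
  have jW: "j \<in> W \<longleftrightarrow> M' (30 + j) \<noteq> 0"
    using j by (auto simp flip: \<open>stored_set n M' 30 = W\<close> simp: stored_set_def)
  have sumd: "(\<Sum>u\<in>W - {j}. cost x i u) = (\<Sum>u\<in>W. cost x i u) - cost x i j" if "j \<in> W" for i
    using gr that by (simp add: sum_diff1)
  have kf: "kfeas (W - {j}) \<longleftrightarrow> (\<forall>i<d. (\<Sum>u\<in>W. cost x i u) - cost x i j \<le> budget x i)" if "j \<in> W"
    using sumd that by (simp add: kfeas_def)
  have sub: "kfeas (W - {j} - {w})" if "kfeas (W - {w})" for w
    by (rule kfeas_subset[OF that]) (use gr in auto)
  show "wp x (Atom (NAdd 8 14 5) ;; Atom (NLoad 9 8) ;; UnlessN 9 4 (
     Atom (NStore 8 3) ;; Atom (RSub 9 1 2) ;; upd_loads ;; UnlessN 10 1 (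
     Atom (NAdd 8 14 5) ;; Atom (NStore 8 4) ;; Atom (RConst 9 1) ;; upd_loads)))
     (\<lambda>M' R' t'. M' 5 = j \<and> M' 4 = 1 \<and> M' 0 = n \<and> (\<exists>W. W \<subseteq> S \<and> \<not> kfeas W \<and> (\<forall>w\<in>W. w < Suc j \<longrightarrow> kfeas (W - {w})) \<and>
      frN M (M'(5 := Suc j)) \<and> frR R R' \<and> (M'(5 := Suc j)) 11 = M 11 \<and> stored_set n (M'(5 := Suc j)) 30 = W \<and>
      loads R' (\<lambda>i. \<Sum>u\<in>W. cost x i u) \<and> t' + 2 \<le> t + 1 + Suc j * (15 + 22 * d))) M' R' t'"
    (is "wp x _ ?Q M' R' t'")
  proof -
    define P where "P = ?Q"
    have 1: "P M'' R'' t''" if "frN M' M''" "frR R' R''" "M'' 5 = j" "M'' 11 = M' 11" "stored_set n M'' 30 = W"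
      "loads R'' (\<lambda>i. \<Sum>u\<in>W. cost x i u)" "t'' \<le> t' + 13 + 22 * d" "j \<in> W \<Longrightarrow> kfeas (W - {j})" for M'' R'' t''
      using that W fr frN_trans[OF fr(1) that(1)] frR_trans[OF fr(2) that(2)] env_fr[OF env, of M'' R'']
      unfolding P_def by (intro conjI exI[of _ W]) (auto simp: env_def frN_upd5 stored_set_simps less_Suc_eq)
    have 2: "P M'' R'' t''" if "frN M' M''" "frR R' R''" "M'' 5 = j" "M'' 11 = M' 11" "stored_set n M'' 30 = W - {j}"
      "loads R'' (\<lambda>i. (\<Sum>u\<in>W. cost x i u) - cost x i j)" "t'' \<le> t' + 13 + 22 * d" "\<not> kfeas (W - {j})" "j \<in> W" for M'' R'' t''
      using that W fr frN_trans[OF fr(1) that(1)] frR_trans[OF fr(2) that(2)] env_fr[OF env, of M'' R''] sub sumd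
      unfolding P_def by (intro conjI exI[of _ "W - {j}"]) (auto simp: env_def frN_upd5 stored_set_simps less_Suc_eq)
    show ?thesis
      unfolding P_def[symmetric]
      apply ((rule wp_Seq wp_UnlessN wp_atoms; (simp add: stored_set_simps)?)+)
       apply (rule wp_upd_loads[where L = "\<lambda>i. \<Sum>u\<in>W. cost x i u"])
           apply (simp_all)[3]
        apply (use W(4) in \<open>simp add: loads_def\<close>)
       apply ((rule wp_Seq wp_UnlessN wp_atoms; (simp add: stored_set_simps)?)+)
        apply (rule wp_upd_loads[where L = "\<lambda>i. (\<Sum>u\<in>W. cost x i u) - cost x i j"])
            apply (simp_all)[4]
      subgoal using jW kf j by (intro 1) (auto simp: frN_def frR_def stored_set_simps)
      subgoal using jW kf j by (intro 2) (auto simp: frN_def frR_def stored_set_simps)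
      subgoal using jW W by (intro 1) (auto simp: frN_def frR_def stored_set_simps)
      done
  qed
next
  fix M' R' t'
  assume "\<exists>W. W \<subseteq> S \<and> \<not> kfeas W \<and> (\<forall>w\<in>W. w < n \<longrightarrow> kfeas (W - {w})) \<and>
      frN M M' \<and> frR R R' \<and> M' 11 = M 11 \<and> stored_set n M' 30 = W \<and> loads R' (\<lambda>i. \<Sum>u\<in>W. cost x i u) \<and>
      t' \<le> t + 1 + n * (15 + 22 * d)"
  then show "Q M' R' t'"
    using stored_set_subset[of n M' 30] by (elim exE conjE, intro Q) auto
qed (use n S in \<open>auto simp: frN_upd5 stored_set_simps\<close>)

lemma wp_drop_element:
  assumes env: "env q \<eta> m ta dm M R" and W: "stored_set n M 30 = W" "W \<noteq> {}"
    and Q: "\<And>w M' R' t'. \<lbrakk>frN M M'; frR R R'; M' 11 = M 11; w \<in> W; stored_set n M' 30 = W - {w};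
        \<And>v. v \<in> W \<Longrightarrow> f (W - {v}) \<le> f (W - {w}); t' \<le> t + 5 + n * 11\<rbrakk> \<Longrightarrow> Q M' R' t'"
  shows "wp x drop_element Q M R t"
proof -
  have gr: "W \<subseteq> {..<n}"
    using stored_set_subset[of n M 30] W by auto
  then have n: "0 < n" using W by auto
  have [simp]: "R (Suc 0) = 0"
    using env by (simp add: env_def)
  let ?J = "\<lambda>j M' R' t'. frN M M' \<and> frR R R' \<and> M' 11 = M 11 \<and> stored_set n M' 30 = W \<and>
      (R' 18 = 0 \<or> M' 13 \<in> W \<and> R' 18 = f (W - {M' 13})) \<and>
      (\<forall>v\<in>W. v < j \<longrightarrow> f (W - {v}) \<le> R' 18 \<and> M' 13 \<in> W \<and> R' 18 = f (W - {M' 13})) \<and> t' \<le> t + 3 + j * 11"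
  let ?P = "wp x (Atom (NAdd 8 14 13) ;; Atom (NStore 8 3)) Q"
  have "wp x (For 5 0 (
     Atom (NAdd 8 14 5) ;; Atom (NLoad 9 8) ;; UnlessN 9 4 (
     Atom (NStore 8 3) ;; Atom (QueryValue 6 14) ;; Atom (NStore 8 4) ;; UnlessR 6 18 (
     Atom (RAdd 18 6 1) ;; Atom (NAdd 13 5 3))))) ?P (M(13 := 0)) (R(18 := 0)) (Suc (Suc t))"
  proof (rule wp_For[where K = n and J = ?J])
    fix j M' R' t'
    assume j: "j < n" "M' 5 = j" and J: "?J j M' R' t'"
    then have fr: "frN M M'" "frR R R'" "M' 11 = M 11" and [simp]: "stored_set n M' 30 = W" and J0: "R' 18 = 0 \<or> M' 13 \<in> W \<and> R' 18 = f (W - {M' 13})"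
      and J1: "\<forall>v\<in>W. v < j \<longrightarrow> f (W - {v}) \<le> R' 18 \<and> M' 13 \<in> W \<and> R' 18 = f (W - {M' 13})" and J2: "t' \<le> t + 3 + j * 11"
      by auto
    have [simp]: "M' 0 = n" "M' 3 = 0" "M' 4 = 1" "M' 14 = 30" "R' (Suc 0) = 0" "M' 5 = j"
      using env_fr[OF env fr(1,2)] j by (auto simp: env_def)
    have jW: "j \<in> W \<longleftrightarrow> M' (30 + j) \<noteq> 0"
      using j by (auto simp flip: \<open>stored_set n M' 30 = W\<close> simp: stored_set_def)
    have ins: "insert j (W - {j}) = W" if "j \<in> W" using that by auto
    have nn: "0 \<le> f (W - {j})" using gr by (intro f_nonneg) auto
    define P where "P = (\<lambda>M' R' t'. M' 5 = j \<and> M' 4 = 1 \<and> M' 0 = n \<and> ?J (Suc j) (M'(5 := Suc j)) R' (t' + 2))"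
    have P: "P M'' R'' t''" if "frN M' M''" "frR R' R''" "M'' 5 = j" "M'' 11 = M' 11" "stored_set n M'' 30 = W"
      "t'' \<le> t' + 9" "R'' 18 = 0 \<or> M'' 13 \<in> W \<and> R'' 18 = f (W - {M'' 13})"
      "\<forall>v\<in>W. v < Suc j \<longrightarrow> f (W - {v}) \<le> R'' 18 \<and> M'' 13 \<in> W \<and> R'' 18 = f (W - {M'' 13})" for M'' R'' t''
    proof -
      have fr': "frN M M''" "frR R R''"
        using frN_trans[OF fr(1) that(1)] frR_trans[OF fr(2) that(2)] .
      have "M'' 4 = 1" "M'' 0 = n"
        using env_fr[OF env fr'] by (auto simp: env_def)
      then show ?thesis
        unfolding P_def using that(3-6) fr' fr(3) J2
        by (intro conjI; (use that(7,8) in \<open>auto; fail\<close>)?) (simp_all add: frN_upd5 stored_set_simps)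
    qed
    show "wp x (Atom (NAdd 8 14 5) ;; Atom (NLoad 9 8) ;; UnlessN 9 4 (
     Atom (NStore 8 3) ;; Atom (QueryValue 6 14) ;; Atom (NStore 8 4) ;; UnlessR 6 18 (
     Atom (RAdd 18 6 1) ;; Atom (NAdd 13 5 3)))) (\<lambda>M' R' t'. M' 5 = j \<and> M' 4 = 1 \<and> M' 0 = n \<and> ?J (Suc j) (M'(5 := Suc j)) R' (t' + 2)) M' R' t'"
      unfolding P_def[symmetric]
      apply ((rule wp_Seq wp_UnlessN wp_UnlessR wp_atoms; (simp add: stored_set_simps)?)+)
      subgoal using jW j nn ins J1 by (intro P) (auto simp: frN_def frR_def stored_set_simps less_Suc_eq)
      subgoal using jW j nn ins J0 J1 by (intro P) (auto simp: frN_def frR_def stored_set_simps less_Suc_eq)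
      subgoal using jW j J0 J1 by (intro P) (auto simp: frN_def frR_def stored_set_simps less_Suc_eq)
      done
  next
    fix M' R' t'
    assume J: "?J n M' R' t'"
    have [simp]: "M' 14 = 30" "M' 3 = 0"
      using J env_fr[OF env, of M' R'] by (auto simp: env_def)
    obtain v where "v \<in> W" using W by auto
    then have w: "M' 13 \<in> W" "M' 13 < n"
      using J gr by auto
    show "?P M' R' t'"
      using J w gr by (intro wp_Seq wp_atoms Q[of _ _ "M' 13"]) (auto simp: frN_def frR_def stored_set_simps)
  qed (use W n in \<open>auto simp: frN_def frR_def stored_set_simps\<close>)
  then show ?thesis
    unfolding drop_element_def by (intro wp_Seq wp_atoms) simp
qed

lemma best_feasible_nonneg: "best V M R \<Longrightarrow> 0 \<le> V"
  using f_nonneg[OF stored_set_subset, of M "30 + n"] by (simp add: best_def)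

text \<open>A wider frame than \<open>frN\<close>: \<open>keep_best\<close> also overwrites the
  block of the best set.\<close>

definition frB :: "(nat \<Rightarrow> nat) \<Rightarrow> (nat \<Rightarrow> nat) \<Rightarrow> bool" where
  "frB M M' \<longleftrightarrow> (\<forall>a. (a < 5 \<or> 13 < a) \<and> (a < 30 \<or> 30 + 2 * n \<le> a) \<longrightarrow> M' a = M a)"

lemma wp_keep_best:
  assumes env: "env q \<eta> m ta dm M R" and S: "feasible x (stored_set n M 30)" and best: "best V M R" and n: "0 < n"
    and Q: "\<And>M' R' t'. \<lbrakk>frB M M'; \<forall>a. a \<noteq> 6 \<and> a \<noteq> 11 \<longrightarrow> R' a = R a;
        best (max V (f (stored_set n M 30))) M' R'; t' \<le> t + 4 + n * 6\<rbrakk> \<Longrightarrow> Q M' R' t'"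
  shows "wp x keep_best Q M R t"
proof -
  have [simp]: "M 0 = n" "M 3 = 0" "M 4 = 1" "M 14 = 30" "M 15 = 30 + n" "R (Suc 0) = 0" "R 11 = V"
    using env best by (auto simp: env_def best_def)
  let ?v = "f (stored_set n M 30)"
  have copy: "wp x (For 5 0 (
     Atom (NAdd 8 14 5) ;; Atom (NLoad 9 8) ;; Atom (NAdd 8 15 5) ;; Atom (NStore 8 9))) Q M (R(6 := ?v, 11 := ?v)) (t + 3)"
    if "V \<le> ?v"
  proof (rule wp_For[where K = n and J = "\<lambda>j M' R' t'. frB M M' \<and> (\<forall>u<n. M' (30 + u) = M (30 + u)) \<and>
      (\<forall>u<j. M' (30 + n + u) = M (30 + u)) \<and> R' = R(6 := ?v, 11 := ?v) \<and> t' \<le> t + 4 + j * 6"])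
    fix j M' R' t'
    assume *: "j < n" "M' 5 = j" "frB M M' \<and> (\<forall>u<n. M' (30 + u) = M (30 + u)) \<and>
      (\<forall>u<j. M' (30 + n + u) = M (30 + u)) \<and> R' = R(6 := ?v, 11 := ?v) \<and> t' \<le> t + 4 + j * 6"
    then have [simp]: "M' 0 = n" "M' 4 = 1" "M' 14 = 30" "M' 15 = 30 + n" "M' (30 + j) = M (30 + j)"
      unfolding frB_def by auto
    show "wp x (Atom (NAdd 8 14 5) ;; Atom (NLoad 9 8) ;; Atom (NAdd 8 15 5) ;; Atom (NStore 8 9))
      (\<lambda>M' R' t'. M' 5 = j \<and> M' 4 = 1 \<and> M' 0 = n \<and> frB M (M'(5 := Suc j)) \<and>
       (\<forall>u<n. (M'(5 := Suc j)) (30 + u) = M (30 + u)) \<and>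
       (\<forall>u<Suc j. (M'(5 := Suc j)) (30 + n + u) = M (30 + u)) \<and> R' = R(6 := ?v, 11 := ?v) \<and> t' + 2 \<le> t + 4 + Suc j * 6) M' R' t'"
      using * by (intro wp_Seq wp_atoms) (auto simp: frB_def less_Suc_eq)
  next
    fix M' R' t'
    assume *: "frB M M' \<and> (\<forall>u<n. M' (30 + u) = M (30 + u)) \<and>
      (\<forall>u<n. M' (30 + n + u) = M (30 + u)) \<and> R' = R(6 := ?v, 11 := ?v) \<and> t' \<le> t + 4 + n * 6"
    then have "stored_set n M' (30 + n) = stored_set n M 30"
      by (auto simp: stored_set_def)
    then show "Q M' R' t'"
      using * that S by (intro Q) (auto simp: best_def max_def)
  qed (use n in \<open>auto simp: frB_def\<close>)
  have keep: "Q M (R(6 := ?v)) (t + 2)" if "?v < V"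
    using best that by (intro Q) (auto simp: best_def frB_def max_def)
  show ?thesis
    unfolding keep_best_def
    apply (intro wp_Seq wp_atoms wp_UnlessR)
    using copy keep by (auto simp: numeral_3_eq_3)
qed

end

section \<open>Bisection over the density\<close>

definition probe :: com where
  "probe = run_greedy ;; UnlessN 11 4 (minimise ;; drop_element ;; Atom (RAdd 12 3 1)) ;;
     UnlessN 3 11 (Atom (RAdd 13 3 1)) ;; keep_best ;;
     Atom (RAdd 3 12 13) ;; Atom (RDiv 3 3 19) ;; Atom (RSub 23 13 12)"

context smks_ctx
begin

definition probe_time :: "nat \<Rightarrow> nat \<Rightarrow> nat" where
  "probe_time W lg = run_time W lg + n * (32 + 22 * d) + 20"

text \<open>An overflow raises the lower end and comes with a value bound; otherwise the upper end
  drops and comes with a certificate. Both are stated for \<open>V'\<close>, as an earlier set may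
  remain the best. The clause \<open>\<rho> < real n * m\<close> excludes an overflow in the first
  probe.\<close>

lemma wp_probe:
  assumes env: "env q \<eta> m ta dm M R" and best: "best V M R" and R: "R 3 = \<rho>" "0 \<le> \<rho>" "R 12 = lo" "R 13 = hi"
    and n: "0 < n" and q: "1 \<le> q"
    and W: "1 \<le> W" "\<eta> = 1 + 1 / real W" and N: "1 \<le> N" "ta = m / (real n * real N)" and lg: "real n * real N \<le> 2 ^ lg"
    and m: "0 \<le> m" "\<And>u. feasible x {u} \<Longrightarrow> f {u} \<le> m"
    and Q: "\<And>V' lo' hi' M' R' t'. \<lbrakk>env q \<eta> m ta dm M' R'; best V' M' R'; V \<le> V'; R' 12 = lo'; R' 13 = hi';
        R' 3 = (lo' + hi') / 2; R' 23 = hi' - lo';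
        (lo' = \<rho> \<and> hi' = hi \<and> \<rho> * (real q / (real q + 1)) \<le> V' \<and> (0 < m \<longrightarrow> \<rho> < real n * m)) \<or>
        (lo' = lo \<and> hi' = \<rho> \<and> cert q \<eta> (2 * m / real N) \<rho> V');
        t' \<le> t + probe_time W lg\<rbrakk> \<Longrightarrow> Q M' R' t'"
  shows "wp x probe Q M R t"
proof -
  have \<eta>0: "0 \<le> \<eta>" using W by simp
  let ?rest = "keep_best ;; Atom (RAdd 3 12 13) ;; Atom (RDiv 3 3 19) ;; Atom (RSub 23 13 12)"
  have rest: "wp x ?rest Q M2 R2 t2"
    if *: "frN M M2" "frR (R(12 := lo', 13 := hi')) R2" "feasible x (stored_set n M2 30)"
      "t2 + 7 + n * 6 \<le> t + probe_time W lg"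
      and res: "\<And>V'. max V (f (stored_set n M2 30)) \<le> V' \<Longrightarrow>
        (lo' = \<rho> \<and> hi' = hi \<and> \<rho> * (real q / (real q + 1)) \<le> V' \<and> (0 < m \<longrightarrow> \<rho> < real n * m)) \<or>
        (lo' = lo \<and> hi' = \<rho> \<and> cert q \<eta> (2 * m / real N) \<rho> V')" for lo' hi' M2 R2 t2
  proof -
    have "env q \<eta> m ta dm M (R(12 := lo', 13 := hi'))" "best V M (R(12 := lo', 13 := hi'))"
      using env best by (auto simp: env_def best_def)
    then have eb: "env q \<eta> m ta dm M2 R2" "best V M2 R2"
      using env_fr best_fr * by blast+
    have lohi: "R2 12 = lo'" "R2 13 = hi'"
      using *(2) by (auto simp: frR_def)
    show ?thesis
    proof (rule wp_Seq, rule wp_keep_best[OF eb(1) *(3) eb(2) n], intro wp_Seq wp_atoms)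
      fix M3 R3 t3
      assume fr: "frB M2 M3" "\<forall>a. a \<noteq> 6 \<and> a \<noteq> 11 \<longrightarrow> R3 a = R2 a"
        and b: "best (max V (f (stored_set n M2 30))) M3 R3" and t3: "t3 \<le> t2 + 4 + n * 6"
      have env3: "env q \<eta> m ta dm M3 R3"
        using eb(1) fr unfolding env_def frB_def by auto
      have [simp]: "R3 19 = 2" "R3 12 = lo'" "R3 13 = hi'"
        using env3 fr lohi by (auto simp: env_def)
      show "Q M3 (R3(3 := R3 12 + R3 13, 3 := (R3(3 := R3 12 + R3 13)) 3 / (R3(3 := R3 12 + R3 13)) 19,
          23 := (R3(3 := R3 12 + R3 13, 3 := (R3(3 := R3 12 + R3 13)) 3 / (R3(3 := R3 12 + R3 13)) 19)) 13 -
                (R3(3 := R3 12 + R3 13, 3 := (R3(3 := R3 12 + R3 13)) 3 / (R3(3 := R3 12 + R3 13)) 19)) 12)) (Suc (Suc (Suc t3)))"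
        by (rule Q[OF _ _ _ _ _ _ _ res[OF order_refl]])
          (use b env3 t3 *(4) in \<open>auto simp: best_def env_def\<close>)
    qed
  qed
  show ?thesis
    unfolding probe_def
  proof (rule wp_Seq, rule wp_run_greedy[OF env R(1,2) n q W N lg m], assumption)
    fix S M1 R1 t1
    assume fr: "frN M M1" "frR R R1" and rd: "run_done q \<rho> \<eta> S M1 R1"
      and cert: "kfeas S \<Longrightarrow> cert q \<eta> (2 * m / real N) \<rho> (f S)" and t1: "t1 \<le> t + run_time W lg"
    have env1: "env q \<eta> m ta dm M1 R1"
      by (rule env_fr[OF env fr])
    have [simp]: "M1 3 = 0" "M1 4 = 1" "R1 3 = \<rho>" "R1 (Suc 0) = 0" "stored_set n M1 30 = S" "R1 12 = lo" "R1 13 = hi"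
      using env1 rd fr(2) R by (auto simp: env_def run_done_def frR_def)
    obtain \<tau> where inv: "greedy_inv q \<rho> \<eta> \<tau> S"
      using rd by (auto simp: run_done_def)
    then have S: "S \<in> \<I>" "\<forall>u\<in>S. small q u"
      by (auto simp: greedy_inv_def)
    show "wp x (UnlessN 11 4 (minimise ;; drop_element ;; Atom (RAdd 12 3 1)) ;;
       UnlessN 3 11 (Atom (RAdd 13 3 1)) ;; ?rest) Q M1 R1 t1"
    proof (cases "kfeas S")
      case True
      then have [simp]: "M1 11 = 0"
        using rd by (simp add: run_done_def)
      have "wp x ?rest Q M1 (R1(13 := \<rho>)) (Suc (Suc (Suc t1)))"
      proof (rule rest[OF fr(1)])
        show "frR (R(12 := lo, 13 := \<rho>)) (R1(13 := \<rho>))"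
          using fr(2) R by (auto simp: frR_def)
        fix V' assume "max V (f (stored_set n M1 30)) \<le> V'"
        then show "(lo = \<rho> \<and> \<rho> = hi \<and> \<rho> * (real q / (real q + 1)) \<le> V' \<and> (0 < m \<longrightarrow> \<rho> < real n * m)) \<or>
            (lo = lo \<and> \<rho> = \<rho> \<and> cert q \<eta> (2 * m / real N) \<rho> V')"
          using cert_mono[OF cert[OF True] _ \<eta>0, of V'] by auto
      qed (use True S t1 in \<open>auto simp: feasible_iff probe_time_def algebra_simps\<close>)
      then show ?thesis
        by (intro wp_Seq[of _ "UnlessN _ _ _"] wp_UnlessN wp_Seq[of _ minimise] wp_atoms) auto
    next
      case False
      then have [simp]: "M1 11 = 1"
        using rd by (simp add: run_done_def)
      have bound: "0 < m \<longrightarrow> \<rho> < real n * m"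
      proof -
        have "f {u} \<le> m" if "u \<in> S" for u
          using that S q small_kfeas indep_subset[of S "{u}"] by (intro m(2)) (auto simp: feasible_iff)
        then show ?thesis
          using greedy_infeasible_bound[OF inv False] by blast
      qed
      have vio: "wp x (minimise ;; drop_element ;; Atom (RAdd 12 3 1))
          (wp x (UnlessN 3 11 (Atom (RAdd 13 3 1)) ;; ?rest) Q) M1 R1 (Suc t1)"
      proof (rule wp_Seq, rule wp_minimise[OF env1 n _ _ False], simp,
          use rd in \<open>simp add: run_done_def\<close>, rule wp_Seq)
        fix Y M2 R2 t2
        assume fr2: "frN M1 M2" "frR R1 R2" "M2 11 = M1 11" and Y: "stored_set n M2 30 = Y" "Y \<subseteq> S" "\<not> kfeas Y"
            "\<And>w. w \<in> Y \<Longrightarrow> kfeas (Y - {w})" and t2: "t2 \<le> Suc t1 + 1 + n * (15 + 22 * d)"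
        obtain w0 where w0: "w0 \<in> Y" "\<rho> * (real q / (real q + 1)) \<le> f (Y - {w0})"
          using greedy_drop[OF inv Y(2,3) R(2)] by blast
        then have "Y \<noteq> {}" by auto
        show "wp x drop_element (wp x (Atom (RAdd 12 3 1)) (wp x (UnlessN 3 11 (Atom (RAdd 13 3 1)) ;; ?rest) Q)) M2 R2 t2"
        proof (rule wp_drop_element[OF env_fr[OF env1 fr2(1,2)] Y(1) \<open>Y \<noteq> {}\<close>], rule wp_atoms)
          fix w M3 R3 t3
          assume fr3: "frN M2 M3" "frR R2 R3" "M3 11 = M2 11" and w: "w \<in> Y" "stored_set n M3 30 = Y - {w}"
              "\<And>v. v \<in> Y \<Longrightarrow> f (Y - {v}) \<le> f (Y - {w})" and t3: "t3 \<le> t2 + 5 + n * 11"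
          have fr': "frN M M3" "frR R R3"
            using fr fr2 fr3 frN_trans frR_trans by blast+
          have [simp]: "M3 3 = 0" "R3 3 = \<rho>" "R3 (Suc 0) = 0" "M3 11 = 1"
            using env_fr[OF env fr'] fr'(2) R(1) fr2 fr3 by (auto simp: env_def frR_def)
          have "wp x ?rest Q M3 (R3(12 := \<rho>)) (Suc (Suc t3))"
          proof (rule rest[OF fr'(1)])
            show "frR (R(12 := \<rho>, 13 := hi)) (R3(12 := \<rho>))"
              using fr'(2) R by (auto simp: frR_def)
            show "feasible x (stored_set n M3 30)"
              using w Y S indep_subset[of S "Y - {w}"] by (auto simp: feasible_iff)
            fix V' assume "max V (f (stored_set n M3 30)) \<le> V'"
            then have "\<rho> * (real q / (real q + 1)) \<le> V'"
              using w0 w by fastforce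
            then show "(\<rho> = \<rho> \<and> hi = hi \<and> \<rho> * (real q / (real q + 1)) \<le> V' \<and> (0 < m \<longrightarrow> \<rho> < real n * m)) \<or>
              (\<rho> = lo \<and> hi = \<rho> \<and> cert q \<eta> (2 * m / real N) \<rho> V')"
              using bound by blast
          qed (use t1 t2 t3 in \<open>simp add: probe_time_def algebra_simps\<close>)
          then show "wp x (UnlessN 3 11 (Atom (RAdd 13 3 1)) ;; ?rest) Q M3 (R3(12 := R3 3 + R3 1)) (Suc t3)"
            by (intro wp_Seq[of _ "UnlessN _ _ _"] wp_UnlessN wp_atoms) auto
        qed
      qed
      show ?thesis
        by (rule wp_Seq, rule wp_UnlessN) (use vio in simp_all)
    qed
  qed
qed

text \<open>The first probe is made at the upper end \<open>n * m\<close> itself: for positive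
  \<open>m\<close> it cannot overflow and so supplies the missing certificate. Halving starts only
  afterwards, whence the exponent \<open>j - 1\<close> in the invariant. At the end
  \<open>hi\<close> exceeds \<open>V * (q + 1) / q\<close> by at most \<open>dm\<close>, which costs
  \<open>dm * d = m / N\<close>; with the threshold error \<open>2 * m / N\<close> this makes
  \<open>3 / N\<close>.\<close>

lemma wp_search:
  assumes env: "env q \<eta> m ta dm M R" and best: "best m M R"
    and R: "R 3 = real n * m" "R 12 = 0" "R 13 = real n * m"
    and n: "0 < n" and q: "1 \<le> q"
    and W: "1 \<le> W" "\<eta> = 1 + 1 / real W" and N: "1 \<le> N" "ta = m / (real n * real N)" "dm = m / (real d * real N)"
    and lg: "real n * real N \<le> 2 ^ lg" and lg2: "real n * real d * real N \<le> 2 ^ lg2"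
    and m: "f {} \<le> m" "\<And>u. feasible x {u} \<Longrightarrow> f {u} \<le> m"
    and Q: "\<And>V M' R' t'. \<lbrakk>env q \<eta> m ta dm M' R'; best V M' R'; m \<le> V; search_result q \<eta> (3 / real N) V;
        t' \<le> t + (lg2 + 1) * (probe_time W lg + 1)\<rbrakk> \<Longrightarrow> Q M' R' t'"
  shows "wp x (DoR probe 16 23) Q M R t"
proof -
  have m0: "0 \<le> m" using best_feasible_nonneg[OF best] .
  have d: "0 < d" using d_pos by simp
  let ?I = "\<lambda>j M' R' t'. \<exists>V lo hi. env q \<eta> m ta dm M' R' \<and> best V M' R' \<and> m \<le> V \<and> R' 12 = lo \<and> R' 13 = hi \<and>
      0 \<le> lo \<and> lo \<le> hi \<and> lo * (real q / (real q + 1)) \<le> V \<and>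
      (j = 0 \<longrightarrow> lo = 0 \<and> hi = real n * m \<and> R' 3 = hi) \<and>
      (0 < j \<longrightarrow> R' 3 = (lo + hi) / 2 \<and> hi - lo = real n * m / 2 ^ (j - 1) \<and> dm < hi - lo \<and>
        (m = 0 \<or> cert q \<eta> (2 * m / real N) hi V)) \<and>
      t' \<le> t + j * (probe_time W lg + 1)"
  have bound: "j \<le> lg2" if I: "?I j M' R' t'" for j M' R' t'
  proof (rule ccontr)
    assume j: "\<not> j \<le> lg2"
    then have "m / (real d * real N) < real n * m / 2 ^ (j - 1)"
      using I N by auto
    moreover have "(2::real) ^ lg2 \<le> 2 ^ (j - 1)"
      using j by (intro power_increasing) auto
    then have "real n * real d * real N \<le> 2 ^ (j - 1)"
      using lg2 by linarith
    then have "real n * m / 2 ^ (j - 1) \<le> real n * m / (real n * real d * real N)"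
      using n d N m0 by (intro divide_left_mono) auto
    ultimately show False
      using n by simp
  qed
  have result: "search_result q \<eta> (3 / real N) V"
    if V: "best V M' R'" "m \<le> V" "0 \<le> lo" "lo \<le> hi" "lo * (real q / (real q + 1)) \<le> V"
      "m = 0 \<or> cert q \<eta> (2 * m / real N) hi V" "\<not> dm < hi - lo" for V lo hi M' R'
    unfolding search_result_def
  proof (intro ballI impI)
    fix Y assume Y: "Y \<in> \<I>" "kfeas Y" "\<forall>u\<in>Y. small q u"
    let ?k = "\<Sum>u\<in>Y. kcost u"
    have V0: "0 \<le> V" using V m0 by simp
    have k: "0 \<le> ?k" "?k \<le> real d"
      using kcost_feasible[OF Y(2)] Y(3) kcost_nonneg by (auto intro!: sum_nonneg simp: small_def)
    show "f Y \<le> (\<eta> * real p' + 1) * V + (real q + 1) / real q * V * ?k + 3 / real N * V"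
    proof (cases "m = 0")
      \<comment> \<open>For \<open>m = 0\<close> all feasible singletons are worth 0 and
        submodularity extends this to \<open>Y\<close>. A probe at density 0 may end either way,
        which is why the invariant offers \<open>m = 0\<close> as an alternative to the
        certificate.\<close>
      case True
      have "f Y \<le> f {} + (\<Sum>u\<in>Y. marg {} u)"
        using f_union_le[of "{}" Y] indep_ground[OF Y(1)] by simp
      also have "(\<Sum>u\<in>Y. marg {} u) \<le> 0"
      proof (rule sum_nonpos)
        fix u assume "u \<in> Y"
        then have "feasible x {u}" "u < n"
          using Y feasible_subset[of Y "{u}"] by (auto simp: feasible_iff small_def)
        then show "marg {} u \<le> 0"
          using m(2)[of u] marg_le_singleton[of "{}" u] True by auto
      qed
      finally have "f Y \<le> 0" using m(1) True by simp
      moreover have "0 \<le> (\<eta> * real p' + 1) * V + (real q + 1) / real q * V * ?k + 3 / real N * V"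
        using V0 k W by (intro add_nonneg_nonneg mult_nonneg_nonneg) auto
      ultimately show ?thesis by linarith
    next
      case False
      then have "f Y \<le> (\<eta> * real p' + 1) * V + hi * ?k + 2 * m / real N"
        using V(6) Y unfolding cert_def by auto
      moreover have "hi * ?k \<le> (real q + 1) / real q * V * ?k + V / real N"
      proof -
        have "lo \<le> (real q + 1) / real q * V"
          using V(5) q by (simp add: field_simps)
        then have "hi * ?k \<le> ((real q + 1) / real q * V + dm) * ?k"
          using V(7) k by (intro mult_right_mono) auto
        also have "\<dots> = (real q + 1) / real q * V * ?k + dm * ?k"
          by (simp add: algebra_simps)
        also have "dm * ?k \<le> dm * real d"
          using k N m0 by (intro mult_left_mono) auto
        also have "dm * real d = m / real N"
          using N d by simp
        also have "\<dots> \<le> V / real N"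
          using V by (intro divide_right_mono) auto
        finally show ?thesis by simp
      qed
      moreover have "2 * m / real N \<le> 2 * V / real N"
        using V by (intro divide_right_mono) auto
      ultimately have "f Y \<le> (\<eta> * real p' + 1) * V + (real q + 1) / real q * V * ?k + (V / real N + 2 * V / real N)"
        by linarith
      also have "V / real N + 2 * V / real N = 3 / real N * V"
        by (simp add: field_simps)
      finally show ?thesis .
    qed
  qed
  show ?thesis
  proof (rule wp_DoR[where I = ?I and K = lg2])
    show "?I 0 M R t"
      by (rule exI[of _ m], rule exI[of _ 0], rule exI[of _ "real n * m"]) (use env best R m0 in auto)
    show "\<And>j M' R' t'. ?I j M' R' t' \<Longrightarrow> j \<le> lg2"
      by (rule bound)
    fix j M' R' t'
    assume I: "?I j M' R' t'"
    then obtain V lo hi where V: "env q \<eta> m ta dm M' R'" "best V M' R'" "m \<le> V" "R' 12 = lo" "R' 13 = hi"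
      "0 \<le> lo" "lo \<le> hi" "lo * (real q / (real q + 1)) \<le> V"
      and j0: "j = 0 \<Longrightarrow> lo = 0 \<and> hi = real n * m \<and> R' 3 = hi"
      and j1: "0 < j \<Longrightarrow> R' 3 = (lo + hi) / 2 \<and> hi - lo = real n * m / 2 ^ (j - 1) \<and>
        (m = 0 \<or> cert q \<eta> (2 * m / real N) hi V)"
      and t': "t' \<le> t + j * (probe_time W lg + 1)"
      by blast
    have r0: "lo \<le> R' 3" "R' 3 \<le> hi" "0 \<le> R' 3"
      using V j0 j1 by (cases "j = 0"; force)+
    show "wp x probe (\<lambda>M' R' t'. if R' 16 < R' 23 then ?I (Suc j) M' R' (Suc t') else Q M' R' (Suc t')) M' R' t'"
    proof (rule wp_probe[OF V(1,2) refl r0(3) V(4,5) n q W N(1,2) lg m0 m(2)], assumption)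
      fix V' lo' hi' M'' R'' t''
      assume *: "env q \<eta> m ta dm M'' R''" "best V' M'' R''" "V \<le> V'" "R'' 12 = lo'" "R'' 13 = hi'"
        "R'' 3 = (lo' + hi') / 2" "R'' 23 = hi' - lo'"
        and cases: "(lo' = R' 3 \<and> hi' = hi \<and> R' 3 * (real q / (real q + 1)) \<le> V' \<and> (0 < m \<longrightarrow> R' 3 < real n * m)) \<or>
        (lo' = lo \<and> hi' = R' 3 \<and> cert q \<eta> (2 * m / real N) (R' 3) V')"
        and t'': "t'' \<le> t' + probe_time W lg"
      have \<eta>0: "0 \<le> \<eta>" using W by simp
      have 16: "R'' 16 = dm" using *(1) by (simp add: env_def)
      have lohi: "0 \<le> lo'" "lo' \<le> hi'" using cases r0 V by auto
      have lo': "lo' * (real q / (real q + 1)) \<le> V'"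
        using cases V(8) *(3) by auto
      have diff: "hi' - lo' = real n * m / 2 ^ j"
      proof (cases j)
        case 0
        then show ?thesis using cases j0 m0 by auto
      next
        case (Suc k)
        then have 3: "R' 3 = (lo + hi) / 2" and *: "hi - lo = real n * m / 2 ^ k"
          using j1 by auto
        have "hi' - lo' = (hi - lo) / 2"
          using cases 3 by (elim disjE) (auto simp: field_simps)
        then show ?thesis
          unfolding * Suc by simp
      qed
      have c: "m = 0 \<or> cert q \<eta> (2 * m / real N) hi' V'"
      proof (cases "j = 0")
        case True
        then show ?thesis using cases j0 m0 by auto
      next
        case False
        then show ?thesis using cases j1 cert_mono[OF _ *(3) \<eta>0] by blast
      qed
      have time: "Suc t'' \<le> t + Suc j * (probe_time W lg + 1)"
        using t' t'' by simp
      show "if R'' 16 < R'' 23 then ?I (Suc j) M'' R'' (Suc t'') else Q M'' R'' (Suc t'')"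
      proof (cases "dm < hi' - lo'")
        case True
        have "?I (Suc j) M'' R'' (Suc t'')"
          by (rule exI[of _ V'], rule exI[of _ lo'], rule exI[of _ hi'])
            (use * V(3) lohi lo' diff c time True in auto)
        then show ?thesis using True 16 *(7) by simp
      next
        case False
        have "Q M'' R'' (Suc t'')"
        proof (rule Q[OF *(1,2)])
          show "m \<le> V'" using V(3) *(3) by simp
          show "search_result q \<eta> (3 / real N) V'"
            by (rule result[OF *(2) _ lohi lo' c False]) (use V(3) *(3) in simp)
          have "Suc j * (probe_time W lg + 1) \<le> (lg2 + 1) * (probe_time W lg + 1)"
            using bound[OF I] by (intro mult_right_mono) auto
          then show "Suc t'' \<le> t + (lg2 + 1) * (probe_time W lg + 1)"
            using time by linarith
        qed
        then show ?thesis using False 16 *(7) by simp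
      qed
    qed
  qed
qed

end

text \<open>
  Before the search, \<open>R 20\<close> counts the elements, \<open>R 21 = d\<close>, \<open>R 22 = 3/4\<close>, and \<open>M (30 + 3n + u)\<close> is the most
  loaded knapsack of \<open>u\<close>. The best set is a subset of \<open>{M 18, M 19}\<close>, so that it can be replaced in
  constant time.
\<close>

definition initialise :: "nat \<Rightarrow> com" where
  "initialise q = Atom (NConst 4 1) ;; Atom (NConst 14 30) ;; Atom (NAdd 15 14 0) ;; Atom (NAdd 16 15 0) ;;
     Atom (NAdd 17 16 0) ;; Atom (RConst 2 1) ;; Atom (RConst 17 q) ;; Atom (RConst 19 2) ;;
     Atom (RConst 22 3) ;; Atom (RConst 7 4) ;; Atom (RDiv 22 22 7) ;; Atom (QueryValue 11 14) ;;
     For 6 1 (Atom (RAdd 21 21 2))"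

text \<open>Only independence is tested here; the budgets are left to the caller. Equal indices in
  \<open>M 5\<close> and \<open>M 7\<close> offer a singleton.\<close>

definition offer :: com where
  "offer = Atom (NAdd 8 14 5) ;; Atom (NAdd 9 14 7) ;; Atom (NStore 8 4) ;; Atom (NStore 9 4) ;;
     Atom (QueryIndep 10 14) ;; Atom (QueryValue 6 14) ;; Atom (NStore 8 3) ;; Atom (NStore 9 3) ;;
     UnlessN 10 4 (UnlessR 6 11 (
     Atom (NAdd 10 15 18) ;; Atom (NStore 10 3) ;; Atom (NAdd 10 15 19) ;; Atom (NStore 10 3) ;;
     Atom (NAdd 10 15 5) ;; Atom (NStore 10 4) ;; Atom (NAdd 10 15 7) ;; Atom (NStore 10 4) ;;
     Atom (NAdd 18 5 3) ;; Atom (NAdd 19 7 3) ;; Atom (RAdd 11 6 1)))"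

text \<open>\<open>M 10\<close> counts the knapsacks in which the element fits, \<open>M 12\<close>
  those in which it is small, and \<open>M 13\<close> is the most loaded one. Costs are non-negative
  and ties overwrite, so \<open>M 13\<close> is meaningful from the first knapsack on.\<close>

definition read_costs :: com where
  "read_costs = Atom (NConst 10 0) ;; Atom (NConst 12 0) ;; Atom (NConst 13 0) ;; Atom (RConst 5 0) ;;
     Atom (RConst 18 0) ;; For 6 1 (
     Atom (ReadCost 7 6 5) ;; Atom (ReadBudget 8 6) ;; UnlessR 8 7 (Atom (NAdd 10 10 4)) ;;
     Atom (RMul 9 17 7) ;; UnlessR 8 9 (Atom (NAdd 12 12 4)) ;; Atom (RDiv 7 7 8) ;; Atom (RAdd 5 5 7) ;;
     UnlessR 7 18 (Atom (RAdd 18 7 1) ;; Atom (NAdd 13 6 3)))"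

definition analyse :: com where
  "analyse = read_costs ;; Atom (RAdd 20 20 2) ;; Atom (NAdd 8 14 5) ;; Atom (RStore 8 5) ;;
     Atom (NAdd 9 17 5) ;; Atom (NStore 9 13) ;; Atom (NAdd 9 16 5) ;; Atom (NStore 9 3) ;;
     UnlessN 12 1 (Atom (NStore 9 4)) ;; UnlessN 10 1 (Atom (NAdd 7 5 3) ;; offer)"

definition fits :: "nat \<Rightarrow> com \<Rightarrow> com" where
  "fits a c = Atom (NAdd 10 17 a) ;; Atom (NLoad 10 10) ;; Atom (ReadCost 7 10 5) ;; Atom (ReadCost 8 10 7) ;;
     Atom (RAdd 7 7 8) ;; Atom (ReadBudget 8 10) ;; UnlessR 8 7 c"

definition try_pair :: com where
  "try_pair = Atom (NAdd 8 14 5) ;; Atom (RLoad 7 8) ;; UnlessR 22 7 (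
     Atom (NAdd 8 14 7) ;; Atom (RLoad 7 8) ;; UnlessR 22 7 (fits 5 (fits 7 offer)))"

text \<open>\<open>w\<close> names the register whose reciprocal is \<open>\<eta> - 1\<close>: 23
  holds \<open>N\<close>, and 15 at that moment holds \<open>n * N\<close>. The sizes
  \<open>n\<close> and \<open>d\<close> are read from \<open>R 20\<close> and \<open>R 21\<close>,
  which were obtained by counting, as no instruction turns a natural number into a real.\<close>

definition params :: "nat \<Rightarrow> nat \<Rightarrow> com" where
  "params N w = Atom (RConst 23 N) ;; Atom (RMul 15 20 23) ;; Atom (RMul 16 21 23) ;; Atom (RDiv 14 2 w) ;;
     Atom (RAdd 14 2 14) ;; Atom (RAdd 10 11 1) ;; Atom (RDiv 15 10 15) ;; Atom (RDiv 16 10 16) ;;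
     Atom (RAdd 12 1 1) ;; Atom (RMul 13 20 10) ;; Atom (RAdd 3 13 1)"

section \<open>Correctness and running time of the preprocessing\<close>

context smks_ctx
begin

definition amax :: "nat \<Rightarrow> nat \<Rightarrow> bool" where
  "amax u i \<longleftrightarrow> i < d \<and> (\<forall>k<d. cost x k u / budget x k \<le> cost x i u / budget x i)"

definition data :: "nat \<Rightarrow> nat \<Rightarrow> (nat \<Rightarrow> nat) \<Rightarrow> (nat \<Rightarrow> real) \<Rightarrow> bool" where
  "data q j M R \<longleftrightarrow> M 0 = n \<and> M 1 = d \<and> M 3 = 0 \<and> M 4 = 1 \<and> M 14 = 30 \<and> M 15 = 30 + n \<and> M 16 = 30 + 2 * n \<and>
     M 17 = 30 + 3 * n \<and> R 1 = 0 \<and> R 2 = 1 \<and> R 17 = real q \<and> R 19 = 2 \<and> R 20 = real j \<and> R 21 = real d \<and> R 22 = 3 / 4 \<and>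
     stored_set n M 30 = {} \<and>
     (\<forall>u<j. R (30 + u) = kcost u \<and> M (30 + 2 * n + u) = (if small q u then 1 else 0) \<and> amax u (M (30 + 3 * n + u)))"

definition cand :: "real \<Rightarrow> (nat \<Rightarrow> nat) \<Rightarrow> (nat \<Rightarrow> real) \<Rightarrow> bool" where
  "cand V M R \<longleftrightarrow> best V M R \<and> stored_set n M (30 + n) \<subseteq> {M 18, M 19} \<and> M 18 < n \<and> M 19 < n"

lemma wp_offer:
  assumes data: "data q j M R" and cand: "cand V M R" and uv: "M 5 = u" "M 7 = v" "u < n" "v < n" "kfeas {u, v}"
    and Q: "\<And>V' M' R' t'. \<lbrakk>data q j M' R'; cand V' M' R'; V \<le> V'; {u, v} \<in> \<I> \<Longrightarrow> f {u, v} \<le> V';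
       M' 5 = u; M' 7 = v; t' \<le> t + 21\<rbrakk> \<Longrightarrow> Q M' R' t'"
  shows "wp x offer Q M R t"
proof -
  have [simp]: "M 3 = 0" "M 4 = 1" "M 14 = 30" "M 15 = 30 + n" "R (Suc 0) = 0" "stored_set n M 30 = {}" "M 5 = u" "M 7 = v"
    using data uv by (auto simp: data_def)
  have [simp]: "R 11 = V" and b: "stored_set n M (30 + n) \<subseteq> {M 18, M 19}" "M 18 < n" "M 19 < n" "best V M R"
    using cand by (auto simp: cand_def best_def)
  have [simp]: "stored_set n (M'(30 + u := Suc 0)) 30 = insert u (stored_set n M' 30)"
    "stored_set n (M'(30 + v := Suc 0)) 30 = insert v (stored_set n M' 30)"
    "stored_set n (M'(30 + u := 0)) 30 = stored_set n M' 30 - {u}"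
    "stored_set n (M'(30 + v := 0)) 30 = stored_set n M' 30 - {v}" 
    "stored_set n (M'(30 + n + u := Suc 0)) (30 + n) = insert u (stored_set n M' (30 + n))"
    "stored_set n (M'(30 + n + v := Suc 0)) (30 + n) = insert v (stored_set n M' (30 + n))"
    "stored_set n (M'(30 + n + w := 0)) (30 + n) = stored_set n M' (30 + n) - {w}"
    for M' w
    using uv by (auto simp: stored_set_def)
  have [simp]: "{v, u} = {u, v}" "stored_set n M (30 + n) - {M 18} - {M 19} = {}"
    using b by auto
  show ?thesis
    unfolding offer_def
    apply ((rule wp_Seq wp_UnlessN wp_UnlessR wp_atoms; (simp add: stored_set_upd_out split del: if_split)?)+)
    subgoal using data b uv
      by (intro Q[of _ _ "f {u, v}"])
        (auto simp: data_def cand_def best_def stored_set_upd_out feasible_iff split: if_splits)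
    subgoal using data b uv by (intro Q[of _ _ V]) (auto simp: data_def cand_def best_def stored_set_upd_out)
    subgoal using data b uv by (intro Q[of _ _ V]) (auto simp: data_def cand_def best_def stored_set_upd_out split: if_splits)
    done
qed

lemma wp_read_costs:
  assumes M: "M 1 = d" "M 3 = 0" "M 4 = 1" "M 5 = u" "u < n" "R 1 = 0" "R 17 = real q"
    and Q: "\<And>k k' i b c e g t'. \<lbrakk>k < d \<longleftrightarrow> \<not> kfeas {u}; k' < d \<longleftrightarrow> \<not> small q u; amax u i; t' \<le> t + 6 + 14 * d\<rbrakk> \<Longrightarrow>
        Q (M(6 := d, 10 := k, 12 := k', 13 := i)) (R(5 := kcost u, 7 := b, 8 := c, 9 := e, 18 := g)) t'"
  shows "wp x read_costs Q M R t"
proof -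
  let ?r = "\<lambda>i. cost x i u / budget x i"
  let ?J = "\<lambda>j M' R' t'. (\<forall>a. a \<noteq> 6 \<and> a \<noteq> 10 \<and> a \<noteq> 12 \<and> a \<noteq> 13 \<longrightarrow> M' a = M a) \<and>
     (\<forall>a. a \<noteq> 5 \<and> a \<noteq> 7 \<and> a \<noteq> 8 \<and> a \<noteq> 9 \<and> a \<noteq> 18 \<longrightarrow> R' a = R a) \<and>
     R' 5 = (\<Sum>i<j. ?r i) \<and> M' 10 = count_below (\<lambda>i. cost x i u \<le> budget x i) j \<and>
     M' 12 = count_below (\<lambda>i. real q * cost x i u \<le> budget x i) j \<and>
     (\<forall>k<j. ?r k \<le> R' 18) \<and> (if j = 0 then R' 18 = 0 else M' 13 < j \<and> R' 18 = ?r (M' 13)) \<and> t' \<le> t + 6 + 14 * j"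
  have "wp x (For 6 1 (
     Atom (ReadCost 7 6 5) ;; Atom (ReadBudget 8 6) ;; UnlessR 8 7 (Atom (NAdd 10 10 4)) ;;
     Atom (RMul 9 17 7) ;; UnlessR 8 9 (Atom (NAdd 12 12 4)) ;; Atom (RDiv 7 7 8) ;; Atom (RAdd 5 5 7) ;;
     UnlessR 7 18 (Atom (RAdd 18 7 1) ;; Atom (NAdd 13 6 3)))) Q (M(10 := 0, 12 := 0, 13 := 0)) (R(5 := 0, 18 := 0)) (t + 5)"
  proof (rule wp_For[where K = d and J = ?J])
    fix j M' R' t'
    assume j: "j < d" "M' 6 = j" and J: "?J j M' R' t'"
    have [simp]: "M' 5 = u" "M' 4 = 1" "M' (Suc 0) = d" "M' 3 = 0" "R' 17 = real q" "R' (Suc 0) = 0" "M' 6 = j"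
      using J M j by auto
    have J': "R' 5 = (\<Sum>i<j. ?r i)" "M' 10 = count_below (\<lambda>i. cost x i u \<le> budget x i) j"
     "M' 12 = count_below (\<lambda>i. real q * cost x i u \<le> budget x i) j"
     "\<forall>k<j. ?r k \<le> R' 18" "if j = 0 then R' 18 = 0 else M' 13 < j \<and> R' 18 = ?r (M' 13)" "t' \<le> t + 6 + 14 * j"
      using J by blast+
    have r0: "0 \<le> ?r j" using cost_nonneg budget_pos M j by (intro divide_nonneg_pos) auto
    define P where "P = (\<lambda>M' R' t'. M' 6 = j \<and> M' 4 = 1 \<and> M' 1 = d \<and> ?J (Suc j) (M'(6 := Suc j)) R' (t' + 2))"
    have P: "P M'' R'' t''"
      if "\<forall>a. a \<noteq> 10 \<and> a \<noteq> 12 \<and> a \<noteq> 13 \<longrightarrow> M'' a = M' a"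
       "\<forall>a. a \<noteq> 5 \<and> a \<noteq> 7 \<and> a \<noteq> 8 \<and> a \<noteq> 9 \<and> a \<noteq> 18 \<longrightarrow> R'' a = R' a"
       "M'' 10 = count_below (\<lambda>i. cost x i u \<le> budget x i) (Suc j)"
       "M'' 12 = count_below (\<lambda>i. real q * cost x i u \<le> budget x i) (Suc j)" "R'' 5 = (\<Sum>i<Suc j. ?r i)"
       "R' 18 \<le> R'' 18" "?r j \<le> R'' 18" "M'' 13 < Suc j" "R'' 18 = ?r (M'' 13)" "t'' \<le> t' + 12" for M'' R'' t''
    proof -
      have "\<forall>k<Suc j. ?r k \<le> R'' 18"
        using J'(4) that(6,7) by (auto simp: less_Suc_eq intro: order_trans)
      then show ?thesis
        unfolding P_def using J that M by simp
    qed
    have "wp x (Atom (ReadCost 7 6 5) ;; Atom (ReadBudget 8 6) ;; UnlessR 8 7 (Atom (NAdd 10 10 4)) ;;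
     Atom (RMul 9 17 7) ;; UnlessR 8 9 (Atom (NAdd 12 12 4)) ;; Atom (RDiv 7 7 8) ;; Atom (RAdd 5 5 7) ;;
     UnlessR 7 18 (Atom (RAdd 18 7 1) ;; Atom (NAdd 13 6 3))) P M' R' t'"
      by ((rule wp_Seq wp_UnlessR wp_atoms; (simp split del: if_split)?) |
          (rule P; insert J'(1-3,5,6) r0; auto split: if_splits))+
    then show "wp x (Atom (ReadCost 7 6 5) ;; Atom (ReadBudget 8 6) ;; UnlessR 8 7 (Atom (NAdd 10 10 4)) ;;
     Atom (RMul 9 17 7) ;; UnlessR 8 9 (Atom (NAdd 12 12 4)) ;; Atom (RDiv 7 7 8) ;; Atom (RAdd 5 5 7) ;;
     UnlessR 7 18 (Atom (RAdd 18 7 1) ;; Atom (NAdd 13 6 3)))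
      (\<lambda>M' R' t'. M' 6 = j \<and> M' 4 = 1 \<and> M' 1 = d \<and> ?J (Suc j) (M'(6 := Suc j)) R' (t' + 2)) M' R' t'"
      unfolding P_def .
  next
    fix M' R' t'
    assume "M' 6 = d" and J: "?J d M' R' t'"
    then have "M' = M(6 := d, 10 := M' 10, 12 := M' 12, 13 := M' 13)"
      "R' = R(5 := kcost u, 7 := R' 7, 8 := R' 8, 9 := R' 9, 18 := R' 18)"
      by (auto simp: kcost_def)
    moreover have "Q (M(6 := d, 10 := M' 10, 12 := M' 12, 13 := M' 13))
        (R(5 := kcost u, 7 := R' 7, 8 := R' 8, 9 := R' 9, 18 := R' 18)) t'"
      using J d_pos M by (intro Q) (auto simp: kfeas_def small_def amax_def count_below_less)
    ultimately show "Q M' R' t'" by simp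
  qed (use d_pos M in auto)
  then show ?thesis
    unfolding read_costs_def by (intro wp_Seq wp_atoms) (simp add: eval_nat_numeral)
qed

lemma kfeas_singleton_kcost:
  assumes "u < n" "kcost u \<le> 1"
  shows "kfeas {u}"
  unfolding kfeas_def
proof (intro allI impI)
  fix i assume i: "i < d"
  have "cost x i u / budget x i \<le> 1"
    using cost_le_kcost[OF assms(1) i] assms(2) by simp
  then show "(\<Sum>u\<in>{u}. cost x i u) \<le> budget x i"
    using budget_pos[OF i] by (simp add: field_simps)
qed

lemma wp_analyse:
  assumes data: "data q u M R" and cand: "cand V M R" and u: "M 5 = u" "u < n"
    and Q: "\<And>V' M' R' t'. \<lbrakk>data q (Suc u) M' R'; cand V' M' R'; V \<le> V'; feasible x {u} \<Longrightarrow> f {u} \<le> V';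
       M' 5 = u; t' \<le> t + 38 + 14 * d\<rbrakk> \<Longrightarrow> Q M' R' t'"
  shows "wp x analyse Q M R t"
proof -
  have M [simp]: "M (Suc 0) = d" "M 3 = 0" "M 4 = 1" "M 14 = 30" "M 15 = 30 + n" "M 16 = 30 + 2 * n" "M 17 = 30 + 3 * n"
    "R (Suc 0) = 0" "R 2 = 1" "R 17 = real q" "R 20 = real u" "M 5 = u"
    using data u by (auto simp: data_def)
  show ?thesis
    unfolding analyse_def
  proof (rule wp_Seq, rule wp_read_costs[where u = u and q = q])
    fix k k' i b c e g t'
    assume k: "k < d \<longleftrightarrow> \<not> kfeas {u}" "k' < d \<longleftrightarrow> \<not> small q u" and i: "amax u i" and t': "t' \<le> t + 6 + 14 * d"
    define P where "P = Q"
    have fin: "P M' R' t''" if "data q (Suc u) M' R'" "cand V M' R'" "M' 5 = u" "t'' \<le> t' + 12" "\<not> kfeas {u}" for M' R' t''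
      unfolding P_def using that t' by (intro Q[of _ _ V]) (auto simp: feasible_iff)
    have off: "wp x offer P M' R' t''" if "data q (Suc u) M' R'" "cand V M' R'" "M' 5 = u" "M' 7 = u" "t'' \<le> t' + 11" "kfeas {u}" for M' R' t''
      using that t' u unfolding P_def
      by (intro wp_offer[OF that(1-4) u(2) u(2)] Q) (auto simp: feasible_iff)
    let ?M = "M(6 := d, 10 := k, 12 := k', 13 := i)"
    let ?R = "R(5 := kcost u, 7 := b, 8 := c, 9 := e, 18 := g)"
    have "wp x (Atom (RAdd 20 20 2) ;; Atom (NAdd 8 14 5) ;; Atom (RStore 8 5) ;;
     Atom (NAdd 9 17 5) ;; Atom (NStore 9 13) ;; Atom (NAdd 9 16 5) ;; Atom (NStore 9 3) ;;
     UnlessN 12 1 (Atom (NStore 9 4)) ;; UnlessN 10 1 (Atom (NAdd 7 5 3) ;; offer)) P ?M ?R t'"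
      by ((rule wp_Seq wp_UnlessN wp_atoms; (simp split del: if_split)?) |
          (rule off fin; insert data cand k i u, auto simp: data_def cand_def best_def less_Suc_eq stored_set_upd_out))+
    then show "wp x (Atom (RAdd 20 20 2) ;; Atom (NAdd 8 14 5) ;; Atom (RStore 8 5) ;;
     Atom (NAdd 9 17 5) ;; Atom (NStore 9 13) ;; Atom (NAdd 9 16 5) ;; Atom (NStore 9 3) ;;
     UnlessN 12 1 (Atom (NStore 9 4)) ;; UnlessN 10 1 (Atom (NAdd 7 5 3) ;; offer)) Q ?M ?R t'"
      unfolding P_def .
  qed (use u in auto)
qed

text \<open>By \<open>kfeas_pair\<close> the tests in two knapsacks decide feasibility exactly. For
  \<open>u = v\<close> they would add the same cost twice and might reject; singletons have already
  been offered by \<open>analyse\<close>.\<close>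

lemma wp_try_pair:
  assumes data: "data q n M R" and cand: "cand V M R" and uv: "M 5 = u" "M 7 = v" "u < n" "v < n"
    and Q: "\<And>V' M' R' t'. \<lbrakk>data q n M' R'; cand V' M' R'; V \<le> V';
       \<lbrakk>u \<noteq> v; feasible x {u, v}; kcost u \<le> 3 / 4; kcost v \<le> 3 / 4\<rbrakk> \<Longrightarrow> f {u, v} \<le> V';
       M' 5 = u; M' 7 = v; t' \<le> t + 41\<rbrakk> \<Longrightarrow> Q M' R' t'"
  shows "wp x try_pair Q M R t"
proof -
  have M [simp]: "M 14 = 30" "M 17 = 30 + 3 * n" "M 5 = u" "M 7 = v" "R 22 = 3 / 4" "R (30 + u) = kcost u" "R (30 + v) = kcost v"
    using data uv by (auto simp: data_def)
  define i where "i = M (30 + 3 * n + u)"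
  define j where "j = M (30 + 3 * n + v)"
  have ij: "amax u i" "amax v j"
    using data uv by (auto simp: data_def i_def j_def)
  have [simp]: "M (30 + 3 * n + u) = i" "M (30 + 3 * n + v) = j"
    by (auto simp: i_def j_def)
  have skip: "Q M' R' t'" if "data q n M' R'" "cand V M' R'" "M' 5 = u" "M' 7 = v" "t' \<le> t + 20"
    "kcost u \<le> 3 / 4 \<Longrightarrow> kcost v \<le> 3 / 4 \<Longrightarrow> u \<noteq> v \<Longrightarrow> \<not> kfeas {u, v}" for M' R' t'
    using that by (intro Q[of _ _ V]) (auto simp: feasible_iff)
  have off: "wp x offer Q M' R' t'" if "data q n M' R'" "cand V M' R'" "M' 5 = u" "M' 7 = v" "t' \<le> t + 20" "kfeas {u, v}" for M' R' t'
    using that by (intro wp_offer[OF that(1-4) uv(3,4)] Q) (auto simp: feasible_iff)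
  have no: "\<not> kfeas {u, v}" if "u \<noteq> v" "i < d" "budget x i < cost x i u + cost x i v" for i
    using that by (force simp: kfeas_def not_le)
  have yes: "kfeas {u, v}" if "kcost u \<le> 3 / 4" "kcost v \<le> 3 / 4"
    "cost x i u + cost x i v \<le> budget x i" "cost x j u + cost x j v \<le> budget x j"
    using that ij uv by (intro kfeas_pair[of u v i j] kfeas_singleton_kcost) (auto simp: amax_def)
  show ?thesis
    unfolding try_pair_def fits_def
    by ((rule wp_Seq wp_UnlessR wp_atoms; (simp split del: if_split)?) |
        (rule off; insert data cand yes, auto simp: data_def cand_def best_def stored_set_upd_out; fail) |
        (rule skip; insert data cand ij no, auto simp: amax_def data_def cand_def best_def stored_set_upd_out; fail))+
qed

lemma wp_initialise:
  assumes Q: "\<And>M R t'. \<lbrakk>data q 0 M R; cand (f {}) M R; t' \<le> t + 13 + 3 * d\<rbrakk> \<Longrightarrow> Q M R t'"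
    and n: "0 < n"
  shows "wp x (initialise q) Q (nmem (init_config \<epsilon> x)) (rmem (init_config \<epsilon> x)) t"
proof -
  define M R where "M = nmem (init_config \<epsilon> x)" and "R = rmem (init_config \<epsilon> x)"
  have M [simp]: "M 0 = n" "M (Suc 0) = d" "\<And>a. 3 \<le> a \<Longrightarrow> M a = 0" "\<And>a. 0 < a \<Longrightarrow> R a = 0"
    by (auto simp: M_def R_def init_config_def)
  let ?M = "M(4 := 1, 14 := 30, 15 := 30 + n, 16 := 30 + 2 * n, 17 := 30 + 3 * n)"
  let ?R = "R(2 := 1, 17 := real q, 19 := 2, 7 := 4, 22 := 3 / 4, 11 := f {})"
  have loop: "wp x (For 6 1 (Atom (RAdd 21 21 2))) Q ?M ?R (t + 12)"
  proof (rule wp_For[where K = d and J = "\<lambda>j M' R' t'. (\<forall>a. a \<noteq> 6 \<longrightarrow> M' a = ?M a) \<and> R' = ?R(21 := real j) \<and> t' \<le> t + 13 + 3 * j"])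
    fix j M' R' t'
    assume "j < d" "M' 6 = j" and *: "(\<forall>a. a \<noteq> 6 \<longrightarrow> M' a = ?M a) \<and> R' = ?R(21 := real j) \<and> t' \<le> t + 13 + 3 * j"
    then show "wp x (Atom (RAdd 21 21 2)) (\<lambda>M' R' t'. M' 6 = j \<and> M' 4 = 1 \<and> M' 1 = d \<and>
       (\<forall>a. a \<noteq> 6 \<longrightarrow> (M'(6 := Suc j)) a = ?M a) \<and> R' = ?R(21 := real (Suc j)) \<and> t' + 2 \<le> t + 13 + 3 * Suc j) M' R' t'"
      by (intro wp_atoms) (auto simp: fun_eq_iff)
  next
    fix M' R' t'
    assume *: "(\<forall>a. a \<noteq> 6 \<longrightarrow> M' a = ?M a) \<and> R' = ?R(21 := real d) \<and> t' \<le> t + 13 + 3 * d"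
    then have "stored_set n M' 30 = {}" "stored_set n M' (30 + n) = {}"
      by (auto simp: stored_set_def)
    then show "Q M' R' t'"
      using * n feasible_empty by (intro Q) (auto simp: data_def cand_def best_def)
  qed (use d_pos in auto)
  have [simp]: "stored_set n M 30 = {}"
    by (auto simp: stored_set_def)
  show ?thesis
    unfolding initialise_def M_def[symmetric] R_def[symmetric]
    apply ((rule wp_Seq wp_atoms; (simp add: stored_set_upd_out)?)+)
    using loop by (simp add: eval_nat_numeral)
qed

lemma data_upd5: "data q j (M(5 := w)) R = data q j M R" "cand V (M(5 := w)) R = cand V M R"
  and data_upd7: "data q j (M(7 := w)) R = data q j M R" "cand V (M(7 := w)) R = cand V M R"
  by (auto simp: data_def cand_def best_def stored_set_upd_out)

lemma wp_analyse_all: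
  assumes data: "data q 0 M R" and cand: "cand (f {}) M R" and n: "0 < n"
    and Q: "\<And>V M' R' t'. \<lbrakk>data q n M' R'; cand V M' R'; f {} \<le> V; \<And>u. feasible x {u} \<Longrightarrow> f {u} \<le> V;
       t' \<le> t + 1 + n * (40 + 14 * d)\<rbrakk> \<Longrightarrow> Q M' R' t'"
  shows "wp x (For 5 0 analyse) Q M R t"
proof (rule wp_For[where K = n and J = "\<lambda>j M' R' t'. \<exists>V. data q j M' R' \<and> cand V M' R' \<and> f {} \<le> V \<and>
      (\<forall>u<j. feasible x {u} \<longrightarrow> f {u} \<le> V) \<and> t' \<le> t + 1 + j * (40 + 14 * d)"])
  show "\<exists>V. data q 0 (M(5 := 0)) R \<and> cand V (M(5 := 0)) R \<and> f {} \<le> V \<and>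
      (\<forall>u<0. feasible x {u} \<longrightarrow> f {u} \<le> V) \<and> Suc t \<le> t + 1 + 0 * (40 + 14 * d)"
    using data cand by (auto simp: data_upd5)
  fix j M' R' t'
  assume j: "j < n" "M' 5 = j" and "\<exists>V. data q j M' R' \<and> cand V M' R' \<and> f {} \<le> V \<and>
      (\<forall>u<j. feasible x {u} \<longrightarrow> f {u} \<le> V) \<and> t' \<le> t + 1 + j * (40 + 14 * d)"
  then obtain V where V: "data q j M' R'" "cand V M' R'" "f {} \<le> V"
      "\<forall>u<j. feasible x {u} \<longrightarrow> f {u} \<le> V" "t' \<le> t + 1 + j * (40 + 14 * d)" by blast
  show "wp x analyse (\<lambda>M' R' t'. M' 5 = j \<and> M' 4 = 1 \<and> M' 0 = n \<and> (\<exists>V. data q (Suc j) (M'(5 := Suc j)) R' \<and>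
      cand V (M'(5 := Suc j)) R' \<and> f {} \<le> V \<and>
      (\<forall>u<Suc j. feasible x {u} \<longrightarrow> f {u} \<le> V) \<and> t' + 2 \<le> t + 1 + Suc j * (40 + 14 * d))) M' R' t'"
  proof (rule wp_analyse[OF V(1,2) j(2,1)])
    fix V' M'' R'' t''
    assume *: "data q (Suc j) M'' R''" "cand V' M'' R''" "V \<le> V'" "feasible x {j} \<Longrightarrow> f {j} \<le> V'"
       "M'' 5 = j" "t'' \<le> t' + 38 + 14 * d"
    have "M'' 4 = 1" "M'' 0 = n"
      using *(1) by (auto simp: data_def)
    then show "M'' 5 = j \<and> M'' 4 = 1 \<and> M'' 0 = n \<and> (\<exists>V. data q (Suc j) (M''(5 := Suc j)) R'' \<and>
      cand V (M''(5 := Suc j)) R'' \<and> f {} \<le> V \<and>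
      (\<forall>u<Suc j. feasible x {u} \<longrightarrow> f {u} \<le> V) \<and> t'' + 2 \<le> t + 1 + Suc j * (40 + 14 * d))"
      using V * by (intro conjI exI[of _ V']) (auto simp: data_upd5 less_Suc_eq)
  qed
next
  fix M' R' t'
  assume "\<exists>V. data q n M' R' \<and> cand V M' R' \<and> f {} \<le> V \<and>
      (\<forall>u<n. feasible x {u} \<longrightarrow> f {u} \<le> V) \<and> t' \<le> t + 1 + n * (40 + 14 * d)"
  then show "Q M' R' t'"
    using indep_ground by (elim exE conjE, intro Q) (auto simp: feasible_iff)
qed (use n in auto)

lemma wp_all_pairs:
  assumes data: "data q n M R" and cand: "cand V0 M R" and n: "0 < n"
    and Q: "\<And>V M' R' t'. \<lbrakk>data q n M' R'; cand V M' R'; V0 \<le> V;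
       \<And>u v. \<lbrakk>u \<noteq> v; feasible x {u, v}; kcost u \<le> 3 / 4; kcost v \<le> 3 / 4\<rbrakk> \<Longrightarrow> f {u, v} \<le> V;
       t' \<le> t + 1 + n * (3 + 43 * n)\<rbrakk> \<Longrightarrow> Q M' R' t'"
  shows "wp x (For 5 0 (For 7 0 try_pair)) Q M R t"
proof -
  define ok where "ok V u v \<longleftrightarrow> (u \<noteq> v \<and> feasible x {u, v} \<and> kcost u \<le> 3 / 4 \<and> kcost v \<le> 3 / 4 \<longrightarrow> f {u, v} \<le> V)" for V u v
  have ok_mono: "ok V u v \<Longrightarrow> V \<le> V' \<Longrightarrow> ok V' u v" for V V' u v
    by (auto simp: ok_def)
  define J1 where "J1 j M' R' t' \<longleftrightarrow> (\<exists>V. data q n M' R' \<and> cand V M' R' \<and> V0 \<le> V \<and>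
      (\<forall>u<j. \<forall>v<n. ok V u v) \<and> t' \<le> t + 1 + j * (3 + 43 * n))" for j M' R' t'
  define J2 where "J2 j k M' R' t' \<longleftrightarrow> (\<exists>V. data q n M' R' \<and> cand V M' R' \<and> V0 \<le> V \<and> M' 5 = j \<and>
      (\<forall>u<j. \<forall>v<n. ok V u v) \<and> (\<forall>v<k. ok V j v) \<and> t' \<le> t + 2 + j * (3 + 43 * n) + 43 * k)" for j k M' R' t'
  show ?thesis
  proof (rule wp_For[where K = n and J = J1])
    show "J1 0 (M(5 := 0)) R (Suc t)"
      using data cand by (auto simp: J1_def data_upd5)
    fix j M' R' t'
    assume j: "j < n" "M' 5 = j" "J1 j M' R' t'"
    show "wp x (For 7 0 try_pair) (\<lambda>M' R' t'. M' 5 = j \<and> M' 4 = 1 \<and> M' 0 = n \<and> J1 (Suc j) (M'(5 := Suc j)) R' (t' + 2)) M' R' t'"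
    proof (rule wp_For[where K = n and J = "J2 j"])
      show "J2 j 0 (M'(7 := 0)) R' (Suc t')"
        using j by (auto simp: J1_def J2_def data_upd7)
    next
      fix k M' R' t'
      assume k: "k < n" "M' 7 = k" "J2 j k M' R' t'"
      then obtain V where V: "data q n M' R'" "cand V M' R'" "V0 \<le> V" "M' 5 = j"
        "\<forall>u<j. \<forall>v<n. ok V u v" "\<forall>v<k. ok V j v" "t' \<le> t + 2 + j * (3 + 43 * n) + 43 * k"
        by (auto simp: J2_def)
      show "wp x try_pair (\<lambda>M' R' t'. M' 7 = k \<and> M' 4 = 1 \<and> M' 0 = n \<and> J2 j (Suc k) (M'(7 := Suc k)) R' (t' + 2)) M' R' t'"
      proof (rule wp_try_pair[OF V(1,2,4) k(2) j(1) k(1)])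
        fix V' M'' R'' t''
        assume *: "data q n M'' R''" "cand V' M'' R''" "V \<le> V'"
          "\<lbrakk>j \<noteq> k; feasible x {j, k}; kcost j \<le> 3 / 4; kcost k \<le> 3 / 4\<rbrakk> \<Longrightarrow> f {j, k} \<le> V'"
          "M'' 5 = j" "M'' 7 = k" "t'' \<le> t' + 41"
        have "M'' 4 = 1" "M'' 0 = n"
          using *(1) by (auto simp: data_def)
        moreover have "ok V' j k"
          using *(4) by (simp add: ok_def)
        then have "J2 j (Suc k) (M''(7 := Suc k)) R'' (t'' + 2)"
          unfolding J2_def using V * ok_mono[OF _ *(3)] by (intro exI[of _ V']) (auto simp: data_upd7 less_Suc_eq)
        ultimately show "M'' 7 = k \<and> M'' 4 = 1 \<and> M'' 0 = n \<and> J2 j (Suc k) (M''(7 := Suc k)) R'' (t'' + 2)"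
          using * by simp
      qed
    next
      fix M' R' t'
      assume "J2 j n M' R' t'"
      then obtain V where V: "data q n M' R'" "cand V M' R'" "V0 \<le> V" "M' 5 = j"
        "\<forall>u<j. \<forall>v<n. ok V u v" "\<forall>v<n. ok V j v" "t' \<le> t + 2 + j * (3 + 43 * n) + 43 * n"
        by (auto simp: J2_def)
      then have "J1 (Suc j) (M'(5 := Suc j)) R' (t' + 2)"
        unfolding J1_def by (intro exI[of _ V]) (auto simp: data_upd5 less_Suc_eq)
      then show "M' 5 = j \<and> M' 4 = 1 \<and> M' 0 = n \<and> J1 (Suc j) (M'(5 := Suc j)) R' (t' + 2)"
        using V by (auto simp: data_def)
    qed (use n in auto)
  next
    fix M' R' t'
    assume "J1 n M' R' t'"
    then obtain V where V: "data q n M' R'" "cand V M' R'" "V0 \<le> V"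
        "\<forall>u<n. \<forall>v<n. ok V u v" "t' \<le> t + 1 + n * (3 + 43 * n)"
      by (auto simp: J1_def)
    show "Q M' R' t'"
    proof (rule Q[OF V(1-3) _ V(5)])
      fix u v assume *: "u \<noteq> v" "feasible x {u, v}" "kcost u \<le> 3 / 4" "kcost v \<le> 3 / 4"
      then have "u < n" "v < n"
        using indep_ground by (auto simp: feasible_iff)
      then show "f {u, v} \<le> V"
        using V(4) * by (auto simp: ok_def)
    qed
  qed (use n in auto)
qed

lemma wp_params:
  assumes data: "data q n M R" and cand: "cand m M R" and n: "0 < n"
    and w: "w = 15 \<and> W = n * N \<or> w = 23 \<and> W = N"
    and Q: "\<And>R' t'. \<lbrakk>env q (1 + 1 / real W) m (m / (real n * real N)) (m / (real d * real N)) M R'; best m M R';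
       R' 3 = real n * m; R' 12 = 0; R' 13 = real n * m; t' = t + 11\<rbrakk> \<Longrightarrow> Q M R' t'"
  shows "wp x (params N w) Q M R t"
proof -
  have [simp]: "R (Suc 0) = 0" "R 2 = 1" "R 20 = real n" "R 21 = real d" "R 11 = m"
    using data cand by (auto simp: data_def cand_def best_def)
  show ?thesis
    using w
  proof (elim disjE conjE)
    assume [simp]: "w = 15" and W: "W = n * N"
    show ?thesis
      unfolding params_def
      by ((rule wp_Seq wp_atoms; simp?) |
          (rule Q; insert data cand W, auto simp: env_def data_def cand_def best_def; fail))+
  next
    assume [simp]: "w = 23" and W: "W = N"
    show ?thesis
      unfolding params_def
      by ((rule wp_Seq wp_atoms; simp?) |
          (rule Q; insert data cand W, auto simp: env_def data_def cand_def best_def; fail))+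
  qed
qed

end

section \<open>The two algorithms\<close>

definition linear_com :: "nat \<Rightarrow> com" where
  "linear_com N = initialise 2 ;; For 5 0 analyse ;; params N 23 ;; DoR probe 16 23"

definition quadratic_com :: "nat \<Rightarrow> com" where
  "quadratic_com N = initialise 3 ;; For 5 0 analyse ;; For 5 0 (For 7 0 try_pair) ;; params N 15 ;;
     DoR probe 16 23"

section \<open>Guarantees and total running times of the two programs\<close>

context smks_ctx
begin

lemma probe_time_le:
  assumes "0 < n"
  shows "probe_time W lg + 1 \<le> 110 * (n * d) + 23 * (n * (W * lg + 1))"
proof -
  have "1 \<le> n * d" "n \<le> n * d" "d \<le> n * d"
    using assms d_pos by (auto simp: Suc_le_eq)
  moreover have "(W * lg + 1) * (20 * n + 3) \<le> (W * lg + 1) * (23 * n)"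
    using assms by (intro mult_left_mono) auto
  moreover have "(8 + 11 * d) * n = 8 * n + 11 * (n * d)" "n * (32 + 22 * d) = 32 * n + 22 * (n * d)"
    "(W * lg + 1) * (23 * n) = 23 * (n * (W * lg + 1))"
    by (auto simp: algebra_simps)
  ultimately show ?thesis
    unfolding probe_time_def run_time_def by linarith
qed

text \<open>One factor \<open>lg + 1\<close> counts the probes, the other the halvings of the
  threshold within a run. The constant is 264 = 82 + 47 + 2 + 133, where 133 = 110 + 23 comes from
  \<open>probe_time_le\<close>.\<close>

lemma total_time_le:
  assumes n: "0 < n" and W: "1 \<le> W"
    and t: "t \<le> 82 * (n * d) + 47 * (n * W) + (lg + 1) * (probe_time W lg + 1)"
  shows "real t + 2 \<le> 264 * ((real lg + 1)\<^sup>2 * (real n * real d + real n * real W))"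
proof -
  let ?a = "n * d" and ?b = "n * W" and ?l = "lg + 1"
  have 1: "1 \<le> ?a" "n \<le> ?a" "1 \<le> ?b"
    using n W d_pos by (auto simp: Suc_le_eq)
  have "n * (W * lg + 1) \<le> ?l * (?a + ?b)"
  proof -
    have "n * (W * lg + 1) = lg * ?b + n" "?l * (?a + ?b) = lg * ?b + lg * ?a + ?a + ?b"
      by (auto simp: algebra_simps)
    then show ?thesis using 1 by linarith
  qed
  moreover have "?a \<le> ?l * (?a + ?b)"
    by simp
  ultimately have "probe_time W lg + 1 \<le> 133 * (?l * (?a + ?b))"
    using probe_time_le[OF n, of W lg] by linarith
  then have "?l * (probe_time W lg + 1) \<le> 133 * (?l\<^sup>2 * (?a + ?b))"
    using mult_left_mono[of "probe_time W lg + 1" "133 * (?l * (?a + ?b))" ?l] by (simp add: power2_eq_square algebra_simps)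
  moreover have "?a + ?b \<le> ?l\<^sup>2 * (?a + ?b)"
    by simp
  ultimately have "t + 2 \<le> 264 * (?l\<^sup>2 * (?a + ?b))"
    using t 1 by linarith
  then have "real (t + 2) \<le> real (264 * (?l\<^sup>2 * (?a + ?b)))"
    by (simp only: of_nat_le_iff)
  then show ?thesis
    by (simp add: add.commute)
qed

text \<open>The exponent chosen for the bisection also serves for the thresholds, so a single
  \<open>lg\<close> is enough.\<close>

lemma log_bounds:
  assumes "0 < n" "1 \<le> N" "real n * real d * real N \<le> 2 ^ lg"
  shows "real n * real N \<le> 2 ^ lg"
proof -
  have "real n * real N * 1 \<le> real n * real N * real d"
    using d_pos by (intro mult_left_mono) auto
  also have "\<dots> = real n * real d * real N"
    by (simp add: algebra_simps)
  finally show ?thesis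
    using assms by linarith
qed

lemma wp_linear_com:
  assumes n: "0 < n" and N: "1 \<le> N" and lg: "real n * real d * real N \<le> 2 ^ lg"
  shows "wp x (linear_com N) (\<lambda>M R t. feasible x (stored_set n M (M 15)) \<and>
      (\<forall>Y. feasible x Y \<longrightarrow> f Y \<le> ((1 + 1 / real N) * real p' + 1 + 7 / 4 * real d + 3 / real N) * f (stored_set n M (M 15))) \<and>
      real t + 2 \<le> 264 * ((real lg + 1)\<^sup>2 * (real n * real d + real n * real N)))
    (nmem (init_config \<epsilon> x)) (rmem (init_config \<epsilon> x)) 0"
  unfolding linear_com_def
proof (rule wp_Seq, rule wp_initialise[OF _ n], rule wp_Seq, rule wp_analyse_all[OF _ _ n], assumption, assumption, rule wp_Seq)
  fix M R t1 V M' R' t2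
  assume t1: "t1 \<le> 0 + 13 + 3 * d" and d: "data 2 n M' R'" "cand V M' R'" and V: "f {} \<le> V" "\<And>u. feasible x {u} \<Longrightarrow> f {u} \<le> V"
    and t2: "t2 \<le> t1 + 1 + n * (40 + 14 * d)"
  show "wp x (params N 23) (wp x (DoR probe 16 23) (\<lambda>M R t. feasible x (stored_set n M (M 15)) \<and>
      (\<forall>Y. feasible x Y \<longrightarrow> f Y \<le> ((1 + 1 / real N) * real p' + 1 + 7 / 4 * real d + 3 / real N) * f (stored_set n M (M 15))) \<and>
      real t + 2 \<le> 264 * ((real lg + 1)\<^sup>2 * (real n * real d + real n * real N)))) M' R' t2"
  proof (rule wp_params[OF d n, of 23 N N])
    fix R3 t3
    assume env: "env 2 (1 + 1 / real N) V (V / (real n * real N)) (V / (real d * real N)) M' R3" and b: "best V M' R3"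
      and R3: "R3 3 = real n * V" "R3 12 = 0" "R3 13 = real n * V" and t3: "t3 = t2 + 11"
    show "wp x (DoR probe 16 23) (\<lambda>M R t. feasible x (stored_set n M (M 15)) \<and>
      (\<forall>Y. feasible x Y \<longrightarrow> f Y \<le> ((1 + 1 / real N) * real p' + 1 + 7 / 4 * real d + 3 / real N) * f (stored_set n M (M 15))) \<and>
      real t + 2 \<le> 264 * ((real lg + 1)\<^sup>2 * (real n * real d + real n * real N))) M' R3 t3"
    proof (rule wp_search[OF env b R3 n _ N refl N refl refl log_bounds[OF n N lg] lg V], simp, assumption)
      fix V' M4 R4 t4
      assume env4: "env 2 (1 + 1 / real N) V (V / (real n * real N)) (V / (real d * real N)) M4 R4"
        and b4: "best V' M4 R4" and V': "V \<le> V'" and res: "search_result 2 (1 + 1 / real N) (3 / real N) V'"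
        and t4: "t4 \<le> t3 + (lg + 1) * (probe_time N lg + 1)"
      have [simp]: "M4 15 = 30 + n" using env4 by (simp add: env_def)
      have single: "f {u} \<le> V'" if "feasible x {u}" for u
        using V(2)[OF that] V' by simp
      have "1 \<le> n * d" "n \<le> n * d" "d \<le> n * d"
        using n d_pos by (auto simp: Suc_le_eq)
      moreover have "n * (40 + 14 * d) = 40 * n + 14 * (n * d)"
        by (simp add: algebra_simps)
      \<comment> \<open>82 = 13 + 3 + 1 + 40 + 14 + 11: the steps before the search, each bounded by
        a multiple of \<open>n * d\<close>.\<close>
      ultimately have "t4 \<le> 82 * (n * d) + 47 * (n * N) + (lg + 1) * (probe_time N lg + 1)"
        using t1 t2 t3 t4 by linarith
      from total_time_le[OF n N this]
      show "feasible x (stored_set n M4 (M4 15)) \<and>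
      (\<forall>Y. feasible x Y \<longrightarrow> f Y \<le> ((1 + 1 / real N) * real p' + 1 + 7 / 4 * real d + 3 / real N) * f (stored_set n M4 (M4 15))) \<and>
      real t4 + 2 \<le> 264 * ((real lg + 1)\<^sup>2 * (real n * real d + real n * real N))"
        using b4 ratio_singletons[OF res _ single best_feasible_nonneg[OF b4]] by (auto simp: best_def)
    qed
  qed simp
qed

lemma wp_quadratic_com:
  assumes n: "0 < n" and N: "1 \<le> N" and lg: "real n * real d * real N \<le> 2 ^ lg"
  shows "wp x (quadratic_com N) (\<lambda>M R t. feasible x (stored_set n M (M 15)) \<and>
      (\<forall>Y. feasible x Y \<longrightarrow> f Y \<le> ((1 + 1 / real (n * N)) * real p' + 3 / 2 + 13 / 9 * real d + 3 / real N) * f (stored_set n M (M 15))) \<and>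
      real t + 2 \<le> 264 * ((real lg + 1)\<^sup>2 * (real n * real d + real n * real (n * N))))
    (nmem (init_config \<epsilon> x)) (rmem (init_config \<epsilon> x)) 0"
    (is "wp x _ ?Q _ _ _")
  unfolding quadratic_com_def
proof (rule wp_Seq, rule wp_initialise[OF _ n], rule wp_Seq, rule wp_analyse_all[OF _ _ n], assumption, assumption,
    rule wp_Seq, rule wp_all_pairs[OF _ _ n], assumption, assumption, rule wp_Seq)
  fix M R t1 V0 M0 R0 t2 V M' R' t3
  assume t1: "t1 \<le> 0 + 13 + 3 * d" and V0: "f {} \<le> V0" "\<And>u. feasible x {u} \<Longrightarrow> f {u} \<le> V0"
    and t2: "t2 \<le> t1 + 1 + n * (40 + 14 * d)"
    and d: "data 3 n M' R'" "cand V M' R'" and V: "V0 \<le> V"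
      "\<And>u v. \<lbrakk>u \<noteq> v; feasible x {u, v}; kcost u \<le> 3 / 4; kcost v \<le> 3 / 4\<rbrakk> \<Longrightarrow> f {u, v} \<le> V"
    and t3: "t3 \<le> t2 + 1 + n * (3 + 43 * n)"
  have single: "f {u} \<le> V" if "feasible x {u}" for u
    using V0(2)[OF that] V by simp
  have nN: "1 \<le> n * N" using n N by (auto simp: Suc_le_eq)
  show "wp x (params N 15) (wp x (DoR probe 16 23) ?Q) M' R' t3"
  proof (rule wp_params[OF d n, of 15 "n * N" N])
    fix R4 t4
    assume env: "env 3 (1 + 1 / real (n * N)) V (V / (real n * real N)) (V / (real d * real N)) M' R4" and b: "best V M' R4"
      and R4: "R4 3 = real n * V" "R4 12 = 0" "R4 13 = real n * V" and t4: "t4 = t3 + 11"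
    have "f {} \<le> V" using V0 V by simp
    show "wp x (DoR probe 16 23) ?Q M' R4 t4"
    proof (rule wp_search[OF env b R4 n _ nN refl N refl refl log_bounds[OF n N lg] lg \<open>f {} \<le> V\<close> single], simp, assumption)
      fix V' M5 R5 t5
      assume env5: "env 3 (1 + 1 / real (n * N)) V (V / (real n * real N)) (V / (real d * real N)) M5 R5"
        and b5: "best V' M5 R5" and V': "V \<le> V'" and res: "search_result 3 (1 + 1 / real (n * N)) (3 / real N) V'"
        and t5: "t5 \<le> t4 + (lg + 1) * (probe_time (n * N) lg + 1)"
      have [simp]: "M5 15 = 30 + n" using env5 by (simp add: env_def)
      have single': "f {u} \<le> V'" if "feasible x {u}" for u
        using single[OF that] V' by simp
      have pair: "f {u, v} \<le> V'" if "feasible x {u, v}" "kcost u \<le> 3 / 4" "kcost v \<le> 3 / 4" for u v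
        using V(2)[of u v] V' single'[of u] that by (cases "u = v") auto
      have "1 \<le> n * d" "n \<le> n * d" "d \<le> n * d"
        using n d_pos by (auto simp: Suc_le_eq)
      moreover have "n * n \<le> n * (n * N)" "n \<le> n * n" "1 \<le> n * n"
        using n N by auto
      moreover have "n * (40 + 14 * d) = 40 * n + 14 * (n * d)" "n * (3 + 43 * n) = 3 * n + 43 * (n * n)"
        by (auto simp: algebra_simps)
      \<comment> \<open>47 = 1 + 3 + 43 accounts for the test of all pairs.\<close>
      ultimately have "t5 \<le> 82 * (n * d) + 47 * (n * (n * N)) + (lg + 1) * (probe_time (n * N) lg + 1)"
        using t1 t2 t3 t4 t5 by linarith
      from total_time_le[OF n nN this]
      show "?Q M5 R5 t5"
        using b5 ratio_pairs[OF res _ single' best_feasible_nonneg[OF b5] pair] by (auto simp: best_def)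
    qed
  qed simp
qed

text \<open>There are only finitely many feasible sets and at least the empty one, so an optimum
  exists and the bound for all \<open>Y\<close> applies to it.\<close>

lemma approximatesI:
  assumes "feasible x S" "\<And>Y. feasible x Y \<Longrightarrow> f Y \<le> c * f S" "c \<le> c'" "0 < c'"
  shows "approximates (inverse c') x S"
proof -
  have fin: "finite {Y. feasible x Y}"
    by (rule finite_subset[of _ "Pow {..<n}"]) (auto simp: feasible_iff dest: indep_ground)
  then have "finite (f ` {Y. feasible x Y})" "f ` {Y. feasible x Y} \<noteq> {}"
    using feasible_empty by auto
  from Max_in[OF this] obtain Y where Y: "feasible x Y" "f Y = Max (f ` {Y. feasible x Y})"
    by force
  then have "optimal x Y"
    using fin by (auto simp: optimal_def)
  moreover have "f Y \<le> c' * f S"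
    using assms(2)[OF Y(1)] mult_right_mono[OF assms(3), of "f S"] f_nonneg[of S] assms(1) indep_ground
    by (auto simp: feasible_iff)
  then have "inverse c' * f Y \<le> f S"
    using assms(4) by (simp add: field_simps)
  ultimately show ?thesis
    using assms(1) by (auto simp: approximates_def)
qed

text \<open>The guard falls through to \<open>Halt 3\<close> after one step, and the empty set is
  the only feasible one.\<close>

lemma empty_ground:
  assumes n: "n = 0" and t: "2 \<le> t" and c: "1 \<le> c"
  shows "\<exists>S. outputs_within ([NJumpLess 3 0 2, Halt 3] @ P) \<epsilon> x t S \<and> approximates (inverse c) x S"
proof -
  let ?P = "[NJumpLess 3 0 2, Halt 3] @ P"
  have "step ?P x (init_config \<epsilon> x) = (init_config \<epsilon> x)\<lparr>pc := 1\<rparr>"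
    using n by (simp add: step_def init_config_def jump_if_def)
  then have "outputs_within ?P \<epsilon> x t {}"
    unfolding outputs_within_def Let_def using t n
    by (intro exI[of _ 1] exI[of _ 3]) (auto simp: stored_set_def)
  moreover have "approximates (inverse c) x {}"
  proof (rule approximatesI[OF feasible_empty, of 1])
    fix Y assume "feasible x Y"
    then have "Y = {}" using n indep_ground by (auto simp: feasible_iff)
    then show "f Y \<le> 1 * f {}" by simp
  qed (use c in auto)
  ultimately show ?thesis by blast
qed

end

section \<open>Poly-logarithmic bounds on the running time\<close>

definition level_count :: "nat \<Rightarrow> nat \<Rightarrow> nat \<Rightarrow> nat" where
  "level_count n d N = nat \<lceil>log 2 (real n * real d * real N)\<rceil>"

text \<open>This many halvings bring the first width \<open>n * m\<close> down to
  \<open>m / (d * N)\<close>.\<close>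

lemma level_count_ge:
  assumes "0 < n" "0 < d" "0 < N"
  shows "real n * real d * real N \<le> 2 ^ level_count n d N"
proof -
  have "log 2 (real n * real d * real N) \<le> real (level_count n d N)"
    unfolding level_count_def by linarith
  then have "real n * real d * real N \<le> 2 powr real (level_count n d N)"
    using assms by (subst (asm) log_le_iff) auto
  then show ?thesis
    by (simp add: powr_realpow)
qed

lemma level_count_le:
  assumes "0 < n" "0 < d" "0 < N"
  shows "real (level_count n d N) + 1 \<le> log 2 (real n + 2) + log 2 (real d + 2) + log 2 (real N) + 2"
proof -
  have z: "1 \<le> n * d * N" using assms by (auto simp: Suc_le_eq)
  then have "1 \<le> real n * real d * real N" by (metis of_nat_1 of_nat_le_iff of_nat_mult)
  then have "0 \<le> log 2 (real n * real d * real N)" by simp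
  then have "real (level_count n d N) \<le> log 2 (real n * real d * real N) + 1"
    unfolding level_count_def by linarith
  also have "log 2 (real n * real d * real N) = log 2 (real n) + log 2 (real d) + log 2 (real N)"
    using assms by (simp add: log_mult)
  also have "log 2 (real n) \<le> log 2 (real n + 2)" using assms by simp
  also have "log 2 (real d) \<le> log 2 (real d + 2)" using assms by simp
  finally show ?thesis by simp
qed

lemma log2_ge_1: "0 \<le> z \<Longrightarrow> 1 \<le> log 2 (z + 2)"
  using log_le_cancel_iff[of 2 2 "z + 2"] by simp

definition time_bound :: "nat \<Rightarrow> nat \<Rightarrow> nat \<Rightarrow> nat \<Rightarrow> real" where
  "time_bound n d N W = 2 + 264 * ((real (level_count n d N) + 1)\<^sup>2 * (real n * real d + real n * real W))"

text \<open>The factors 7 and 100 leave room for the constant accuracy \<open>N = 100\<close> of the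
  second algorithm, where \<open>log 2 100\<close> is at most 7 and
  \<open>W = n * 100\<close>.\<close>

lemma time_bound_le:
  assumes n: "0 < n" and d: "0 < d" and N: "0 < N"
    and A: "1 \<le> A" "A = log 2 (real n + 2)" and B: "1 \<le> B" "B = log 2 (real d + 2)" and E: "1 \<le> E" "log 2 (real N) \<le> 7 * E"
    and g: "real n * real d + real n * real W \<le> 100 * g" "1 \<le> g"
  shows "time_bound n d N W \<le> (2 + 264 * 121 * 100) * g * (A * B * E) ^ 2"
proof -
  have AB: "1 \<le> A * B" "A \<le> A * B" "B \<le> A * B"
    using A B mult_mono[of 1 A 1 B] mult_left_mono[of 1 B A] mult_right_mono[of 1 A B] by auto
  have ABE: "A * B \<le> A * B * E" "E \<le> A * B * E"
    using AB E mult_left_mono[of 1 E "A * B"] mult_right_mono[of 1 "A * B" E] by auto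
  \<comment> \<open>11 = 1 + 1 + 7 + 2, as \<open>A\<close>, \<open>B\<close>, \<open>E\<close> and
    1 are all at most \<open>A * B * E\<close>.\<close>
  have "real (level_count n d N) + 1 \<le> 11 * (A * B * E)"
    using level_count_le[OF n d N] AB ABE A B E by linarith
  then have "(real (level_count n d N) + 1)\<^sup>2 \<le> (11 * (A * B * E))\<^sup>2"
    by (intro power_mono) auto
  then have "(real (level_count n d N) + 1)\<^sup>2 * (real n * real d + real n * real W) \<le> (11 * (A * B * E))\<^sup>2 * (100 * g)"
    using g by (intro mult_mono) auto
  also have "\<dots> = 121 * 100 * (g * (A * B * E)\<^sup>2)"
    by (simp add: power_mult_distrib)
  finally have 1: "time_bound n d N W \<le> 2 + 264 * (121 * 100 * (g * (A * B * E)\<^sup>2))"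
    unfolding time_bound_def by (intro add_left_mono mult_left_mono) auto
  have "1 \<le> (A * B * E)\<^sup>2"
    using AB ABE by (intro one_le_power) linarith
  then have "1 \<le> g * (A * B * E)\<^sup>2"
    using g mult_mono[of 1 g 1 "(A * B * E)\<^sup>2"] by simp
  moreover have "1 \<le> y \<Longrightarrow> 2 + 264 * (121 * 100 * y) \<le> (2 + 264 * 121 * 100) * y" for y :: real
    by simp
  ultimately have "2 + 264 * (121 * 100 * (g * (A * B * E)\<^sup>2)) \<le> (2 + 264 * 121 * 100) * (g * (A * B * E)\<^sup>2)"
    by blast
  then show ?thesis
    using 1 by (simp only: mult.assoc)
qed

lemma time_bound_linear:
  "(\<lambda>\<epsilon> n d. time_bound n d (nat \<lceil>1 / \<epsilon>\<rceil>) (nat \<lceil>1 / \<epsilon>\<rceil>))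
     \<in> soft_O (\<lambda>\<epsilon> n d. real n * real d + real n / \<epsilon>)"
  unfolding soft_O_def
proof (intro CollectI, rule exI[of _ "2 + 264 * 121 * 100"], rule exI[of _ 2], intro allI impI)
  fix \<epsilon> :: real and n d :: nat
  assume \<epsilon>: "0 < \<epsilon>" and nd: "1 \<le> n" "1 \<le> d"
  define N where "N = nat \<lceil>1 / \<epsilon>\<rceil>"
  have e: "0 < 1 / \<epsilon>" using \<epsilon> by simp
  have N: "0 < N" "real N \<le> 1 / \<epsilon> + 1"
    using e unfolding N_def by linarith+
  \<comment> \<open>Rounding \<open>1 / \<epsilon>\<close> up costs an additional \<open>n\<close>,
    which is absorbed by \<open>n * d\<close>.\<close>
  have "real n * 1 \<le> real n * real d"
    using nd by (intro mult_left_mono) auto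
  then have nn: "real n \<le> real n * real d" "1 \<le> real n" using nd by auto
  show "time_bound n d (nat \<lceil>1 / \<epsilon>\<rceil>) (nat \<lceil>1 / \<epsilon>\<rceil>) \<le> (2 + 264 * 121 * 100) * (real n * real d + real n / \<epsilon>) *
      (log 2 (real n + 2) * log 2 (real d + 2) * log 2 (1 / \<epsilon> + 2)) ^ 2"
    unfolding N_def[symmetric]
  proof (rule time_bound_le)
    have "log 2 (real N) \<le> log 2 (1 / \<epsilon> + 2)"
      using N e by (subst log_le_cancel_iff) linarith+
    then show "log 2 (real N) \<le> 7 * log 2 (1 / \<epsilon> + 2)"
      using log2_ge_1[of "1 / \<epsilon>"] e by linarith
    have "real n * real N \<le> real n * (1 / \<epsilon> + 1)"
      using N by (intro mult_left_mono) auto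
    also have "\<dots> = real n / \<epsilon> + real n"
      by (simp add: algebra_simps)
    finally have "real n * real N \<le> real n / \<epsilon> + real n" .
    moreover have "0 \<le> real n / \<epsilon>" using \<epsilon> by simp
    ultimately show "real n * real d + real n * real N \<le> 100 * (real n * real d + real n / \<epsilon>)"
      using nn unfolding distrib_left by linarith
    show "1 \<le> real n * real d + real n / \<epsilon>"
      using nn \<open>0 \<le> real n / \<epsilon>\<close> by linarith
    show "1 \<le> log 2 (1 / \<epsilon> + 2)"
      using e by (intro log2_ge_1) simp
  qed (use nd N log2_ge_1 in auto)
qed

lemma time_bound_quadratic:
  "(\<lambda>\<epsilon> n d. time_bound n d 100 (n * 100)) \<in> soft_O (\<lambda>\<epsilon> n d. real n ^ 2 + real n * real d)"
  unfolding soft_O_def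
proof (intro CollectI, rule exI[of _ "2 + 264 * 121 * 100"], rule exI[of _ 2], intro allI impI)
  fix \<epsilon> :: real and n d :: nat
  assume \<epsilon>: "0 < \<epsilon>" and nd: "1 \<le> n" "1 \<le> d"
  have E: "1 \<le> log 2 (1 / \<epsilon> + 2)"
    using \<epsilon> by (intro log2_ge_1) simp
  have "log 2 100 \<le> log 2 (2 ^ 7)"
    by (subst log_le_cancel_iff) auto
  then have "log 2 (real 100) \<le> 7 * log 2 (1 / \<epsilon> + 2)"
    using E by (simp del: power_numeral)
  moreover have "1 \<le> n\<^sup>2 + n * d"
    using nd by (auto simp: Suc_le_eq)
  then have "1 \<le> (real n)\<^sup>2 + real n * real d"
    by (metis of_nat_1 of_nat_add of_nat_le_iff of_nat_mult of_nat_power)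
  ultimately show "time_bound n d 100 (n * 100) \<le> (2 + 264 * 121 * 100) * ((real n)\<^sup>2 + real n * real d) *
      (log 2 (real n + 2) * log 2 (real d + 2) * log 2 (1 / \<epsilon> + 2)) ^ 2"
    using nd E log2_ge_1 by (intro time_bound_le) (auto simp: power2_eq_square)
qed

text \<open>The program may depend on \<open>\<epsilon>\<close>, so the rounded
  \<open>1 / \<epsilon>\<close> is a literal in it. The errors \<open>p' / N\<close> and
  \<open>3 / N\<close> are at most \<open>\<epsilon> * p\<close> and \<open>3 * \<epsilon>\<close>,
  which is where the factor \<open>1 + 3 * \<epsilon>\<close> comes from.\<close>

lemma linear_algorithm:
  assumes \<epsilon>: "0 < \<epsilon>"
  defines "N \<equiv> nat \<lceil>1 / \<epsilon>\<rceil>"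
  shows "smks_algorithm ([NJumpLess 3 0 2, Halt 3] @ compile 2 (linear_com N) @ [Halt 15]) \<epsilon>
     (\<lambda>p d. inverse ((1 + 3 * \<epsilon>) * (real p + 1 + 7 / 4 * real d))) (\<lambda>n d. time_bound n d N N)"
  unfolding smks_algorithm_def
proof (intro allI impI)
  fix x assume "smks_instance x"
  then interpret smks_ctx x by unfold_locales
  have e: "0 < 1 / \<epsilon>" using \<epsilon> by simp
  have "0 < N" "1 / \<epsilon> \<le> real N"
    using e unfolding N_def by linarith+
  then have N: "1 \<le> N" "1 / real N \<le> \<epsilon>"
    using \<epsilon> by (auto simp: field_simps)
  let ?c = "(1 + 3 * \<epsilon>) * (real (pparam x) + 1 + 7 / 4 * real d)"
  let ?b = "(1 + 1 / real N) * real p' + 1 + 7 / 4 * real d + 3 / real N"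
  have c: "?b \<le> ?c"
  proof -
    have "1 / real N * real p' \<le> \<epsilon> * real (pparam x)"
      using N \<epsilon> by (intro mult_mono) (auto simp: p'_def)
    moreover have "real p' \<le> real (pparam x)" by (simp add: p'_def)
    moreover have "3 / real N \<le> 3 * \<epsilon>" using N by simp
    moreover have "0 \<le> \<epsilon> * real (pparam x)" "0 \<le> \<epsilon> * real d" using \<epsilon> by auto
    moreover have "?c = real (pparam x) + 1 + 7 / 4 * real d + 3 * (\<epsilon> * real (pparam x)) + 3 * \<epsilon> + 21 / 4 * (\<epsilon> * real d)"
      by (simp add: algebra_simps)
    moreover have "?b = real p' + 1 / real N * real p' + 1 + 7 / 4 * real d + 3 / real N"
      by (simp add: algebra_simps)
    ultimately show ?thesis by linarith
  qed
  have c1: "1 \<le> ?c"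
    using mult_mono[of 1 "1 + 3 * \<epsilon>" 1 "real (pparam x) + 1 + 7 / 4 * real d"] \<epsilon> by simp
  show "\<exists>S. outputs_within ([NJumpLess 3 0 2, Halt 3] @ compile 2 (linear_com N) @ [Halt 15]) \<epsilon> x (time_bound n d N N) S \<and>
      approximates (inverse ?c) x S"
  proof (cases "n = 0")
    case True
    then show ?thesis using c1 by (intro empty_ground) (auto simp: time_bound_def)
  next
    case False
    have d: "0 < d" using d_pos by simp
    show ?thesis
    proof (rule outputs_withinI[OF wp_linear_com[OF _ N(1) level_count_ge]])
      show "real t + 2 \<le> time_bound n d N N \<and> approximates (inverse ?c) x (stored_set n M (M 15))"
        if res: "feasible x (stored_set n M (M 15)) \<and> (\<forall>Y. feasible x Y \<longrightarrow> f Y \<le> ?b * f (stored_set n M (M 15))) \<and>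
          real t + 2 \<le> 264 * ((real (level_count n d N) + 1)\<^sup>2 * (real n * real d + real n * real N))" for M t
      proof
        show "real t + 2 \<le> time_bound n d N N"
          using res unfolding time_bound_def by linarith
        show "approximates (inverse ?c) x (stored_set n M (M 15))"
        proof (rule approximatesI[of _ ?b ?c])
          show "feasible x (stored_set n M (M 15))"
            using res by (rule conjunct1)
          show "f Y \<le> ?b * f (stored_set n M (M 15))" if "feasible x Y" for Y
            using res that by blast
        qed (use c c1 in linarith)+
      qed
    qed (use False d N in auto)
  qed
qed

text \<open>The gap between 3/2 and 1.5556 pays for a fixed accuracy: as \<open>p'\<close> is at
  most \<open>n\<close> and \<open>\<eta> = 1 + 1 / (100 * n)\<close>, the thresholds lose 1/100 and
  the search 3/100. The fixed \<open>N = 100\<close> keeps \<open>1 / \<epsilon>\<close> out of the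
  running time.\<close>

lemma quadratic_algorithm:
  assumes \<epsilon>: "0 < \<epsilon>"
  shows "smks_algorithm ([NJumpLess 3 0 2, Halt 3] @ compile 2 (quadratic_com 100) @ [Halt 15]) \<epsilon>
     (\<lambda>p d. inverse (real p + 1.5556 + 13 / 9 * real d + \<epsilon>)) (\<lambda>n d. time_bound n d 100 (n * 100))"
  unfolding smks_algorithm_def
proof (intro allI impI)
  fix x assume "smks_instance x"
  then interpret smks_ctx x by unfold_locales
  let ?c = "real (pparam x) + 1.5556 + 13 / 9 * real d + \<epsilon>"
  let ?b = "(1 + 1 / real (n * 100)) * real p' + 3 / 2 + 13 / 9 * real d + 3 / real 100"
  have c: "?b \<le> ?c" if "n \<noteq> 0"
  proof -
    have "1 / real (n * 100) * real p' \<le> 1 / 100"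
      using that by (simp add: p'_def field_simps)
    moreover have "real p' \<le> real (pparam x)" by (simp add: p'_def)
    ultimately show ?thesis using \<epsilon> by (simp add: algebra_simps)
  qed
  have c1: "1 \<le> ?c"
    using \<epsilon> by simp
  show "\<exists>S. outputs_within ([NJumpLess 3 0 2, Halt 3] @ compile 2 (quadratic_com 100) @ [Halt 15]) \<epsilon> x (time_bound n d 100 (n * 100)) S \<and>
      approximates (inverse ?c) x S"
  proof (cases "n = 0")
    case True
    then show ?thesis using c1 by (intro empty_ground) (auto simp: time_bound_def)
  next
    case False
    have d: "0 < d" using d_pos by simp
    show ?thesis
    proof (rule outputs_withinI[OF wp_quadratic_com[OF _ _ level_count_ge]])
      show "real t + 2 \<le> time_bound n d 100 (n * 100) \<and> approximates (inverse ?c) x (stored_set n M (M 15))"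
        if res: "feasible x (stored_set n M (M 15)) \<and> (\<forall>Y. feasible x Y \<longrightarrow> f Y \<le> ?b * f (stored_set n M (M 15))) \<and>
          real t + 2 \<le> 264 * ((real (level_count n d 100) + 1)\<^sup>2 * (real n * real d + real n * real (n * 100)))" for M t
      proof
        show "real t + 2 \<le> time_bound n d 100 (n * 100)"
          using res unfolding time_bound_def by linarith
        show "approximates (inverse ?c) x (stored_set n M (M 15))"
        proof (rule approximatesI[of _ ?b ?c])
          show "feasible x (stored_set n M (M 15))"
            using res by (rule conjunct1)
          show "f Y \<le> ?b * f (stored_set n M (M 15))" if "feasible x Y" for Y
            using res that by blast
        qed (use c[OF False] c1 in linarith)+
      qed
    qed (use False d in auto)
  qed
qed

theorem theorem7:
  shows "(\<exists>K\<ge>0. \<exists>T \<in> soft_O (\<lambda>\<epsilon> n d. real n * real d + real n / \<epsilon>). \<forall>\<epsilon>>0. \<exists>P.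
            smks_algorithm P \<epsilon>
              (\<lambda>p d. inverse ((1 + K * \<epsilon>) * (real p + 1 + 7 / 4 * real d))) (T \<epsilon>))
       \<and> (\<exists>T \<in> soft_O (\<lambda>\<epsilon> n d. real n ^ 2 + real n * real d). \<forall>\<epsilon>>0. \<exists>P.
            smks_algorithm P \<epsilon>
              (\<lambda>p d. inverse (real p + 1.5556 + 13 / 9 * real d + \<epsilon>)) (T \<epsilon>))"
proof (intro conjI exI[of _ "3::real"] bexI[OF _ time_bound_linear] bexI[OF _ time_bound_quadratic] allI impI)
  fix \<epsilon> :: real
  assume \<epsilon>: "0 < \<epsilon>"
  show "\<exists>P. smks_algorithm P \<epsilon> (\<lambda>p d. inverse ((1 + 3 * \<epsilon>) * (real p + 1 + 7 / 4 * real d)))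
      (\<lambda>n d. time_bound n d (nat \<lceil>1 / \<epsilon>\<rceil>) (nat \<lceil>1 / \<epsilon>\<rceil>))"
    using linear_algorithm[OF \<epsilon>] by blast
  show "\<exists>P. smks_algorithm P \<epsilon> (\<lambda>p d. inverse (real p + 1.5556 + 13 / 9 * real d + \<epsilon>))
      (\<lambda>n d. time_bound n d 100 (n * 100))"
    using quadratic_algorithm[OF \<epsilon>] by blast
qed simp

end
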